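(* Let $\mathcal{Q}$ be a small quantaloid. Then the quantaloid $\mathcal{Q}\text{-}\mathbf{CCat}$ is a retract of $\mathbf{ChuCon}(\mathcal{Q}\text{-}\mathbf{Dist})^{\mathrm{op}}$ in the category of 2-categories and 2-functors; that is, there are 2-functors $\mathcal{J}:\mathcal{Q}\text{-}\mathbf{CCat}\to\mathbf{ChuCon}(\mathcal{Q}\text{-}\mathbf{Dist})^{\mathrm{op}}$ and $\mathcal{M}:\mathbf{ChuCon}(\mathcal{Q}\text{-}\mathbf{Dist})^{\mathrm{op}}\to\mathcal{Q}\text{-}\mathbf{CCat}$ such that $\mathcal{M}\mathcal{J}$ is naturally isomorphic to the identity 2-functor on $\mathcal{Q}\text{-}\mathbf{CCat}$.
   Context: A quantaloid is a category whose hom-sets are complete lattices and whose composition preserves arbitrary joins in each variable; it is regarded as a locally ordered 2-category (so a 2-functor between quantaloids is a functor that is order-preserving on hom-sets). For arrows $f:X\to Y$, $g:Y\to Z$, $h:X\to Z$ the implications $h\swarrow f:Y\to Z$ and $g\searrow h:X\to Y$ are determined by $g\circ f\leq h\iff g\leq h\swarrow f\iff f\leq g\searrow h$. For a quantaloid $\mathcal{C}$, $\mathcal{C}^{\mathrm{op}}$ is the opposite category with the same order on hom-sets. For a quantaloid $\mathcal{C}$, a Chu connection from $f:X_1\to Y_1$ to $g:X_2\to Y_2$ is a pair of arrows $(u:X_1\to X_2,\ v:Y_1\to Y_2)$ with $f\swarrow u=v\searrow g$. Arrows of $\mathcal{C}$ (as objects) and Chu connections (as morphisms), with componentwise composition,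 identities $(1_X,1_Y)$, and componentwise order and joins, form the quantaloid $\mathbf{ChuCon}(\mathcal{C})$. A $\mathcal{Q}$-category $\mathbb{A}$ is a set $\mathbb{A}_0$ with a type map $t:\mathbb{A}_0\to\mathrm{ob}\,\mathcal{Q}$ and hom-arrows $\mathbb{A}(x,y)\in\mathcal{Q}(tx,ty)$ with $1_{tx}\leq\mathbb{A}(x,x)$ and $\mathbb{A}(y,z)\circ\mathbb{A}(x,y)\leq\mathbb{A}(x,z)$. Its underlying preorder is: $x\leq y$ iff $tx=ty$ and $1_{tx}\leq\mathbb{A}(x,y)$; $\mathbb{A}$ is skeletal if this is a partial order. A $\mathcal{Q}$-functor $F:\mathbb{A}\to\mathbb{B}$ is a type-preserving map with $\mathbb{A}(x,y)\leq\mathbb{B}(Fx,Fy)$; $\mathcal{Q}$-functors are ordered pointwise ($F\le G$ iff $Fx\le Gx$ for all $x$), giving the locally ordered 2-category $\mathcal{Q}\text{-}\mathbf{Cat}$. Adjunctions $F\dashv G$ are taken in this 2-category. A $\mathcal{Q}$-distributor $\phi$ from $\mathbb{A}$ to $\mathbb{B}$ assigns to each $(x,y)\in\mathbb{A}_0\times\mathbb{B}_0$ an arrow $\phi(x,y)\in\mathcal{Q}(tx,ty)$ with $\mathbb{B}(y,y')\circ\phi(x,y)\circ\mathbb{A}(x',x)\leq\phi(x',y')$. With $(\psi\circ\phi)(x,z)=\bigvee_{y}\psi(y,z)\circ\phi(x,y)$, identities $\mathbb{A}$ (the hom-arrows) and the pointwise order, $\mathcal{Q}$-categories and $\mathcal{Q}$-distributors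 form a quantaloid $\mathcal{Q}\text{-}\mathbf{Dist}$. For $X\in\mathrm{ob}\,\mathcal{Q}$, $*_X$ is the $\mathcal{Q}$-category with one object, of type $X$, and hom-arrow $1_X$. $\mathcal{P}\mathbb{A}$ is the $\mathcal{Q}$-category whose objects of type $X$ are the $\mathcal{Q}$-distributors $\mu$ from $\mathbb{A}$ to $*_X$, with $\mathcal{P}\mathbb{A}(\mu,\mu')=\mu'\swarrow\mu$. $\mathbb{A}$ is complete if the Yoneda embedding $\mathbb{A}\to\mathcal{P}\mathbb{A}$, $x\mapsto\mathbb{A}(-,x)$, has a left adjoint in $\mathcal{Q}\text{-}\mathbf{Cat}$. $\mathcal{Q}\text{-}\mathbf{CCat}$ is the quantaloid of skeletal complete $\mathcal{Q}$-categories and left adjoint $\mathcal{Q}$-functors, with the pointwise order. *)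

theory Defs
  imports "HOL-Algebra.Complete_Lattice" "HOL-Library.Equipollence" "HOL-Library.FuncSet"
begin

text \<open>Hom-sets form an indexed family of ordered sets and need not be disjoint, so composition is
  indexed by the objects involved: \<open>Cmp C X Y Z g f\<close> is the composite of \<open>f : X \<rightarrow> Y\<close>
  and \<open>g : Y \<rightarrow> Z\<close>.\<close>

record ('o, 'm) locat =
  Ob :: "'o set"
  Hom :: "'o \<Rightarrow> 'o \<Rightarrow> 'm gorder"
  Idt :: "'o \<Rightarrow> 'm"
  Cmp :: "'o \<Rightarrow> 'o \<Rightarrow> 'o \<Rightarrow> 'm \<Rightarrow> 'm \<Rightarrow> 'm"

locale locally_ordered_category =
  fixes C :: "('o, 'm) locat"
  assumes hom_order: "\<lbrakk>X \<in> Ob C; Y \<in> Ob C\<rbrakk> \<Longrightarrow> partial_order (Hom C X Y)"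
    and idt_in_hom: "X \<in> Ob C \<Longrightarrow> Idt C X \<in> carrier (Hom C X X)"
    and cmp_in_hom: "\<lbrakk>X \<in> Ob C; Y \<in> Ob C; Z \<in> Ob C;
        f \<in> carrier (Hom C X Y); g \<in> carrier (Hom C Y Z)\<rbrakk>
      \<Longrightarrow> Cmp C X Y Z g f \<in> carrier (Hom C X Z)"
    and cmp_idt_left: "\<lbrakk>X \<in> Ob C; Y \<in> Ob C; f \<in> carrier (Hom C X Y)\<rbrakk>
      \<Longrightarrow> Cmp C X Y Y (Idt C Y) f = f"
    and cmp_idt_right: "\<lbrakk>X \<in> Ob C; Y \<in> Ob C; f \<in> carrier (Hom C X Y)\<rbrakk>
      \<Longrightarrow> Cmp C X X Y f (Idt C X) = f"
    and cmp_assoc: "\<lbrakk>W \<in> Ob C; X \<in> Ob C; Y \<in> Ob C; Z \<in> Ob C;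
        f \<in> carrier (Hom C W X); g \<in> carrier (Hom C X Y); h \<in> carrier (Hom C Y Z)\<rbrakk>
      \<Longrightarrow> Cmp C W Y Z h (Cmp C W X Y g f) = Cmp C W X Z (Cmp C X Y Z h g) f"
    and cmp_mono: "\<lbrakk>X \<in> Ob C; Y \<in> Ob C; Z \<in> Ob C;
        f \<in> carrier (Hom C X Y); f' \<in> carrier (Hom C X Y); f \<sqsubseteq>\<^bsub>Hom C X Y\<^esub> f';
        g \<in> carrier (Hom C Y Z); g' \<in> carrier (Hom C Y Z); g \<sqsubseteq>\<^bsub>Hom C Y Z\<^esub> g'\<rbrakk>
      \<Longrightarrow> Cmp C X Y Z g f \<sqsubseteq>\<^bsub>Hom C X Z\<^esub> Cmp C X Y Z g' f'"

locale quantaloid = locally_ordered_category Q for Q :: "('o, 'm) locat" +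
  assumes hom_complete: "\<lbrakk>X \<in> Ob Q; Y \<in> Ob Q\<rbrakk> \<Longrightarrow> complete_lattice (Hom Q X Y)"
    and cmp_sup_right: "\<lbrakk>X \<in> Ob Q; Y \<in> Ob Q; Z \<in> Ob Q; g \<in> carrier (Hom Q Y Z)\<rbrakk>
      \<Longrightarrow> sup_pres (Hom Q X Y) (Hom Q X Z) (\<lambda>f. Cmp Q X Y Z g f)"
    and cmp_sup_left: "\<lbrakk>X \<in> Ob Q; Y \<in> Ob Q; Z \<in> Ob Q; f \<in> carrier (Hom Q X Y)\<rbrakk>
      \<Longrightarrow> sup_pres (Hom Q Y Z) (Hom Q X Z) (\<lambda>g. Cmp Q X Y Z g f)"

definition arrows :: "('o, 'm) locat \<Rightarrow> 'm set" where
  "arrows C = (\<Union>X\<in>Ob C. \<Union>Y\<in>Ob C. carrier (Hom C X Y))"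

definition opposite :: "('o, 'm) locat \<Rightarrow> ('o, 'm) locat" where
  "opposite C =
    \<lparr>Ob = Ob C, Hom = (\<lambda>X Y. Hom C Y X), Idt = Idt C, Cmp = (\<lambda>X Y Z g f. Cmp C Z Y X f g)\<rparr>"

text \<open>The two implications, as the arrows determined by the adjunction property.  The parameters
  are the hom-sets \<open>K\<close> in which the implication lives and \<open>L\<close> in which composites live,
  and composition \<open>c g f\<close>; separate parameters allow a use across different types of objects.\<close>

definition left_implication ::
  "'k gorder \<Rightarrow> 'l gorder \<Rightarrow> ('k \<Rightarrow> 'f \<Rightarrow> 'l) \<Rightarrow> 'l \<Rightarrow> 'f \<Rightarrow> 'k" where
  "left_implication K L c h f =
    (THE k. k \<in> carrier K \<and> (\<forall>g\<in>carrier K. c g f \<sqsubseteq>\<^bsub>L\<^esub> h \<longleftrightarrow> g \<sqsubseteq>\<^bsub>K\<^esub> k))"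

definition right_implication ::
  "'k gorder \<Rightarrow> 'l gorder \<Rightarrow> ('g \<Rightarrow> 'k \<Rightarrow> 'l) \<Rightarrow> 'g \<Rightarrow> 'l \<Rightarrow> 'k" where
  "right_implication K L c g h =
    (THE k. k \<in> carrier K \<and> (\<forall>f\<in>carrier K. c g f \<sqsubseteq>\<^bsub>L\<^esub> h \<longleftrightarrow> f \<sqsubseteq>\<^bsub>K\<^esub> k))"

text \<open>For \<open>f : X \<rightarrow> Y\<close>, \<open>g : Y \<rightarrow> Z\<close> and \<open>h : X \<rightarrow> Z\<close>, \<open>limp C X Y Z h f\<close> is
  \<open>h \<swarrow> f : Y \<rightarrow> Z\<close> and \<open>rimp C X Y Z g h\<close> is \<open>g \<searrow> h : X \<rightarrow> Y\<close>.\<close>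

definition limp :: "('o, 'm) locat \<Rightarrow> 'o \<Rightarrow> 'o \<Rightarrow> 'o \<Rightarrow> 'm \<Rightarrow> 'm \<Rightarrow> 'm" where
  "limp C X Y Z h f = left_implication (Hom C Y Z) (Hom C X Z) (Cmp C X Y Z) h f"

definition rimp :: "('o, 'm) locat \<Rightarrow> 'o \<Rightarrow> 'o \<Rightarrow> 'o \<Rightarrow> 'm \<Rightarrow> 'm \<Rightarrow> 'm" where
  "rimp C X Y Z g h = right_implication (Hom C X Y) (Hom C X Z) (Cmp C X Y Z) g h"

record ('o1, 'm1, 'o2, 'm2) functor_data =
  on_ob :: "'o1 \<Rightarrow> 'o2"
  on_hom :: "'o1 \<Rightarrow> 'o1 \<Rightarrow> 'm1 \<Rightarrow> 'm2"

locale two_functor = C: locally_ordered_category C + D: locally_ordered_category D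
  for C :: "('o1, 'm1) locat" and D :: "('o2, 'm2) locat" +
  fixes F :: "('o1, 'm1, 'o2, 'm2) functor_data"
  assumes ob: "X \<in> Ob C \<Longrightarrow> on_ob F X \<in> Ob D"
    and hom: "\<lbrakk>X \<in> Ob C; Y \<in> Ob C; f \<in> carrier (Hom C X Y)\<rbrakk>
      \<Longrightarrow> on_hom F X Y f \<in> carrier (Hom D (on_ob F X) (on_ob F Y))"
    and idt: "X \<in> Ob C \<Longrightarrow> on_hom F X X (Idt C X) = Idt D (on_ob F X)"
    and cmp: "\<lbrakk>X \<in> Ob C; Y \<in> Ob C; Z \<in> Ob C;
        f \<in> carrier (Hom C X Y); g \<in> carrier (Hom C Y Z)\<rbrakk>
      \<Longrightarrow> on_hom F X Z (Cmp C X Y Z g f)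
        = Cmp D (on_ob F X) (on_ob F Y) (on_ob F Z) (on_hom F Y Z g) (on_hom F X Y f)"
    and mono: "\<lbrakk>X \<in> Ob C; Y \<in> Ob C; f \<in> carrier (Hom C X Y); f' \<in> carrier (Hom C X Y);
        f \<sqsubseteq>\<^bsub>Hom C X Y\<^esub> f'\<rbrakk>
      \<Longrightarrow> on_hom F X Y f \<sqsubseteq>\<^bsub>Hom D (on_ob F X) (on_ob F Y)\<^esub> on_hom F X Y f'"

definition id_functor :: "('o, 'm, 'o, 'm) functor_data" where
  "id_functor = \<lparr>on_ob = (\<lambda>X. X), on_hom = (\<lambda>X Y f. f)\<rparr>"

definition comp_functor ::
  "('o2, 'm2, 'o3, 'm3) functor_data \<Rightarrow> ('o1, 'm1, 'o2, 'm2) functor_data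
    \<Rightarrow> ('o1, 'm1, 'o3, 'm3) functor_data" where
  "comp_functor G F =
    \<lparr>on_ob = (\<lambda>X. on_ob G (on_ob F X)),
     on_hom = (\<lambda>X Y f. on_hom G (on_ob F X) (on_ob F Y) (on_hom F X Y f))\<rparr>"

definition isomorphism :: "('o, 'm) locat \<Rightarrow> 'o \<Rightarrow> 'o \<Rightarrow> 'm \<Rightarrow> bool" where
  "isomorphism C X Y f \<longleftrightarrow> f \<in> carrier (Hom C X Y) \<and>
    (\<exists>g\<in>carrier (Hom C Y X). Cmp C X Y X g f = Idt C X \<and> Cmp C Y X Y f g = Idt C Y)"

text \<open>Since 2-cells are inequalities, naturality on arrows is already 2-naturality.\<close>

definition naturally_isomorphic ::
  "('o1, 'm1) locat \<Rightarrow> ('o2, 'm2) locat \<Rightarrow> ('o1, 'm1, 'o2, 'm2) functor_data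
    \<Rightarrow> ('o1, 'm1, 'o2, 'm2) functor_data \<Rightarrow> bool" where
  "naturally_isomorphic C D F G \<longleftrightarrow>
    (\<exists>\<alpha>. (\<forall>X\<in>Ob C. isomorphism D (on_ob F X) (on_ob G X) (\<alpha> X)) \<and>
      (\<forall>X\<in>Ob C. \<forall>Y\<in>Ob C. \<forall>f\<in>carrier (Hom C X Y).
        Cmp D (on_ob F X) (on_ob F Y) (on_ob G Y) (\<alpha> Y) (on_hom F X Y f)
          = Cmp D (on_ob F X) (on_ob G X) (on_ob G Y) (on_hom G X Y f) (\<alpha> X)))"

text \<open>An object \<open>(X, Y, f)\<close> is an arrow \<open>f : X \<rightarrow> Y\<close> of \<open>C\<close>.\<close>

definition ChuCon :: "('o, 'm) locat \<Rightarrow> ('o \<times> 'o \<times> 'm, 'm \<times> 'm) locat" where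
  "ChuCon C =
    \<lparr>Ob = {(X, Y, f). X \<in> Ob C \<and> Y \<in> Ob C \<and> f \<in> carrier (Hom C X Y)},
     Hom = (\<lambda>(X1, Y1, f) (X2, Y2, g).
       \<lparr>carrier = {(u, v). u \<in> carrier (Hom C X1 X2) \<and> v \<in> carrier (Hom C Y1 Y2)
           \<and> limp C X1 X2 Y1 f u = rimp C X2 Y1 Y2 v g},
        eq = (=),
        le = (\<lambda>(u, v) (u', v'). u \<sqsubseteq>\<^bsub>Hom C X1 X2\<^esub> u' \<and> v \<sqsubseteq>\<^bsub>Hom C Y1 Y2\<^esub> v')\<rparr>),
     Idt = (\<lambda>(X, Y, f). (Idt C X, Idt C Y)),
     Cmp = (\<lambda>(X1, Y1, f) (X2, Y2, g) (X3, Y3, h) (u', v') (u, v).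
       (Cmp C X1 X2 X3 u' u, Cmp C Y1 Y2 Y3 v' v))\<rparr>"

text \<open>Structure maps, functors and distributors are extensional (fixed outside the object sets), so
  that equality in HOL is equality of the set-based objects.\<close>

record ('a, 'o, 'm) qcat =
  objs :: "'a set"
  qtyp :: "'a \<Rightarrow> 'o"
  qhom :: "'a \<times> 'a \<Rightarrow> 'm"

definition is_qcat :: "('o, 'm) locat \<Rightarrow> ('a, 'o, 'm) qcat \<Rightarrow> bool" where
  "is_qcat Q A \<longleftrightarrow>
    qtyp A \<in> objs A \<rightarrow>\<^sub>E Ob Q \<and>
    qhom A \<in> (\<Pi>\<^sub>E (x, y)\<in>objs A \<times> objs A. carrier (Hom Q (qtyp A x) (qtyp A y))) \<and>
    (\<forall>x\<in>objs A. Idt Q (qtyp A x) \<sqsubseteq>\<^bsub>Hom Q (qtyp A x) (qtyp A x)\<^esub> qhom A (x, x)) \<and>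
    (\<forall>x\<in>objs A. \<forall>y\<in>objs A. \<forall>z\<in>objs A.
      Cmp Q (qtyp A x) (qtyp A y) (qtyp A z) (qhom A (y, z)) (qhom A (x, y))
        \<sqsubseteq>\<^bsub>Hom Q (qtyp A x) (qtyp A z)\<^esub> qhom A (x, z))"

definition underlying_le :: "('o, 'm) locat \<Rightarrow> ('a, 'o, 'm) qcat \<Rightarrow> 'a \<Rightarrow> 'a \<Rightarrow> bool" where
  "underlying_le Q A x y \<longleftrightarrow>
    qtyp A x = qtyp A y \<and> Idt Q (qtyp A x) \<sqsubseteq>\<^bsub>Hom Q (qtyp A x) (qtyp A y)\<^esub> qhom A (x, y)"

definition skeletal :: "('o, 'm) locat \<Rightarrow> ('a, 'o, 'm) qcat \<Rightarrow> bool" where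
  "skeletal Q A \<longleftrightarrow>
    (\<forall>x\<in>objs A. \<forall>y\<in>objs A. underlying_le Q A x y \<and> underlying_le Q A y x \<longrightarrow> x = y)"

definition is_qfunctor ::
  "('o, 'm) locat \<Rightarrow> ('a, 'o, 'm) qcat \<Rightarrow> ('b, 'o, 'm) qcat \<Rightarrow> ('a \<Rightarrow> 'b) \<Rightarrow> bool" where
  "is_qfunctor Q A B F \<longleftrightarrow>
    F \<in> objs A \<rightarrow>\<^sub>E objs B \<and>
    (\<forall>x\<in>objs A. qtyp B (F x) = qtyp A x) \<and>
    (\<forall>x\<in>objs A. \<forall>y\<in>objs A. qhom A (x, y) \<sqsubseteq>\<^bsub>Hom Q (qtyp A x) (qtyp A y)\<^esub> qhom B (F x, F y))"

definition qfunctor_le ::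
  "('o, 'm) locat \<Rightarrow> ('a, 'o, 'm) qcat \<Rightarrow> ('b, 'o, 'm) qcat \<Rightarrow> ('a \<Rightarrow> 'b) \<Rightarrow> ('a \<Rightarrow> 'b) \<Rightarrow> bool"
  where
  "qfunctor_le Q A B F G \<longleftrightarrow> (\<forall>x\<in>objs A. underlying_le Q B (F x) (G x))"

text \<open>\<open>F \<stileturn> G\<close> for \<open>F : A \<rightarrow> B\<close>; the triangle identities hold automatically up to the equivalence
  of the hom-preorders.\<close>

definition qadjunction ::
  "('o, 'm) locat \<Rightarrow> ('a, 'o, 'm) qcat \<Rightarrow> ('b, 'o, 'm) qcat \<Rightarrow> ('a \<Rightarrow> 'b) \<Rightarrow> ('b \<Rightarrow> 'a) \<Rightarrow> bool"
  where
  "qadjunction Q A B F G \<longleftrightarrow>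
    is_qfunctor Q A B F \<and> is_qfunctor Q B A G \<and>
    qfunctor_le Q A A (\<lambda>x\<in>objs A. x) (compose (objs A) G F) \<and>
    qfunctor_le Q B B (compose (objs B) F G) (\<lambda>y\<in>objs B. y)"

definition left_adjoint ::
  "('o, 'm) locat \<Rightarrow> ('a, 'o, 'm) qcat \<Rightarrow> ('b, 'o, 'm) qcat \<Rightarrow> ('a \<Rightarrow> 'b) \<Rightarrow> bool" where
  "left_adjoint Q A B F \<longleftrightarrow> (\<exists>G. qadjunction Q A B F G)"

definition dist_hom ::
  "('o, 'm) locat \<Rightarrow> ('a, 'o, 'm) qcat \<Rightarrow> ('b, 'o, 'm) qcat \<Rightarrow> ('a \<times> 'b \<Rightarrow> 'm) gorder" where
  "dist_hom Q A B =
    \<lparr>carrier = {\<phi> \<in> (\<Pi>\<^sub>E (x, y)\<in>objs A \<times> objs B. carrier (Hom Q (qtyp A x) (qtyp B y))).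
       \<forall>x\<in>objs A. \<forall>x'\<in>objs A. \<forall>y\<in>objs B. \<forall>y'\<in>objs B.
         Cmp Q (qtyp A x') (qtyp A x) (qtyp B y')
             (Cmp Q (qtyp A x) (qtyp B y) (qtyp B y') (qhom B (y, y')) (\<phi> (x, y))) (qhom A (x', x))
           \<sqsubseteq>\<^bsub>Hom Q (qtyp A x') (qtyp B y')\<^esub> \<phi> (x', y')},
     eq = (=),
     le = (\<lambda>\<phi> \<psi>. \<forall>x\<in>objs A. \<forall>y\<in>objs B. \<phi> (x, y) \<sqsubseteq>\<^bsub>Hom Q (qtyp A x) (qtyp B y)\<^esub> \<psi> (x, y))\<rparr>"

definition dist_comp ::
  "('o, 'm) locat \<Rightarrow> ('a, 'o, 'm) qcat \<Rightarrow> ('b, 'o, 'm) qcat \<Rightarrow> ('c, 'o, 'm) qcat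
    \<Rightarrow> ('b \<times> 'c \<Rightarrow> 'm) \<Rightarrow> ('a \<times> 'b \<Rightarrow> 'm) \<Rightarrow> ('a \<times> 'c \<Rightarrow> 'm)" where
  "dist_comp Q A B C \<psi> \<phi> =
    (\<lambda>(x, z)\<in>objs A \<times> objs C. \<Squnion>\<^bsub>Hom Q (qtyp A x) (qtyp C z)\<^esub>
      ((\<lambda>y. Cmp Q (qtyp A x) (qtyp B y) (qtyp C z) (\<psi> (y, z)) (\<phi> (x, y))) ` objs B))"

definition star :: "('o, 'm) locat \<Rightarrow> 'o \<Rightarrow> (unit, 'o, 'm) qcat" where
  "star Q X = \<lparr>objs = {()}, qtyp = (\<lambda>_. X), qhom = (\<lambda>_. Idt Q X)\<rparr>"

text \<open>An object \<open>(X, \<mu>)\<close> of the presheaf category is a distributor \<open>\<mu>\<close> from \<open>A\<close> to \<open>star Q X\<close>.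
  The implication of two of these is a distributor between one-object categories, that is, a
  single arrow of \<open>Q\<close>.\<close>

definition presheaves ::
  "('o, 'm) locat \<Rightarrow> ('a, 'o, 'm) qcat \<Rightarrow> ('o \<times> ('a \<times> unit \<Rightarrow> 'm), 'o, 'm) qcat" where
  "presheaves Q A = (let P = {(X, \<mu>). X \<in> Ob Q \<and> \<mu> \<in> carrier (dist_hom Q A (star Q X))} in
    \<lparr>objs = P,
     qtyp = (\<lambda>(X, \<mu>)\<in>P. X),
     qhom = (\<lambda>((X, \<mu>), (X', \<mu>'))\<in>P \<times> P.
       left_implication (dist_hom Q (star Q X) (star Q X')) (dist_hom Q A (star Q X'))
         (dist_comp Q A (star Q X) (star Q X')) \<mu>' \<mu> ((), ()))\<rparr>)"

definition yoneda ::
  "('a, 'o, 'm) qcat \<Rightarrow> 'a \<Rightarrow> 'o \<times> ('a \<times> unit \<Rightarrow> 'm)" where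
  "yoneda A = (\<lambda>x\<in>objs A. (qtyp A x, \<lambda>(a, _)\<in>objs A \<times> {()}. qhom A (a, x)))"

definition complete_qcat :: "('o, 'm) locat \<Rightarrow> ('a, 'o, 'm) qcat \<Rightarrow> bool" where
  "complete_qcat Q A \<longleftrightarrow> (\<exists>S. qadjunction Q (presheaves Q A) A S (yoneda A))"

text \<open>The type \<open>'u\<close> plays the role of the universe of sets: a small set is one of cardinality strictly
  below that of \<open>'u\<close>, and small sets are closed under the formation of power sets.  The
  universe \<open>V\<^sub>\<kappa>\<close> of a strongly inaccessible \<open>\<kappa>\<close> is of this kind, its elements being exactly
  its subsets of cardinality below \<open>\<kappa>\<close>.  Closure under power sets forces \<open>'u\<close> to be infinite.\<close>

definition set_universe :: "'u itself \<Rightarrow> bool" where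
  "set_universe U \<longleftrightarrow> (\<forall>S :: 'u set. S \<prec> (UNIV :: 'u set) \<longrightarrow> Pow S \<prec> (UNIV :: 'u set))"

definition small_quantaloid :: "'u itself \<Rightarrow> ('o, 'm) locat \<Rightarrow> bool" where
  "small_quantaloid U Q \<longleftrightarrow>
    quantaloid Q \<and> Ob Q \<prec> (UNIV :: 'u set) \<and> arrows Q \<prec> (UNIV :: 'u set)"

definition Dist :: "('o, 'm) locat \<Rightarrow> (('u, 'o, 'm) qcat, 'u \<times> 'u \<Rightarrow> 'm) locat" where
  "Dist Q =
    \<lparr>Ob = {A. is_qcat Q A \<and> objs A \<prec> (UNIV :: 'u set)},
     Hom = dist_hom Q, Idt = qhom, Cmp = dist_comp Q\<rparr>"

definition CCat :: "('o, 'm) locat \<Rightarrow> (('u, 'o, 'm) qcat, 'u \<Rightarrow> 'u) locat" where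
  "CCat Q =
    \<lparr>Ob = {A. is_qcat Q A \<and> objs A \<prec> (UNIV :: 'u set) \<and> skeletal Q A \<and> complete_qcat Q A},
     Hom = (\<lambda>A B. \<lparr>carrier = {F. left_adjoint Q A B F}, eq = (=), le = qfunctor_le Q A B\<rparr>),
     Idt = (\<lambda>A. \<lambda>x\<in>objs A. x),
     Cmp = (\<lambda>A B C G F. compose (objs A) G F)\<rparr>"

end

theory Submission
  imports Defs
begin

text \<open>The functor \<open>M\<close> sends an arrow \<open>\<phi> : A \<rightarrow> B\<close> of \<open>Dist Q\<close> to the \<open>Q\<close>-category of its closed copresheaves
(formal concepts): the distributors \<open>\<nu>\<close> from a one-object category to \<open>B\<close> of the form \<open>\<phi> \<swarrow> \<mu>\<close>.
They are the fixed points of the closure operator \<open>\<nu> \<mapsto> \<phi> \<swarrow> (\<nu> \<searrow> \<phi>)\<close>, and the hom-arrow from \<open>\<nu>\<close> to \<open>\<xi>\<close> is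
\<open>\<xi> \<searrow> \<nu>\<close>.  This category is skeletal because \<open>\<nu>\<close> lies below \<open>\<xi>\<close> exactly when \<open>\<xi> \<le> \<nu>\<close> as distributors,
and it is complete because an implication \<open>(\<phi> \<swarrow> \<upsilon>) \<swarrow> \<theta>\<close> is again of the form \<open>\<phi> \<swarrow> (\<theta> \<circ> \<upsilon>)\<close>: the weighted
supremum of a presheaf \<open>\<theta>\<close> is \<open>\<Lambda> \<swarrow> \<theta>\<close>, where \<open>\<Lambda>\<close> is the distributor whose rows are all the closed
copresheaves (\<open>complete_fixpoint_cat\<close>).

A Chu connection \<open>(u, v)\<close> from \<open>\<phi>\<close> to \<open>\<psi>\<close> acts contravariantly by \<open>\<nu> \<mapsto> v \<searrow> \<nu>\<close>.  The equation
\<open>\<phi> \<swarrow> u = v \<searrow> \<psi>\<close> is what makes this map preserve closedness: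
\<open>v \<searrow> (\<psi> \<swarrow> \<mu>) = (v \<searrow> \<psi>) \<swarrow> \<mu> = (\<phi> \<swarrow> u) \<swarrow> \<mu> = \<phi> \<swarrow> (\<mu> \<circ> u)\<close>.  The map has a right adjoint, which sends \<open>\<xi>\<close> to the
closure of \<open>v \<circ> \<xi>\<close> (\<open>left_adjoint_fixpoint_map\<close>).  Functoriality is the law
\<open>v \<searrow> (w \<searrow> \<nu>) = (w \<circ> v) \<searrow> \<nu>\<close>, and order preservation is the antitonicity of \<open>\<searrow>\<close> in its first argument
together with the reversal of the order in the category of closed copresheaves.

The functor \<open>J\<close> sends \<open>A\<close> to its identity distributor.  A left adjoint \<open>F\<close> from \<open>A\<close> to \<open>B\<close>, with right adjoint
\<open>G\<close>, goes to the pair of distributors \<open>B(y, F x)\<close> and \<open>A(G y, x)\<close>, both from \<open>B\<close> to \<open>A\<close>; the Chu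
condition for this pair is the adjointness \<open>B(F x, y) = A(x, G y)\<close> (\<open>chu_connection_left_adjoint\<close>).

The closed copresheaves of the identity distributor of \<open>A\<close> are the distributors \<open>A \<swarrow> \<mu>\<close>.  If \<open>A\<close> is complete,
these are exactly the corepresentable ones \<open>A(s, -)\<close>, with \<open>s\<close> the supremum of \<open>\<mu>\<close>.  Hence \<open>s \<mapsto> A(s, -)\<close> is
an isomorphism from \<open>A\<close> to \<open>M (J A)\<close>, and it is natural because \<open>A(G y, -) \<searrow> A(s, -)\<close> is
\<open>A(s, G y) = B(F s, y)\<close>.

The size condition matters in one place: the closed copresheaves form a set of functions, which has to be coded
by elements of the universe.  There are fewer of them than elements of the universe, as products and power
sets of small sets are small (\<open>closed_copresheaves_small\<close>).

All laws for distributors are proved for \<open>Q\<close>-categories over arbitrary types, so that they apply to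
distributors to and from the one-object categories \<open>star Q X\<close> as well.\<close>

section \<open>Arrows of a quantaloid\<close>

context quantaloid
begin

abbreviation arr :: "'o \<Rightarrow> 'o \<Rightarrow> 'm set" where
  "arr X Y \<equiv> carrier (Hom Q X Y)"

abbreviation arr_le :: "'m \<Rightarrow> 'o \<Rightarrow> 'o \<Rightarrow> 'm \<Rightarrow> bool"
    (\<open>_ \<preceq>\<^bsub>_\<rightarrow>_\<^esub> _\<close> [51, 0, 0, 51] 50) where
  "f \<preceq>\<^bsub>X\<rightarrow>Y\<^esub> g \<equiv> f \<sqsubseteq>\<^bsub>Hom Q X Y\<^esub> g"

lemma arr_refl [simp]: "X \<in> Ob Q \<Longrightarrow> Y \<in> Ob Q \<Longrightarrow> f \<in> arr X Y \<Longrightarrow> f \<preceq>\<^bsub>X\<rightarrow>Y\<^esub> f"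
  using hom_order[of X Y] by (auto simp: partial_order_def weak_partial_order_def weak_partial_order_axioms_def)

lemma arr_trans:
  assumes "f \<preceq>\<^bsub>X\<rightarrow>Y\<^esub> g" "g \<preceq>\<^bsub>X\<rightarrow>Y\<^esub> h" "X \<in> Ob Q" "Y \<in> Ob Q" "f \<in> arr X Y" "g \<in> arr X Y" "h \<in> arr X Y"
  shows "f \<preceq>\<^bsub>X\<rightarrow>Y\<^esub> h"
proof -
  interpret partial_order "Hom Q X Y" using assms by (simp add: hom_order)
  show ?thesis using assms le_trans by blast
qed

lemma arr_antisym:
  assumes "f \<preceq>\<^bsub>X\<rightarrow>Y\<^esub> g" "g \<preceq>\<^bsub>X\<rightarrow>Y\<^esub> f" "X \<in> Ob Q" "Y \<in> Ob Q" "f \<in> arr X Y" "g \<in> arr X Y"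
  shows "f = g"
proof -
  interpret partial_order "Hom Q X Y" using assms by (simp add: hom_order)
  show ?thesis using assms by blast
qed

lemma arr_eqI_upper:
  assumes "X \<in> Ob Q" "Y \<in> Ob Q" "f \<in> arr X Y" "g \<in> arr X Y"
    and "\<And>k. k \<in> arr X Y \<Longrightarrow> f \<preceq>\<^bsub>X\<rightarrow>Y\<^esub> k \<longleftrightarrow> g \<preceq>\<^bsub>X\<rightarrow>Y\<^esub> k"
  shows "f = g"
  using assms arr_antisym arr_refl by metis

abbreviation arr_Sup :: "'o \<Rightarrow> 'o \<Rightarrow> 'm set \<Rightarrow> 'm" where
  "arr_Sup X Y S \<equiv> \<Squnion>\<^bsub>Hom Q X Y\<^esub> S"

lemma arr_Sup_in:
  assumes "X \<in> Ob Q" "Y \<in> Ob Q" "S \<subseteq> arr X Y" shows "arr_Sup X Y S \<in> arr X Y"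
proof -
  interpret complete_lattice "Hom Q X Y" using assms by (simp add: hom_complete)
  show ?thesis using assms by simp
qed

lemma arr_Sup_le_iff:
  assumes "X \<in> Ob Q" "Y \<in> Ob Q" "S \<subseteq> arr X Y" "k \<in> arr X Y"
  shows "arr_Sup X Y S \<preceq>\<^bsub>X\<rightarrow>Y\<^esub> k \<longleftrightarrow> (\<forall>s\<in>S. s \<preceq>\<^bsub>X\<rightarrow>Y\<^esub> k)"
proof -
  interpret complete_lattice "Hom Q X Y" using assms by (simp add: hom_complete)
  show ?thesis
    using assms sup_upper sup_least sup_closed le_trans by (meson subsetD)
qed

lemma arr_Sup_upper:
  assumes "s \<in> S" "X \<in> Ob Q" "Y \<in> Ob Q" "S \<subseteq> arr X Y"
  shows "s \<preceq>\<^bsub>X\<rightarrow>Y\<^esub> arr_Sup X Y S"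
  using arr_Sup_le_iff[of X Y S "arr_Sup X Y S"] arr_Sup_in[of X Y S] assms by auto

lemma cmp_Sup_right_le_iff:
  assumes "X \<in> Ob Q" "Y \<in> Ob Q" "Z \<in> Ob Q" "g \<in> arr Y Z" "S \<subseteq> arr X Y" "k \<in> arr X Z"
  shows "Cmp Q X Y Z g (arr_Sup X Y S) \<preceq>\<^bsub>X\<rightarrow>Z\<^esub> k \<longleftrightarrow> (\<forall>s\<in>S. Cmp Q X Y Z g s \<preceq>\<^bsub>X\<rightarrow>Z\<^esub> k)"
proof -
  have "Cmp Q X Y Z g (arr_Sup X Y S) = arr_Sup X Z ((\<lambda>f. Cmp Q X Y Z g f) ` S)"
    using cmp_sup_right[of X Y Z g] assms by (simp add: sup_pres_def)
  moreover have "(\<lambda>f. Cmp Q X Y Z g f) ` S \<subseteq> arr X Z"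
    using assms cmp_in_hom by blast
  ultimately show ?thesis using assms by (simp add: arr_Sup_le_iff)
qed

lemma cmp_Sup_left_le_iff:
  assumes "X \<in> Ob Q" "Y \<in> Ob Q" "Z \<in> Ob Q" "f \<in> arr X Y" "S \<subseteq> arr Y Z" "k \<in> arr X Z"
  shows "Cmp Q X Y Z (arr_Sup Y Z S) f \<preceq>\<^bsub>X\<rightarrow>Z\<^esub> k \<longleftrightarrow> (\<forall>s\<in>S. Cmp Q X Y Z s f \<preceq>\<^bsub>X\<rightarrow>Z\<^esub> k)"
proof -
  have "Cmp Q X Y Z (arr_Sup Y Z S) f = arr_Sup X Z ((\<lambda>g. Cmp Q X Y Z g f) ` S)"
    using cmp_sup_left[of X Y Z f] assms by (simp add: sup_pres_def)
  moreover have "(\<lambda>g. Cmp Q X Y Z g f) ` S \<subseteq> arr X Z"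
    using assms cmp_in_hom by blast
  ultimately show ?thesis using assms by (simp add: arr_Sup_le_iff)
qed

lemma cmp_mono_right:
  assumes "X \<in> Ob Q" "Y \<in> Ob Q" "Z \<in> Ob Q" "g \<in> arr Y Z" "f \<in> arr X Y" "f' \<in> arr X Y" "f \<preceq>\<^bsub>X\<rightarrow>Y\<^esub> f'"
  shows "Cmp Q X Y Z g f \<preceq>\<^bsub>X\<rightarrow>Z\<^esub> Cmp Q X Y Z g f'"
  using assms by (intro cmp_mono) auto

lemma cmp_mono_left:
  assumes "X \<in> Ob Q" "Y \<in> Ob Q" "Z \<in> Ob Q" "f \<in> arr X Y" "g \<in> arr Y Z" "g' \<in> arr Y Z" "g \<preceq>\<^bsub>Y\<rightarrow>Z\<^esub> g'"
  shows "Cmp Q X Y Z g f \<preceq>\<^bsub>X\<rightarrow>Z\<^esub> Cmp Q X Y Z g' f"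
  using assms by (intro cmp_mono) auto

section \<open>Categories enriched in a quantaloid and their distributors\<close>

lemma qtyp_Ob [simp]: "is_qcat Q A \<Longrightarrow> x \<in> objs A \<Longrightarrow> qtyp A x \<in> Ob Q"
  by (auto simp: is_qcat_def)

lemma qhom_arr [simp]:
  "is_qcat Q A \<Longrightarrow> x \<in> objs A \<Longrightarrow> y \<in> objs A \<Longrightarrow> qhom A (x, y) \<in> arr (qtyp A x) (qtyp A y)"
  by (force simp: is_qcat_def dest: PiE_mem[of "qhom A" _ _ "(x, y)"])

lemma qhom_refl:
  "is_qcat Q A \<Longrightarrow> x \<in> objs A \<Longrightarrow> Idt Q (qtyp A x) \<preceq>\<^bsub>qtyp A x\<rightarrow>qtyp A x\<^esub> qhom A (x, x)"
  by (auto simp: is_qcat_def)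

lemma qhom_trans:
  "is_qcat Q A \<Longrightarrow> x \<in> objs A \<Longrightarrow> y \<in> objs A \<Longrightarrow> z \<in> objs A \<Longrightarrow>
    Cmp Q (qtyp A x) (qtyp A y) (qtyp A z) (qhom A (y, z)) (qhom A (x, y))
      \<preceq>\<^bsub>qtyp A x\<rightarrow>qtyp A z\<^esub> qhom A (x, z)"
  by (auto simp: is_qcat_def)

lemma is_qcat_star [simp]: "X \<in> Ob Q \<Longrightarrow> is_qcat Q (star Q X)"
  by (auto simp: is_qcat_def star_def PiE_def extensional_def idt_in_hom cmp_idt_left)

abbreviation dist :: "('a, 'o, 'm) qcat \<Rightarrow> ('b, 'o, 'm) qcat \<Rightarrow> ('a \<times> 'b \<Rightarrow> 'm) set" where
  "dist A B \<equiv> carrier (dist_hom Q A B)"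

abbreviation dist_le ::
    "('a \<times> 'b \<Rightarrow> 'm) \<Rightarrow> ('a, 'o, 'm) qcat \<Rightarrow> ('b, 'o, 'm) qcat \<Rightarrow> ('a \<times> 'b \<Rightarrow> 'm) \<Rightarrow> bool"
    (\<open>_ \<le>\<^bsub>_\<rightarrow>_\<^esub> _\<close> [51, 0, 0, 51] 50) where
  "\<phi> \<le>\<^bsub>A\<rightarrow>B\<^esub> \<psi> \<equiv> \<phi> \<sqsubseteq>\<^bsub>dist_hom Q A B\<^esub> \<psi>"

lemma dist_le_iff:
  "\<phi> \<le>\<^bsub>A\<rightarrow>B\<^esub> \<psi> \<longleftrightarrow> (\<forall>x\<in>objs A. \<forall>y\<in>objs B. \<phi> (x, y) \<preceq>\<^bsub>qtyp A x\<rightarrow>qtyp B y\<^esub> \<psi> (x, y))"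
  by (simp add: dist_hom_def)

lemma dist_arr:
  "\<phi> \<in> dist A B \<Longrightarrow> x \<in> objs A \<Longrightarrow> y \<in> objs B \<Longrightarrow> \<phi> (x, y) \<in> arr (qtyp A x) (qtyp B y)"
  by (auto simp: dist_hom_def dest!: PiE_mem)

lemma dist_extensional:
  "\<phi> \<in> dist A B \<Longrightarrow> \<phi> \<in> extensional (objs A \<times> objs B)"
  by (auto simp: dist_hom_def PiE_def)

lemma dist_eqI:
  assumes "\<phi> \<in> dist A B" "\<psi> \<in> dist A B"
    and "\<And>x y. x \<in> objs A \<Longrightarrow> y \<in> objs B \<Longrightarrow> \<phi> (x, y) = \<psi> (x, y)"
  shows "\<phi> = \<psi>"
  using assms dist_extensional by (intro extensionalityI[of _ "objs A \<times> objs B"]) blast+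

text \<open>The compatibility of a distributor with the hom-arrows is a single inequality that acts on both sides
at once.  It splits into two one-sided actions: \<open>1 \<le> A(x, x)\<close> removes the action of the other side.\<close>

lemma dist_action_left:
  assumes A: "is_qcat Q A" and B: "is_qcat Q B" and \<phi>: "\<phi> \<in> dist A B"
    and [simp]: "x \<in> objs A" "y \<in> objs B" "y' \<in> objs B"
  shows "Cmp Q (qtyp A x) (qtyp B y) (qtyp B y') (qhom B (y, y')) (\<phi> (x, y))
    \<preceq>\<^bsub>qtyp A x\<rightarrow>qtyp B y'\<^esub> \<phi> (x, y')"
proof -
  note [simp] = A B dist_arr[OF \<phi>] cmp_in_hom
  let ?f = "Cmp Q (qtyp A x) (qtyp B y) (qtyp B y') (qhom B (y, y')) (\<phi> (x, y))"
  have "?f = Cmp Q (qtyp A x) (qtyp A x) (qtyp B y') ?f (Idt Q (qtyp A x))"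
    by (subst cmp_idt_right) auto
  also have "\<dots> \<preceq>\<^bsub>qtyp A x\<rightarrow>qtyp B y'\<^esub> Cmp Q (qtyp A x) (qtyp A x) (qtyp B y') ?f (qhom A (x, x))"
    by (intro cmp_mono_right) (auto intro: qhom_refl idt_in_hom)
  finally have 1: "?f \<preceq>\<^bsub>qtyp A x\<rightarrow>qtyp B y'\<^esub> Cmp Q (qtyp A x) (qtyp A x) (qtyp B y') ?f (qhom A (x, x))" .
  have "Cmp Q (qtyp A x) (qtyp A x) (qtyp B y') ?f (qhom A (x, x)) \<preceq>\<^bsub>qtyp A x\<rightarrow>qtyp B y'\<^esub> \<phi> (x, y')"
    using \<phi> by (auto simp: dist_hom_def)
  with 1 show ?thesis by (rule arr_trans) auto
qed

lemma dist_action_right: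
  assumes A: "is_qcat Q A" and B: "is_qcat Q B" and \<phi>: "\<phi> \<in> dist A B"
    and [simp]: "x \<in> objs A" "x' \<in> objs A" "y \<in> objs B"
  shows "Cmp Q (qtyp A x') (qtyp A x) (qtyp B y) (\<phi> (x, y)) (qhom A (x', x))
    \<preceq>\<^bsub>qtyp A x'\<rightarrow>qtyp B y\<^esub> \<phi> (x', y)"
proof -
  note [simp] = A B dist_arr[OF \<phi>] cmp_in_hom
  let ?f = "Cmp Q (qtyp A x) (qtyp B y) (qtyp B y) (qhom B (y, y)) (\<phi> (x, y))"
  have "\<phi> (x, y) = Cmp Q (qtyp A x) (qtyp B y) (qtyp B y) (Idt Q (qtyp B y)) (\<phi> (x, y))"
    by (subst cmp_idt_left) auto
  also have "\<dots> \<preceq>\<^bsub>qtyp A x\<rightarrow>qtyp B y\<^esub> ?f"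
    by (intro cmp_mono_left) (auto intro: qhom_refl idt_in_hom)
  finally have 1: "Cmp Q (qtyp A x') (qtyp A x) (qtyp B y) (\<phi> (x, y)) (qhom A (x', x))
      \<preceq>\<^bsub>qtyp A x'\<rightarrow>qtyp B y\<^esub> Cmp Q (qtyp A x') (qtyp A x) (qtyp B y) ?f (qhom A (x', x))"
    by (intro cmp_mono_left) auto
  have "Cmp Q (qtyp A x') (qtyp A x) (qtyp B y) ?f (qhom A (x', x)) \<preceq>\<^bsub>qtyp A x'\<rightarrow>qtyp B y\<^esub> \<phi> (x', y)"
    using \<phi> by (auto simp: dist_hom_def)
  with 1 show ?thesis by (rule arr_trans) auto
qed

lemma distI:
  assumes A: "is_qcat Q A" and B: "is_qcat Q B"
    and ext: "\<phi> \<in> extensional (objs A \<times> objs B)"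
    and arr: "\<And>x y. x \<in> objs A \<Longrightarrow> y \<in> objs B \<Longrightarrow> \<phi> (x, y) \<in> arr (qtyp A x) (qtyp B y)"
    and left: "\<And>x y y'. x \<in> objs A \<Longrightarrow> y \<in> objs B \<Longrightarrow> y' \<in> objs B \<Longrightarrow>
      Cmp Q (qtyp A x) (qtyp B y) (qtyp B y') (qhom B (y, y')) (\<phi> (x, y))
        \<preceq>\<^bsub>qtyp A x\<rightarrow>qtyp B y'\<^esub> \<phi> (x, y')"
    and right: "\<And>x x' y. x \<in> objs A \<Longrightarrow> x' \<in> objs A \<Longrightarrow> y \<in> objs B \<Longrightarrow>
      Cmp Q (qtyp A x') (qtyp A x) (qtyp B y) (\<phi> (x, y)) (qhom A (x', x))
        \<preceq>\<^bsub>qtyp A x'\<rightarrow>qtyp B y\<^esub> \<phi> (x', y)"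
  shows "\<phi> \<in> dist A B"
proof -
  note [simp] = A B arr cmp_in_hom
  have "Cmp Q (qtyp A x') (qtyp A x) (qtyp B y')
             (Cmp Q (qtyp A x) (qtyp B y) (qtyp B y') (qhom B (y, y')) (\<phi> (x, y))) (qhom A (x', x))
           \<preceq>\<^bsub>qtyp A x'\<rightarrow>qtyp B y'\<^esub> \<phi> (x', y')"
    if [simp]: "x \<in> objs A" "x' \<in> objs A" "y \<in> objs B" "y' \<in> objs B" for x x' y y'
  proof (rule arr_trans)
    show "Cmp Q (qtyp A x') (qtyp A x) (qtyp B y')
             (Cmp Q (qtyp A x) (qtyp B y) (qtyp B y') (qhom B (y, y')) (\<phi> (x, y))) (qhom A (x', x))
        \<preceq>\<^bsub>qtyp A x'\<rightarrow>qtyp B y'\<^esub> Cmp Q (qtyp A x') (qtyp A x) (qtyp B y') (\<phi> (x, y')) (qhom A (x', x))"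
      by (intro cmp_mono_left left) auto
  qed (auto intro: right)
  then show ?thesis
    using ext arr by (auto simp: dist_hom_def PiE_def)
qed

lemma qhom_dist [simp]: "is_qcat Q A \<Longrightarrow> qhom A \<in> dist A A"
  by (rule distI) (auto intro: qhom_trans simp: is_qcat_def PiE_def)

lemma dist_comp_apply:
  assumes "x \<in> objs A" "z \<in> objs C"
  shows "dist_comp Q A B C \<psi> \<phi> (x, z) = arr_Sup (qtyp A x) (qtyp C z)
      ((\<lambda>y. Cmp Q (qtyp A x) (qtyp B y) (qtyp C z) (\<psi> (y, z)) (\<phi> (x, y))) ` objs B)"
  using assms by (simp add: dist_comp_def)

context
  fixes A :: "('a, 'o, 'm) qcat" and B :: "('b, 'o, 'm) qcat" and C :: "('c, 'o, 'm) qcat"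
  assumes A: "is_qcat Q A" and B: "is_qcat Q B" and C: "is_qcat Q C"
begin

lemma dist_comp_terms:
  assumes "\<phi> \<in> dist A B" "\<psi> \<in> dist B C" "x \<in> objs A" "z \<in> objs C"
  shows "(\<lambda>y. Cmp Q (qtyp A x) (qtyp B y) (qtyp C z) (\<psi> (y, z)) (\<phi> (x, y))) ` objs B
     \<subseteq> arr (qtyp A x) (qtyp C z)"
  using assms A B C by (auto intro!: cmp_in_hom simp: dist_arr)

lemma dist_comp_arr:
  assumes "\<phi> \<in> dist A B" "\<psi> \<in> dist B C" "x \<in> objs A" "z \<in> objs C"
  shows "dist_comp Q A B C \<psi> \<phi> (x, z) \<in> arr (qtyp A x) (qtyp C z)"
  using assms A B C dist_comp_terms[OF assms] by (simp add: dist_comp_apply arr_Sup_in)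

text \<open>An entry of a composite is a join, so it is used through the arrows above it.  Comparing the
upper bounds of two composites (\<open>arr_eqI_upper\<close>) replaces computations with iterated joins in the proof of
associativity.\<close>

lemma dist_comp_point_le_iff:
  assumes "\<phi> \<in> dist A B" "\<psi> \<in> dist B C" "x \<in> objs A" "z \<in> objs C" "k \<in> arr (qtyp A x) (qtyp C z)"
  shows "dist_comp Q A B C \<psi> \<phi> (x, z) \<preceq>\<^bsub>qtyp A x\<rightarrow>qtyp C z\<^esub> k \<longleftrightarrow>
    (\<forall>y\<in>objs B. Cmp Q (qtyp A x) (qtyp B y) (qtyp C z) (\<psi> (y, z)) (\<phi> (x, y)) \<preceq>\<^bsub>qtyp A x\<rightarrow>qtyp C z\<^esub> k)"
  using assms A B C dist_comp_terms[OF assms(1-4)] by (simp add: dist_comp_apply arr_Sup_le_iff)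

lemma dist_comp_upper:
  assumes "\<phi> \<in> dist A B" "\<psi> \<in> dist B C" "x \<in> objs A" "z \<in> objs C" "y \<in> objs B"
  shows "Cmp Q (qtyp A x) (qtyp B y) (qtyp C z) (\<psi> (y, z)) (\<phi> (x, y))
     \<preceq>\<^bsub>qtyp A x\<rightarrow>qtyp C z\<^esub> dist_comp Q A B C \<psi> \<phi> (x, z)"
  using dist_comp_point_le_iff[OF assms(1-4) dist_comp_arr[OF assms(1-4)]]
    dist_comp_arr[OF assms(1-4)] A C assms by auto

text \<open>Composition with a fixed arrow preserves joins; hence the description by upper bounds persists inside a
further composition.\<close>

lemma cmp_dist_comp_left_le_iff:
  assumes "\<phi> \<in> dist A B" "\<psi> \<in> dist B C" "x \<in> objs A" "z \<in> objs C"
    "W \<in> Ob Q" "h \<in> arr (qtyp C z) W" "k \<in> arr (qtyp A x) W"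
  shows "Cmp Q (qtyp A x) (qtyp C z) W h (dist_comp Q A B C \<psi> \<phi> (x, z)) \<preceq>\<^bsub>qtyp A x\<rightarrow>W\<^esub> k \<longleftrightarrow>
    (\<forall>y\<in>objs B. Cmp Q (qtyp A x) (qtyp C z) W h
       (Cmp Q (qtyp A x) (qtyp B y) (qtyp C z) (\<psi> (y, z)) (\<phi> (x, y))) \<preceq>\<^bsub>qtyp A x\<rightarrow>W\<^esub> k)"
  using assms A C dist_comp_terms[OF assms(1-4)] by (simp add: dist_comp_apply cmp_Sup_right_le_iff)

lemma cmp_dist_comp_right_le_iff:
  assumes "\<phi> \<in> dist A B" "\<psi> \<in> dist B C" "x \<in> objs A" "z \<in> objs C"
    "W \<in> Ob Q" "h \<in> arr W (qtyp A x)" "k \<in> arr W (qtyp C z)"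
  shows "Cmp Q W (qtyp A x) (qtyp C z) (dist_comp Q A B C \<psi> \<phi> (x, z)) h \<preceq>\<^bsub>W\<rightarrow>qtyp C z\<^esub> k \<longleftrightarrow>
    (\<forall>y\<in>objs B. Cmp Q W (qtyp A x) (qtyp C z)
       (Cmp Q (qtyp A x) (qtyp B y) (qtyp C z) (\<psi> (y, z)) (\<phi> (x, y))) h \<preceq>\<^bsub>W\<rightarrow>qtyp C z\<^esub> k)"
  using assms A C dist_comp_terms[OF assms(1-4)] by (simp add: dist_comp_apply cmp_Sup_left_le_iff)

lemma dist_comp_dist [simp]:
  assumes \<phi>: "\<phi> \<in> dist A B" and \<psi>: "\<psi> \<in> dist B C"
  shows "dist_comp Q A B C \<psi> \<phi> \<in> dist A C"
proof (rule distI[OF A C])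
  note [simp] = A B C \<phi> \<psi> dist_arr[OF \<phi>] dist_arr[OF \<psi>] cmp_in_hom
    dist_comp_arr[OF \<phi> \<psi>]
  show "dist_comp Q A B C \<psi> \<phi> \<in> extensional (objs A \<times> objs C)"
    by (simp add: dist_comp_def)
  show "dist_comp Q A B C \<psi> \<phi> (x, z) \<in> arr (qtyp A x) (qtyp C z)"
    if "x \<in> objs A" "z \<in> objs C" for x z
    using that by simp
  show "Cmp Q (qtyp A x) (qtyp C z) (qtyp C z') (qhom C (z, z')) (dist_comp Q A B C \<psi> \<phi> (x, z))
      \<preceq>\<^bsub>qtyp A x\<rightarrow>qtyp C z'\<^esub> dist_comp Q A B C \<psi> \<phi> (x, z')"
    if [simp]: "x \<in> objs A" "z \<in> objs C" "z' \<in> objs C" for x z z'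
  proof (subst cmp_dist_comp_left_le_iff; simp?; intro ballI)
    fix y assume [simp]: "y \<in> objs B"
    show "Cmp Q (qtyp A x) (qtyp C z) (qtyp C z') (qhom C (z, z'))
          (Cmp Q (qtyp A x) (qtyp B y) (qtyp C z) (\<psi> (y, z)) (\<phi> (x, y)))
         \<preceq>\<^bsub>qtyp A x\<rightarrow>qtyp C z'\<^esub> dist_comp Q A B C \<psi> \<phi> (x, z')"
    proof (rule arr_trans)
      show "Cmp Q (qtyp A x) (qtyp C z) (qtyp C z') (qhom C (z, z'))
          (Cmp Q (qtyp A x) (qtyp B y) (qtyp C z) (\<psi> (y, z)) (\<phi> (x, y)))
         \<preceq>\<^bsub>qtyp A x\<rightarrow>qtyp C z'\<^esub> Cmp Q (qtyp A x) (qtyp B y) (qtyp C z') (\<psi> (y, z')) (\<phi> (x, y))"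
        by (subst cmp_assoc) (auto intro!: cmp_mono_left dist_action_left[OF B C \<psi>])
    qed (auto intro: dist_comp_upper)
  qed
  show "Cmp Q (qtyp A x') (qtyp A x) (qtyp C z) (dist_comp Q A B C \<psi> \<phi> (x, z)) (qhom A (x', x))
      \<preceq>\<^bsub>qtyp A x'\<rightarrow>qtyp C z\<^esub> dist_comp Q A B C \<psi> \<phi> (x', z)"
    if [simp]: "x \<in> objs A" "x' \<in> objs A" "z \<in> objs C" for x x' z
  proof (subst cmp_dist_comp_right_le_iff; simp?; intro ballI)
    fix y assume [simp]: "y \<in> objs B"
    show "Cmp Q (qtyp A x') (qtyp A x) (qtyp C z)
          (Cmp Q (qtyp A x) (qtyp B y) (qtyp C z) (\<psi> (y, z)) (\<phi> (x, y))) (qhom A (x', x))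
         \<preceq>\<^bsub>qtyp A x'\<rightarrow>qtyp C z\<^esub> dist_comp Q A B C \<psi> \<phi> (x', z)"
    proof (rule arr_trans)
      show "Cmp Q (qtyp A x') (qtyp A x) (qtyp C z)
          (Cmp Q (qtyp A x) (qtyp B y) (qtyp C z) (\<psi> (y, z)) (\<phi> (x, y))) (qhom A (x', x))
         \<preceq>\<^bsub>qtyp A x'\<rightarrow>qtyp C z\<^esub> Cmp Q (qtyp A x') (qtyp B y) (qtyp C z) (\<psi> (y, z)) (\<phi> (x', y))"
        by (subst cmp_assoc[symmetric]) (auto intro!: cmp_mono_right dist_action_right[OF A B \<phi>])
    qed (auto intro: dist_comp_upper)
  qed
qed

lemma dist_comp_le_iff:
  assumes \<phi>: "\<phi> \<in> dist A B" and \<psi>: "\<psi> \<in> dist B C" and \<chi>: "\<chi> \<in> dist A C"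
  shows "dist_comp Q A B C \<psi> \<phi> \<le>\<^bsub>A\<rightarrow>C\<^esub> \<chi> \<longleftrightarrow>
    (\<forall>x\<in>objs A. \<forall>y\<in>objs B. \<forall>z\<in>objs C.
      Cmp Q (qtyp A x) (qtyp B y) (qtyp C z) (\<psi> (y, z)) (\<phi> (x, y)) \<preceq>\<^bsub>qtyp A x\<rightarrow>qtyp C z\<^esub> \<chi> (x, z))"
  using assms dist_comp_point_le_iff[OF \<phi> \<psi> _ _ dist_arr[OF \<chi>]] by (auto simp: dist_le_iff)

lemma dist_comp_mono:
  assumes [simp]: "\<phi> \<in> dist A B" "\<phi>' \<in> dist A B" "\<psi> \<in> dist B C" "\<psi>' \<in> dist B C"
    and le: "\<phi> \<le>\<^bsub>A\<rightarrow>B\<^esub> \<phi>'" "\<psi> \<le>\<^bsub>B\<rightarrow>C\<^esub> \<psi>'"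
  shows "dist_comp Q A B C \<psi> \<phi> \<le>\<^bsub>A\<rightarrow>C\<^esub> dist_comp Q A B C \<psi>' \<phi>'"
proof (subst dist_comp_le_iff; simp?; intro ballI)
  fix x y z assume [simp]: "x \<in> objs A" "y \<in> objs B" "z \<in> objs C"
  have "Cmp Q (qtyp A x) (qtyp B y) (qtyp C z) (\<psi> (y, z)) (\<phi> (x, y))
    \<preceq>\<^bsub>qtyp A x\<rightarrow>qtyp C z\<^esub> Cmp Q (qtyp A x) (qtyp B y) (qtyp C z) (\<psi>' (y, z)) (\<phi>' (x, y))"
    using A B C le by (intro cmp_mono) (auto simp: dist_arr dist_le_iff)
  then show "Cmp Q (qtyp A x) (qtyp B y) (qtyp C z) (\<psi> (y, z)) (\<phi> (x, y))
    \<preceq>\<^bsub>qtyp A x\<rightarrow>qtyp C z\<^esub> dist_comp Q A B C \<psi>' \<phi>' (x, z)"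
    by (rule arr_trans) (auto intro!: dist_comp_upper dist_comp_arr cmp_in_hom simp: A B C dist_arr)
qed

end

lemma dist_comp_assoc:
  assumes A: "is_qcat Q A" and B: "is_qcat Q B" and C: "is_qcat Q C" and D: "is_qcat Q D"
    and \<phi>: "\<phi> \<in> dist A B" and \<psi>: "\<psi> \<in> dist B C" and \<chi>: "\<chi> \<in> dist C D"
  shows "dist_comp Q A C D \<chi> (dist_comp Q A B C \<psi> \<phi>) = dist_comp Q A B D (dist_comp Q B C D \<chi> \<psi>) \<phi>"
proof (rule dist_eqI[of _ A D])
  note [simp] = A B C D \<phi> \<psi> \<chi> dist_arr[OF \<phi>] dist_arr[OF \<psi>] dist_arr[OF \<chi>] cmp_in_hom dist_comp_arr
  fix x w assume [simp]: "x \<in> objs A" "w \<in> objs D"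
  show "dist_comp Q A C D \<chi> (dist_comp Q A B C \<psi> \<phi>) (x, w) =
      dist_comp Q A B D (dist_comp Q B C D \<chi> \<psi>) \<phi> (x, w)"
    by (rule arr_eqI_upper[of "qtyp A x" "qtyp D w"])
      (auto simp: dist_comp_point_le_iff cmp_dist_comp_left_le_iff cmp_dist_comp_right_le_iff cmp_assoc)
qed (use assms in auto)

text \<open>The action bounds every term of the join by \<open>\<phi> (x, y)\<close>, and the term at \<open>x\<close> itself is at least
\<open>\<phi> (x, y) \<circ> 1\<close>.\<close>

lemma dist_comp_id_right:
  assumes A: "is_qcat Q A" and B: "is_qcat Q B" and \<phi>: "\<phi> \<in> dist A B"
  shows "dist_comp Q A A B \<phi> (qhom A) = \<phi>"
proof (rule dist_eqI[of _ A B])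
  note [simp] = A B \<phi> dist_arr[OF \<phi>] dist_comp_arr cmp_in_hom
  fix x y assume [simp]: "x \<in> objs A" "y \<in> objs B"
  show "dist_comp Q A A B \<phi> (qhom A) (x, y) = \<phi> (x, y)"
  proof (rule arr_antisym)
    show "dist_comp Q A A B \<phi> (qhom A) (x, y) \<preceq>\<^bsub>qtyp A x\<rightarrow>qtyp B y\<^esub> \<phi> (x, y)"
      by (simp add: dist_comp_point_le_iff dist_action_right)
    have "\<phi> (x, y) = Cmp Q (qtyp A x) (qtyp A x) (qtyp B y) (\<phi> (x, y)) (Idt Q (qtyp A x))"
      by (subst cmp_idt_right) auto
    also have "\<dots> \<preceq>\<^bsub>qtyp A x\<rightarrow>qtyp B y\<^esub> Cmp Q (qtyp A x) (qtyp A x) (qtyp B y) (\<phi> (x, y)) (qhom A (x, x))"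
      by (intro cmp_mono_right) (auto intro: qhom_refl idt_in_hom)
    finally show "\<phi> (x, y) \<preceq>\<^bsub>qtyp A x\<rightarrow>qtyp B y\<^esub> dist_comp Q A A B \<phi> (qhom A) (x, y)"
      by (rule arr_trans) (auto intro: dist_comp_upper)
  qed auto
qed (use assms in auto)

lemma dist_comp_id_left:
  assumes A: "is_qcat Q A" and B: "is_qcat Q B" and \<phi>: "\<phi> \<in> dist A B"
  shows "dist_comp Q A B B (qhom B) \<phi> = \<phi>"
proof (rule dist_eqI[of _ A B])
  note [simp] = A B \<phi> dist_arr[OF \<phi>] dist_comp_arr cmp_in_hom
  fix x y assume [simp]: "x \<in> objs A" "y \<in> objs B"
  show "dist_comp Q A B B (qhom B) \<phi> (x, y) = \<phi> (x, y)"
  proof (rule arr_antisym)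
    show "dist_comp Q A B B (qhom B) \<phi> (x, y) \<preceq>\<^bsub>qtyp A x\<rightarrow>qtyp B y\<^esub> \<phi> (x, y)"
      by (simp add: dist_comp_point_le_iff dist_action_left)
    have "\<phi> (x, y) = Cmp Q (qtyp A x) (qtyp B y) (qtyp B y) (Idt Q (qtyp B y)) (\<phi> (x, y))"
      by (subst cmp_idt_left) auto
    also have "\<dots> \<preceq>\<^bsub>qtyp A x\<rightarrow>qtyp B y\<^esub> Cmp Q (qtyp A x) (qtyp B y) (qtyp B y) (qhom B (y, y)) (\<phi> (x, y))"
      by (intro cmp_mono_left) (auto intro: qhom_refl idt_in_hom)
    finally show "\<phi> (x, y) \<preceq>\<^bsub>qtyp A x\<rightarrow>qtyp B y\<^esub> dist_comp Q A B B (qhom B) \<phi> (x, y)"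
      by (rule arr_trans) (auto intro: dist_comp_upper)
  qed auto
qed (use assms in auto)

section \<open>Implications of distributors\<close>

text \<open>The implication \<open>g \<searrow> h\<close> in the quantaloid of distributors.  Each entry is the largest arrow \<open>k\<close> of \<open>Q\<close> with
\<open>g (y, z) \<circ> k \<le> h (x, z)\<close> for all \<open>z\<close>, so an entry depends only on one row of \<open>g\<close> and one row of \<open>h\<close>.
This allows the comparison of implications over different categories, see \<open>dist_rimp_point_cong\<close>.\<close>

definition dist_rimp :: "('a, 'o, 'm) qcat \<Rightarrow> ('b, 'o, 'm) qcat \<Rightarrow> ('c, 'o, 'm) qcat
    \<Rightarrow> ('b \<times> 'c \<Rightarrow> 'm) \<Rightarrow> ('a \<times> 'c \<Rightarrow> 'm) \<Rightarrow> ('a \<times> 'b \<Rightarrow> 'm)" where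
  "dist_rimp A B C g h = (\<lambda>(x, y)\<in>objs A \<times> objs B. arr_Sup (qtyp A x) (qtyp B y)
    {k \<in> arr (qtyp A x) (qtyp B y). \<forall>z\<in>objs C.
      Cmp Q (qtyp A x) (qtyp B y) (qtyp C z) (g (y, z)) k \<preceq>\<^bsub>qtyp A x\<rightarrow>qtyp C z\<^esub> h (x, z)})"

text \<open>The implication \<open>h \<swarrow> f\<close>, dually.\<close>

definition dist_limp :: "('a, 'o, 'm) qcat \<Rightarrow> ('b, 'o, 'm) qcat \<Rightarrow> ('c, 'o, 'm) qcat
    \<Rightarrow> ('a \<times> 'c \<Rightarrow> 'm) \<Rightarrow> ('a \<times> 'b \<Rightarrow> 'm) \<Rightarrow> ('b \<times> 'c \<Rightarrow> 'm)" where
  "dist_limp A B C h f = (\<lambda>(y, z)\<in>objs B \<times> objs C. arr_Sup (qtyp B y) (qtyp C z)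
    {k \<in> arr (qtyp B y) (qtyp C z). \<forall>x\<in>objs A.
      Cmp Q (qtyp A x) (qtyp B y) (qtyp C z) k (f (x, y)) \<preceq>\<^bsub>qtyp A x\<rightarrow>qtyp C z\<^esub> h (x, z)})"

context
  fixes A :: "('a, 'o, 'm) qcat" and B :: "('b, 'o, 'm) qcat" and C :: "('c, 'o, 'm) qcat"
  assumes A: "is_qcat Q A" and B: "is_qcat Q B" and C: "is_qcat Q C"
begin

lemma dist_rimp_arr: "x \<in> objs A \<Longrightarrow> y \<in> objs B \<Longrightarrow> dist_rimp A B C g h (x, y) \<in> arr (qtyp A x) (qtyp B y)"
  using A B by (auto simp: dist_rimp_def intro!: arr_Sup_in)

lemma dist_limp_arr: "y \<in> objs B \<Longrightarrow> z \<in> objs C \<Longrightarrow> dist_limp A B C h f (y, z) \<in> arr (qtyp B y) (qtyp C z)"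
  using B C by (auto simp: dist_limp_def intro!: arr_Sup_in)

text \<open>One direction holds because composition with \<open>g (y, z)\<close> preserves the join that defines the entry: the join
itself satisfies the inequalities imposed on its members.\<close>

lemma le_dist_rimp_point_iff:
  assumes g: "g \<in> dist B C" and h: "h \<in> dist A C"
    and [simp]: "x \<in> objs A" "y \<in> objs B" "k \<in> arr (qtyp A x) (qtyp B y)"
  shows "k \<preceq>\<^bsub>qtyp A x\<rightarrow>qtyp B y\<^esub> dist_rimp A B C g h (x, y) \<longleftrightarrow>
    (\<forall>z\<in>objs C. Cmp Q (qtyp A x) (qtyp B y) (qtyp C z) (g (y, z)) k \<preceq>\<^bsub>qtyp A x\<rightarrow>qtyp C z\<^esub> h (x, z))"
proof -
  note [simp] = A B C dist_arr[OF g] dist_arr[OF h] cmp_in_hom dist_rimp_arr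
  define S where "S = {k \<in> arr (qtyp A x) (qtyp B y). \<forall>z\<in>objs C.
      Cmp Q (qtyp A x) (qtyp B y) (qtyp C z) (g (y, z)) k \<preceq>\<^bsub>qtyp A x\<rightarrow>qtyp C z\<^esub> h (x, z)}"
  have S: "S \<subseteq> arr (qtyp A x) (qtyp B y)" by (auto simp: S_def)
  have r: "dist_rimp A B C g h (x, y) = arr_Sup (qtyp A x) (qtyp B y) S"
    by (simp add: dist_rimp_def S_def)
  show ?thesis
  proof (intro iffI ballI)
    fix z assume le: "k \<preceq>\<^bsub>qtyp A x\<rightarrow>qtyp B y\<^esub> dist_rimp A B C g h (x, y)" and [simp]: "z \<in> objs C"
    have "Cmp Q (qtyp A x) (qtyp B y) (qtyp C z) (g (y, z)) (dist_rimp A B C g h (x, y))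
        \<preceq>\<^bsub>qtyp A x\<rightarrow>qtyp C z\<^esub> h (x, z)"
      unfolding r by (subst cmp_Sup_right_le_iff) (use S in \<open>auto simp: S_def\<close>)
    moreover have "Cmp Q (qtyp A x) (qtyp B y) (qtyp C z) (g (y, z)) k
        \<preceq>\<^bsub>qtyp A x\<rightarrow>qtyp C z\<^esub> Cmp Q (qtyp A x) (qtyp B y) (qtyp C z) (g (y, z)) (dist_rimp A B C g h (x, y))"
      using le by (intro cmp_mono_right) auto
    ultimately show "Cmp Q (qtyp A x) (qtyp B y) (qtyp C z) (g (y, z)) k \<preceq>\<^bsub>qtyp A x\<rightarrow>qtyp C z\<^esub> h (x, z)"
      by (meson \<open>z \<in> objs C\<close> arr_trans A B C assms cmp_in_hom dist_arr qtyp_Ob dist_rimp_arr)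
  next
    assume "\<forall>z\<in>objs C. Cmp Q (qtyp A x) (qtyp B y) (qtyp C z) (g (y, z)) k \<preceq>\<^bsub>qtyp A x\<rightarrow>qtyp C z\<^esub> h (x, z)"
    then have "k \<in> S" by (simp add: S_def)
    then show "k \<preceq>\<^bsub>qtyp A x\<rightarrow>qtyp B y\<^esub> dist_rimp A B C g h (x, y)"
      unfolding r by (rule arr_Sup_upper) (use S in auto)
  qed
qed

lemma le_dist_limp_point_iff:
  assumes f: "f \<in> dist A B" and h: "h \<in> dist A C"
    and [simp]: "y \<in> objs B" "z \<in> objs C" "k \<in> arr (qtyp B y) (qtyp C z)"
  shows "k \<preceq>\<^bsub>qtyp B y\<rightarrow>qtyp C z\<^esub> dist_limp A B C h f (y, z) \<longleftrightarrow>
    (\<forall>x\<in>objs A. Cmp Q (qtyp A x) (qtyp B y) (qtyp C z) k (f (x, y)) \<preceq>\<^bsub>qtyp A x\<rightarrow>qtyp C z\<^esub> h (x, z))"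
proof -
  note [simp] = A B C dist_arr[OF f] dist_arr[OF h] cmp_in_hom dist_limp_arr
  define S where "S = {k \<in> arr (qtyp B y) (qtyp C z). \<forall>x\<in>objs A.
      Cmp Q (qtyp A x) (qtyp B y) (qtyp C z) k (f (x, y)) \<preceq>\<^bsub>qtyp A x\<rightarrow>qtyp C z\<^esub> h (x, z)}"
  have S: "S \<subseteq> arr (qtyp B y) (qtyp C z)" by (auto simp: S_def)
  have r: "dist_limp A B C h f (y, z) = arr_Sup (qtyp B y) (qtyp C z) S"
    by (simp add: dist_limp_def S_def)
  show ?thesis
  proof (intro iffI ballI)
    fix x assume le: "k \<preceq>\<^bsub>qtyp B y\<rightarrow>qtyp C z\<^esub> dist_limp A B C h f (y, z)" and [simp]: "x \<in> objs A"
    have "Cmp Q (qtyp A x) (qtyp B y) (qtyp C z) (dist_limp A B C h f (y, z)) (f (x, y))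
        \<preceq>\<^bsub>qtyp A x\<rightarrow>qtyp C z\<^esub> h (x, z)"
      unfolding r by (subst cmp_Sup_left_le_iff) (use S in \<open>auto simp: S_def\<close>)
    moreover have "Cmp Q (qtyp A x) (qtyp B y) (qtyp C z) k (f (x, y))
        \<preceq>\<^bsub>qtyp A x\<rightarrow>qtyp C z\<^esub> Cmp Q (qtyp A x) (qtyp B y) (qtyp C z) (dist_limp A B C h f (y, z)) (f (x, y))"
      using le by (intro cmp_mono_left) auto
    ultimately show "Cmp Q (qtyp A x) (qtyp B y) (qtyp C z) k (f (x, y)) \<preceq>\<^bsub>qtyp A x\<rightarrow>qtyp C z\<^esub> h (x, z)"
      by (meson \<open>x \<in> objs A\<close> arr_trans A B C assms cmp_in_hom dist_arr qtyp_Ob dist_limp_arr)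
  next
    assume "\<forall>x\<in>objs A. Cmp Q (qtyp A x) (qtyp B y) (qtyp C z) k (f (x, y)) \<preceq>\<^bsub>qtyp A x\<rightarrow>qtyp C z\<^esub> h (x, z)"
    then have "k \<in> S" by (simp add: S_def)
    then show "k \<preceq>\<^bsub>qtyp B y\<rightarrow>qtyp C z\<^esub> dist_limp A B C h f (y, z)"
      unfolding r by (rule arr_Sup_upper) (use S in auto)
  qed
qed

lemma dist_rimp_dist [simp]:
  assumes g: "g \<in> dist B C" and h: "h \<in> dist A C"
  shows "dist_rimp A B C g h \<in> dist A B"
proof (rule distI[OF A B])
  note [simp] = A B C dist_arr[OF g] dist_arr[OF h] cmp_in_hom dist_rimp_arr
  have r: "Cmp Q (qtyp A x) (qtyp B y) (qtyp C z) (g (y, z)) (dist_rimp A B C g h (x, y))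
      \<preceq>\<^bsub>qtyp A x\<rightarrow>qtyp C z\<^esub> h (x, z)" if "x \<in> objs A" "y \<in> objs B" "z \<in> objs C" for x y z
    using le_dist_rimp_point_iff[OF g h that(1,2) dist_rimp_arr[OF that(1,2)], of g h] that by auto
  show "dist_rimp A B C g h \<in> extensional (objs A \<times> objs B)"
    by (simp add: dist_rimp_def)
  show "dist_rimp A B C g h (x, y) \<in> arr (qtyp A x) (qtyp B y)" if "x \<in> objs A" "y \<in> objs B" for x y
    using that by simp
  show "Cmp Q (qtyp A x) (qtyp B y) (qtyp B y') (qhom B (y, y')) (dist_rimp A B C g h (x, y))
      \<preceq>\<^bsub>qtyp A x\<rightarrow>qtyp B y'\<^esub> dist_rimp A B C g h (x, y')"
    if [simp]: "x \<in> objs A" "y \<in> objs B" "y' \<in> objs B" for x y y'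
  proof (subst le_dist_rimp_point_iff[OF g h]; simp?; intro ballI)
    fix z assume [simp]: "z \<in> objs C"
    have "Cmp Q (qtyp A x) (qtyp B y') (qtyp C z) (g (y', z))
           (Cmp Q (qtyp A x) (qtyp B y) (qtyp B y') (qhom B (y, y')) (dist_rimp A B C g h (x, y)))
        \<preceq>\<^bsub>qtyp A x\<rightarrow>qtyp C z\<^esub> Cmp Q (qtyp A x) (qtyp B y) (qtyp C z) (g (y, z)) (dist_rimp A B C g h (x, y))"
      by (subst cmp_assoc) (auto intro!: cmp_mono_left dist_action_right[OF B C g])
    then show "Cmp Q (qtyp A x) (qtyp B y') (qtyp C z) (g (y', z))
           (Cmp Q (qtyp A x) (qtyp B y) (qtyp B y') (qhom B (y, y')) (dist_rimp A B C g h (x, y)))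
        \<preceq>\<^bsub>qtyp A x\<rightarrow>qtyp C z\<^esub> h (x, z)"
      by (rule arr_trans) (auto intro: r)
  qed
  show "Cmp Q (qtyp A x') (qtyp A x) (qtyp B y) (dist_rimp A B C g h (x, y)) (qhom A (x', x))
      \<preceq>\<^bsub>qtyp A x'\<rightarrow>qtyp B y\<^esub> dist_rimp A B C g h (x', y)"
    if [simp]: "x \<in> objs A" "x' \<in> objs A" "y \<in> objs B" for x x' y
  proof (subst le_dist_rimp_point_iff[OF g h]; simp?; intro ballI)
    fix z assume [simp]: "z \<in> objs C"
    have "Cmp Q (qtyp A x') (qtyp B y) (qtyp C z) (g (y, z))
           (Cmp Q (qtyp A x') (qtyp A x) (qtyp B y) (dist_rimp A B C g h (x, y)) (qhom A (x', x)))
        \<preceq>\<^bsub>qtyp A x'\<rightarrow>qtyp C z\<^esub> Cmp Q (qtyp A x') (qtyp A x) (qtyp C z) (h (x, z)) (qhom A (x', x))"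
      by (subst cmp_assoc) (auto intro!: cmp_mono_left r)
    then show "Cmp Q (qtyp A x') (qtyp B y) (qtyp C z) (g (y, z))
           (Cmp Q (qtyp A x') (qtyp A x) (qtyp B y) (dist_rimp A B C g h (x, y)) (qhom A (x', x)))
        \<preceq>\<^bsub>qtyp A x'\<rightarrow>qtyp C z\<^esub> h (x', z)"
      by (rule arr_trans) (auto intro: dist_action_right[OF A C h])
  qed
qed

lemma dist_limp_dist [simp]:
  assumes f: "f \<in> dist A B" and h: "h \<in> dist A C"
  shows "dist_limp A B C h f \<in> dist B C"
proof (rule distI[OF B C])
  note [simp] = A B C dist_arr[OF f] dist_arr[OF h] cmp_in_hom dist_limp_arr
  have r: "Cmp Q (qtyp A x) (qtyp B y) (qtyp C z) (dist_limp A B C h f (y, z)) (f (x, y))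
      \<preceq>\<^bsub>qtyp A x\<rightarrow>qtyp C z\<^esub> h (x, z)" if "x \<in> objs A" "y \<in> objs B" "z \<in> objs C" for x y z
    using le_dist_limp_point_iff[OF f h that(2,3) dist_limp_arr[OF that(2,3)], of h f] that by auto
  show "dist_limp A B C h f \<in> extensional (objs B \<times> objs C)"
    by (simp add: dist_limp_def)
  show "dist_limp A B C h f (y, z) \<in> arr (qtyp B y) (qtyp C z)" if "y \<in> objs B" "z \<in> objs C" for y z
    using that by simp
  show "Cmp Q (qtyp B y) (qtyp C z) (qtyp C z') (qhom C (z, z')) (dist_limp A B C h f (y, z))
      \<preceq>\<^bsub>qtyp B y\<rightarrow>qtyp C z'\<^esub> dist_limp A B C h f (y, z')"
    if [simp]: "y \<in> objs B" "z \<in> objs C" "z' \<in> objs C" for y z z'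
  proof (subst le_dist_limp_point_iff[OF f h]; simp?; intro ballI)
    fix x assume [simp]: "x \<in> objs A"
    have "Cmp Q (qtyp A x) (qtyp B y) (qtyp C z')
           (Cmp Q (qtyp B y) (qtyp C z) (qtyp C z') (qhom C (z, z')) (dist_limp A B C h f (y, z))) (f (x, y))
        \<preceq>\<^bsub>qtyp A x\<rightarrow>qtyp C z'\<^esub> Cmp Q (qtyp A x) (qtyp C z) (qtyp C z') (qhom C (z, z')) (h (x, z))"
      by (subst cmp_assoc[symmetric]) (auto intro!: cmp_mono_right r)
    then show "Cmp Q (qtyp A x) (qtyp B y) (qtyp C z')
           (Cmp Q (qtyp B y) (qtyp C z) (qtyp C z') (qhom C (z, z')) (dist_limp A B C h f (y, z))) (f (x, y))
        \<preceq>\<^bsub>qtyp A x\<rightarrow>qtyp C z'\<^esub> h (x, z')"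
      by (rule arr_trans) (auto intro: dist_action_left[OF A C h])
  qed
  show "Cmp Q (qtyp B y') (qtyp B y) (qtyp C z) (dist_limp A B C h f (y, z)) (qhom B (y', y))
      \<preceq>\<^bsub>qtyp B y'\<rightarrow>qtyp C z\<^esub> dist_limp A B C h f (y', z)"
    if [simp]: "y \<in> objs B" "y' \<in> objs B" "z \<in> objs C" for y y' z
  proof (subst le_dist_limp_point_iff[OF f h]; simp?; intro ballI)
    fix x assume [simp]: "x \<in> objs A"
    have "Cmp Q (qtyp A x) (qtyp B y') (qtyp C z)
           (Cmp Q (qtyp B y') (qtyp B y) (qtyp C z) (dist_limp A B C h f (y, z)) (qhom B (y', y))) (f (x, y'))
        \<preceq>\<^bsub>qtyp A x\<rightarrow>qtyp C z\<^esub> Cmp Q (qtyp A x) (qtyp B y) (qtyp C z) (dist_limp A B C h f (y, z)) (f (x, y))"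
      by (subst cmp_assoc[symmetric]) (auto intro!: cmp_mono_right dist_action_left[OF A B f])
    then show "Cmp Q (qtyp A x) (qtyp B y') (qtyp C z)
           (Cmp Q (qtyp B y') (qtyp B y) (qtyp C z) (dist_limp A B C h f (y, z)) (qhom B (y', y))) (f (x, y'))
        \<preceq>\<^bsub>qtyp A x\<rightarrow>qtyp C z\<^esub> h (x, z)"
      by (rule arr_trans) (auto intro: r)
  qed
qed

lemma le_dist_rimp_iff:
  assumes "f \<in> dist A B" "g \<in> dist B C" "h \<in> dist A C"
  shows "f \<le>\<^bsub>A\<rightarrow>B\<^esub> dist_rimp A B C g h \<longleftrightarrow> dist_comp Q A B C g f \<le>\<^bsub>A\<rightarrow>C\<^esub> h"
  using assms A B C by (auto simp: dist_comp_le_iff dist_le_iff[of A B] le_dist_rimp_point_iff dist_arr)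

lemma le_dist_limp_iff:
  assumes "f \<in> dist A B" "g \<in> dist B C" "h \<in> dist A C"
  shows "g \<le>\<^bsub>B\<rightarrow>C\<^esub> dist_limp A B C h f \<longleftrightarrow> dist_comp Q A B C g f \<le>\<^bsub>A\<rightarrow>C\<^esub> h"
  using assms A B C by (auto simp: dist_comp_le_iff dist_le_iff[of B C] le_dist_limp_point_iff dist_arr)

end

lemma dist_order:
  assumes A: "is_qcat Q A" and B: "is_qcat Q B"
  shows "partial_order (dist_hom Q A B)"
proof -
  have e: "eq (dist_hom Q A B) = (=)" by (simp add: dist_hom_def)
  show ?thesis
  proof (unfold_locales, unfold e)
    fix \<phi> \<psi> \<chi>
    assume [simp]: "\<phi> \<in> dist A B"
    show "\<phi> \<le>\<^bsub>A\<rightarrow>B\<^esub> \<phi>" using A B by (simp add: dist_le_iff dist_arr)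
    assume [simp]: "\<psi> \<in> dist A B"
    show "\<phi> = \<psi>" if "\<phi> \<le>\<^bsub>A\<rightarrow>B\<^esub> \<psi>" "\<psi> \<le>\<^bsub>A\<rightarrow>B\<^esub> \<phi>"
      using that A B by (intro dist_eqI[of _ A B]) (auto simp: dist_le_iff dist_arr intro!: arr_antisym)
    assume [simp]: "\<chi> \<in> dist A B"
    show "\<phi> \<le>\<^bsub>A\<rightarrow>B\<^esub> \<chi>" if "\<phi> \<le>\<^bsub>A\<rightarrow>B\<^esub> \<psi>" "\<psi> \<le>\<^bsub>A\<rightarrow>B\<^esub> \<chi>"
      using that A B unfolding dist_le_iff
      by (meson \<open>\<phi> \<in> dist A B\<close> \<open>\<psi> \<in> dist A B\<close> \<open>\<chi> \<in> dist A B\<close> arr_trans dist_arr qtyp_Ob)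
  qed auto
qed

lemma dist_refl:
  assumes "is_qcat Q A" "is_qcat Q B" "\<phi> \<in> dist A B" shows "\<phi> \<le>\<^bsub>A\<rightarrow>B\<^esub> \<phi>"
proof -
  interpret partial_order "dist_hom Q A B" using assms by (simp add: dist_order)
  show ?thesis using assms by simp
qed

lemma dist_antisym:
  assumes "is_qcat Q A" "is_qcat Q B" "\<phi> \<in> dist A B" "\<psi> \<in> dist A B" "\<phi> \<le>\<^bsub>A\<rightarrow>B\<^esub> \<psi>" "\<psi> \<le>\<^bsub>A\<rightarrow>B\<^esub> \<phi>"
  shows "\<phi> = \<psi>"
proof -
  interpret partial_order "dist_hom Q A B" using assms by (simp add: dist_order)
  show ?thesis using assms by blast
qed

lemma dist_trans:
  assumes "is_qcat Q A" "is_qcat Q B" "\<phi> \<in> dist A B" "\<psi> \<in> dist A B" "\<chi> \<in> dist A B"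
    "\<phi> \<le>\<^bsub>A\<rightarrow>B\<^esub> \<psi>" "\<psi> \<le>\<^bsub>A\<rightarrow>B\<^esub> \<chi>"
  shows "\<phi> \<le>\<^bsub>A\<rightarrow>B\<^esub> \<chi>"
proof -
  interpret partial_order "dist_hom Q A B" using assms by (simp add: dist_order)
  show ?thesis using assms le_trans by blast
qed

text \<open>Implications are determined by the distributors below them; with the adjunctions \<open>le_dist_rimp_iff\<close> and
\<open>le_dist_limp_iff\<close>, equations between them reduce to associativity of composition.\<close>

lemma dist_eqI_lower:
  assumes "is_qcat Q A" "is_qcat Q B" "\<phi> \<in> dist A B" "\<psi> \<in> dist A B"
    and "\<And>\<chi>. \<chi> \<in> dist A B \<Longrightarrow> \<chi> \<le>\<^bsub>A\<rightarrow>B\<^esub> \<phi> \<longleftrightarrow> \<chi> \<le>\<^bsub>A\<rightarrow>B\<^esub> \<psi>"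
  shows "\<phi> = \<psi>"
  using assms dist_antisym dist_refl by metis

lemma left_implication_eq_dist_limp:
  assumes "is_qcat Q A" "is_qcat Q B" "is_qcat Q C" "f \<in> dist A B" "h \<in> dist A C"
  shows "left_implication (dist_hom Q B C) (dist_hom Q A C) (dist_comp Q A B C) h f = dist_limp A B C h f"
  unfolding left_implication_def
proof (rule the_equality)
  show "dist_limp A B C h f \<in> dist B C \<and>
      (\<forall>g\<in>dist B C. dist_comp Q A B C g f \<le>\<^bsub>A\<rightarrow>C\<^esub> h \<longleftrightarrow> g \<le>\<^bsub>B\<rightarrow>C\<^esub> dist_limp A B C h f)"
    using assms by (simp add: le_dist_limp_iff)
next
  fix k assume "k \<in> dist B C \<and> (\<forall>g\<in>dist B C. dist_comp Q A B C g f \<le>\<^bsub>A\<rightarrow>C\<^esub> h \<longleftrightarrow> g \<le>\<^bsub>B\<rightarrow>C\<^esub> k)"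
  then show "k = dist_limp A B C h f"
    using assms by (intro dist_eqI_lower[of B C]) (auto simp: le_dist_limp_iff)
qed

lemma right_implication_eq_dist_rimp:
  assumes "is_qcat Q A" "is_qcat Q B" "is_qcat Q C" "g \<in> dist B C" "h \<in> dist A C"
  shows "right_implication (dist_hom Q A B) (dist_hom Q A C) (dist_comp Q A B C) g h = dist_rimp A B C g h"
  unfolding right_implication_def
proof (rule the_equality)
  show "dist_rimp A B C g h \<in> dist A B \<and>
      (\<forall>f\<in>dist A B. dist_comp Q A B C g f \<le>\<^bsub>A\<rightarrow>C\<^esub> h \<longleftrightarrow> f \<le>\<^bsub>A\<rightarrow>B\<^esub> dist_rimp A B C g h)"
    using assms by (simp add: le_dist_rimp_iff)
next
  fix k assume "k \<in> dist A B \<and> (\<forall>f\<in>dist A B. dist_comp Q A B C g f \<le>\<^bsub>A\<rightarrow>C\<^esub> h \<longleftrightarrow> f \<le>\<^bsub>A\<rightarrow>B\<^esub> k)"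
  then show "k = dist_rimp A B C g h"
    using assms by (intro dist_eqI_lower[of A B]) (auto simp: le_dist_rimp_iff)
qed

lemma dist_rimp_dist_limp:
  assumes "is_qcat Q A" "is_qcat Q X" "is_qcat Q B" "is_qcat Q C"
    "\<mu> \<in> dist A X" "h \<in> dist A C" "v \<in> dist B C"
  shows "dist_rimp X B C v (dist_limp A X C h \<mu>) = dist_limp A X B (dist_rimp A B C v h) \<mu>"
  using assms
  by (intro dist_eqI_lower[of X B]) (simp_all add: le_dist_rimp_iff le_dist_limp_iff dist_comp_assoc)

lemma dist_limp_dist_limp:
  assumes "is_qcat Q A" "is_qcat Q X" "is_qcat Q B" "is_qcat Q C"
    "u \<in> dist A B" "\<mu> \<in> dist B X" "h \<in> dist A C"
  shows "dist_limp B X C (dist_limp A B C h u) \<mu> = dist_limp A X C h (dist_comp Q A B X \<mu> u)"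
  using assms
  by (intro dist_eqI_lower[of X C]) (simp_all add: le_dist_rimp_iff le_dist_limp_iff dist_comp_assoc)

lemma dist_rimp_dist_rimp:
  assumes "is_qcat Q A" "is_qcat Q X" "is_qcat Q B" "is_qcat Q C"
    "v \<in> dist A B" "w \<in> dist B C" "h \<in> dist X C"
  shows "dist_rimp X A B v (dist_rimp X B C w h) = dist_rimp X A C (dist_comp Q A B C w v) h"
  using assms
  by (intro dist_eqI_lower[of X A]) (simp_all add: le_dist_rimp_iff le_dist_limp_iff dist_comp_assoc)

lemma dist_rimp_id: "is_qcat Q A \<Longrightarrow> is_qcat Q B \<Longrightarrow> h \<in> dist A B \<Longrightarrow> dist_rimp A B B (qhom B) h = h"
  by (intro dist_eqI_lower[of A B]) (simp_all add: le_dist_rimp_iff dist_comp_id_left)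

lemma dist_limp_id: "is_qcat Q A \<Longrightarrow> is_qcat Q B \<Longrightarrow> h \<in> dist A B \<Longrightarrow> dist_limp A A B h (qhom A) = h"
  by (intro dist_eqI_lower[of A B]) (simp_all add: le_dist_limp_iff dist_comp_id_right)

lemma dist_comp_dist_rimp_le:
  assumes "is_qcat Q A" "is_qcat Q B" "is_qcat Q C" "g \<in> dist B C" "h \<in> dist A C"
  shows "dist_comp Q A B C g (dist_rimp A B C g h) \<le>\<^bsub>A\<rightarrow>C\<^esub> h"
proof -
  have "dist_rimp A B C g h \<le>\<^bsub>A\<rightarrow>B\<^esub> dist_rimp A B C g h"
    using assms by (intro dist_refl dist_rimp_dist)
  then show ?thesis
    by (subst (asm) le_dist_rimp_iff) (intro assms dist_rimp_dist)+
qed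

lemma dist_comp_dist_limp_le:
  assumes "is_qcat Q A" "is_qcat Q B" "is_qcat Q C" "f \<in> dist A B" "h \<in> dist A C"
  shows "dist_comp Q A B C (dist_limp A B C h f) f \<le>\<^bsub>A\<rightarrow>C\<^esub> h"
proof -
  have "dist_limp A B C h f \<le>\<^bsub>B\<rightarrow>C\<^esub> dist_limp A B C h f"
    using assms by (intro dist_refl dist_limp_dist)
  then show ?thesis
    by (subst (asm) le_dist_limp_iff) (intro assms dist_limp_dist)+
qed

lemma dist_rimp_antimono:
  assumes A: "is_qcat Q A" and B: "is_qcat Q B" and C: "is_qcat Q C"
    and g: "g \<in> dist B C" and g': "g' \<in> dist B C" and h: "h \<in> dist A C" and le: "g \<le>\<^bsub>B\<rightarrow>C\<^esub> g'"
  shows "dist_rimp A B C g' h \<le>\<^bsub>A\<rightarrow>B\<^esub> dist_rimp A B C g h"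
proof (subst le_dist_rimp_iff[OF A B C _ g h])
  show r: "dist_rimp A B C g' h \<in> dist A B" by (intro dist_rimp_dist A B C g' h)
  have "dist_comp Q A B C g (dist_rimp A B C g' h) \<le>\<^bsub>A\<rightarrow>C\<^esub> dist_comp Q A B C g' (dist_rimp A B C g' h)"
    by (intro dist_comp_mono A B C g g' r le dist_refl)
  then show "dist_comp Q A B C g (dist_rimp A B C g' h) \<le>\<^bsub>A\<rightarrow>C\<^esub> h"
    by (rule dist_trans[rotated 5])
      (intro A B C g g' h r dist_comp_dist dist_comp_dist_rimp_le)+
qed

lemma dist_limp_antimono:
  assumes A: "is_qcat Q A" and B: "is_qcat Q B" and C: "is_qcat Q C"
    and f: "f \<in> dist A B" and f': "f' \<in> dist A B" and h: "h \<in> dist A C" and le: "f \<le>\<^bsub>A\<rightarrow>B\<^esub> f'"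
  shows "dist_limp A B C h f' \<le>\<^bsub>B\<rightarrow>C\<^esub> dist_limp A B C h f"
proof (subst le_dist_limp_iff[OF A B C f _ h])
  show r: "dist_limp A B C h f' \<in> dist B C" by (intro dist_limp_dist A B C f' h)
  have "dist_comp Q A B C (dist_limp A B C h f') f \<le>\<^bsub>A\<rightarrow>C\<^esub> dist_comp Q A B C (dist_limp A B C h f') f'"
    by (intro dist_comp_mono A B C f f' r le dist_refl)
  then show "dist_comp Q A B C (dist_limp A B C h f') f \<le>\<^bsub>A\<rightarrow>C\<^esub> h"
    by (rule dist_trans[rotated 5])
      (intro A B C f f' h r dist_comp_dist dist_comp_dist_limp_le)+
qed

lemma le_dist_limp_dist_rimp:
  assumes A: "is_qcat Q A" and X: "is_qcat Q X" and B: "is_qcat Q B"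
    and \<phi>: "\<phi> \<in> dist A B" and \<nu>: "\<nu> \<in> dist X B"
  shows "\<nu> \<le>\<^bsub>X\<rightarrow>B\<^esub> dist_limp A X B \<phi> (dist_rimp A X B \<nu> \<phi>)"
  by (subst le_dist_limp_iff) (intro A X B \<phi> \<nu> dist_rimp_dist dist_comp_dist_rimp_le)+

lemma le_dist_rimp_dist_limp:
  assumes A: "is_qcat Q A" and X: "is_qcat Q X" and B: "is_qcat Q B"
    and \<phi>: "\<phi> \<in> dist A B" and \<mu>: "\<mu> \<in> dist A X"
  shows "\<mu> \<le>\<^bsub>A\<rightarrow>X\<^esub> dist_rimp A X B (dist_limp A X B \<phi> \<mu>) \<phi>"
  by (subst le_dist_rimp_iff) (intro A X B \<phi> \<mu> dist_limp_dist dist_comp_dist_limp_le)+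

text \<open>\<open>\<mu> \<mapsto> \<phi> \<swarrow> \<mu>\<close> and \<open>\<nu> \<mapsto> \<nu> \<searrow> \<phi>\<close> form an antitone Galois connection, so applying the two maps alternately
stabilises after one step.\<close>

lemma dist_limp_dist_rimp_dist_limp:
  assumes A: "is_qcat Q A" and X: "is_qcat Q X" and B: "is_qcat Q B"
    and \<phi>: "\<phi> \<in> dist A B" and \<mu>: "\<mu> \<in> dist A X"
  shows "dist_limp A X B \<phi> (dist_rimp A X B (dist_limp A X B \<phi> \<mu>) \<phi>) = dist_limp A X B \<phi> \<mu>"
  by (rule dist_antisym[OF X B])
    (intro A X B \<phi> \<mu> dist_limp_dist dist_rimp_dist dist_limp_antimono le_dist_rimp_dist_limp le_dist_limp_dist_rimp)+

lemma dist_rimp_dist_limp_dist_rimp: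
  assumes A: "is_qcat Q A" and X: "is_qcat Q X" and B: "is_qcat Q B"
    and \<phi>: "\<phi> \<in> dist A B" and \<nu>: "\<nu> \<in> dist X B"
  shows "dist_rimp A X B (dist_limp A X B \<phi> (dist_rimp A X B \<nu> \<phi>)) \<phi> = dist_rimp A X B \<nu> \<phi>"
  by (rule dist_antisym[OF A X])
    (intro A X B \<phi> \<nu> dist_limp_dist dist_rimp_dist dist_rimp_antimono le_dist_rimp_dist_limp le_dist_limp_dist_rimp)+

section \<open>Chu connections between distributors\<close>

definition chu_connection :: "('a, 'o, 'm) qcat \<Rightarrow> ('b, 'o, 'm) qcat \<Rightarrow> ('a \<times> 'b \<Rightarrow> 'm)
    \<Rightarrow> ('c, 'o, 'm) qcat \<Rightarrow> ('d, 'o, 'm) qcat \<Rightarrow> ('c \<times> 'd \<Rightarrow> 'm)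
    \<Rightarrow> ('a \<times> 'c \<Rightarrow> 'm) \<Rightarrow> ('b \<times> 'd \<Rightarrow> 'm) \<Rightarrow> bool" where
  "chu_connection A B \<phi> A' B' \<psi> u v \<longleftrightarrow> u \<in> dist A A' \<and> v \<in> dist B B' \<and> dist_limp A A' B \<phi> u = dist_rimp A' B B' v \<psi>"

lemma chu_connection_id: "is_qcat Q A \<Longrightarrow> is_qcat Q B \<Longrightarrow> \<phi> \<in> dist A B \<Longrightarrow> chu_connection A B \<phi> A B \<phi> (qhom A) (qhom B)"
  by (simp add: chu_connection_def dist_limp_id dist_rimp_id)

text \<open>\<open>f \<swarrow> (u' \<circ> u) = (f \<swarrow> u) \<swarrow> u' = (v \<searrow> g) \<swarrow> u' = v \<searrow> (g \<swarrow> u') = v \<searrow> (v' \<searrow> h) = (v' \<circ> v) \<searrow> h\<close>.\<close>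

lemma chu_connection_comp:
  assumes [simp]: "is_qcat Q A" "is_qcat Q B" "is_qcat Q A'" "is_qcat Q B'" "is_qcat Q A''" "is_qcat Q B''"
    and [simp]: "f \<in> dist A B" "g \<in> dist A' B'" "h \<in> dist A'' B''"
    and "chu_connection A B f A' B' g u v" "chu_connection A' B' g A'' B'' h u' v'"
  shows "chu_connection A B f A'' B'' h (dist_comp Q A A' A'' u' u) (dist_comp Q B B' B'' v' v)"
proof -
  have [simp]: "u \<in> dist A A'" "v \<in> dist B B'" "u' \<in> dist A' A''" "v' \<in> dist B' B''"
    and 1: "dist_limp A A' B f u = dist_rimp A' B B' v g" and 2: "dist_limp A' A'' B' g u' = dist_rimp A'' B' B'' v' h"
    using assms by (auto simp: chu_connection_def)
  have "dist_limp A A'' B f (dist_comp Q A A' A'' u' u) = dist_limp A' A'' B (dist_rimp A' B B' v g) u'"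
    by (simp add: dist_limp_dist_limp[symmetric] 1)
  also have "\<dots> = dist_rimp A'' B B' v (dist_rimp A'' B' B'' v' h)"
    by (simp add: dist_rimp_dist_limp[symmetric] 2)
  also have "\<dots> = dist_rimp A'' B B'' (dist_comp Q B B' B'' v' v) h"
    by (simp add: dist_rimp_dist_rimp)
  finally show ?thesis by (simp add: chu_connection_def)
qed

abbreviation chucon :: "(('u, 'o, 'm) qcat \<times> ('u, 'o, 'm) qcat \<times> ('u \<times> 'u \<Rightarrow> 'm),
    ('u \<times> 'u \<Rightarrow> 'm) \<times> ('u \<times> 'u \<Rightarrow> 'm)) locat" where
  "chucon \<equiv> ChuCon (Dist Q)"

lemma Ob_chucon: "(A, B, \<phi>) \<in> Ob chucon \<longleftrightarrow>
    is_qcat Q A \<and> is_qcat Q B \<and> objs A \<prec> (UNIV :: 'u set) \<and> objs B \<prec> (UNIV :: 'u set) \<and> \<phi> \<in> dist A B"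
  for A B :: "('u, 'o, 'm) qcat"
  by (auto simp: ChuCon_def Dist_def)

lemma Hom_chucon:
  assumes "(A, B, \<phi>) \<in> Ob chucon" "(A', B', \<psi>) \<in> Ob chucon"
  shows "(u, v) \<in> carrier (Hom chucon (A, B, \<phi>) (A', B', \<psi>)) \<longleftrightarrow> chu_connection A B \<phi> A' B' \<psi> u v"
  using assms
  by (auto simp: Ob_chucon chu_connection_def ChuCon_def Dist_def limp_def rimp_def
    left_implication_eq_dist_limp right_implication_eq_dist_rimp)

lemma le_chucon:
  "(u, v) \<sqsubseteq>\<^bsub>Hom chucon (A, B, \<phi>) (A', B', \<psi>)\<^esub> (u', v') \<longleftrightarrow> u \<le>\<^bsub>A\<rightarrow>A'\<^esub> u' \<and> v \<le>\<^bsub>B\<rightarrow>B'\<^esub> v'"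
  by (simp add: ChuCon_def Dist_def)

lemma Idt_chucon: "Idt chucon (A, B, \<phi>) = (qhom A, qhom B)"
  by (simp add: ChuCon_def Dist_def)

lemma Cmp_chucon: "Cmp chucon (A, B, \<phi>) (A', B', \<psi>) (A'', B'', \<chi>) (u', v') (u, v) =
    (dist_comp Q A A' A'' u' u, dist_comp Q B B' B'' v' v)"
  by (simp add: ChuCon_def Dist_def)

lemma chucon_order:
  assumes "X \<in> Ob chucon" "Y \<in> Ob chucon"
  shows "partial_order (Hom chucon X Y)"
proof -
  obtain A B \<phi> A' B' \<psi> where XY: "X = (A, B, \<phi>)" "Y = (A', B', \<psi>)"
    by (metis prod_cases3)
  note obs = assms[unfolded XY]
  note [simp] = obs[unfolded Ob_chucon]
  have e: "eq (Hom chucon X Y) = (=)" by (simp add: XY ChuCon_def)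
  show ?thesis
  proof (unfold_locales, unfold e)
    fix p q r
    assume "p \<in> carrier (Hom chucon X Y)"
    then obtain u v where [simp]: "p = (u, v)" "u \<in> dist A A'" "v \<in> dist B B'"
      using Hom_chucon[OF obs] unfolding XY by (metis chu_connection_def surj_pair)
    show "p \<sqsubseteq>\<^bsub>Hom chucon X Y\<^esub> p" by (simp add: XY le_chucon dist_refl)
    assume "q \<in> carrier (Hom chucon X Y)"
    then obtain u' v' where [simp]: "q = (u', v')" "u' \<in> dist A A'" "v' \<in> dist B B'"
      using Hom_chucon[OF obs] unfolding XY by (metis chu_connection_def surj_pair)
    show "p = q" if "p \<sqsubseteq>\<^bsub>Hom chucon X Y\<^esub> q" "q \<sqsubseteq>\<^bsub>Hom chucon X Y\<^esub> p"
      using that dist_antisym[of A A' u u'] dist_antisym[of B B' v v'] by (simp add: XY le_chucon)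
    assume "r \<in> carrier (Hom chucon X Y)"
    then obtain u'' v'' where [simp]: "r = (u'', v'')" "u'' \<in> dist A A'" "v'' \<in> dist B B'"
      using Hom_chucon[OF obs] unfolding XY by (metis chu_connection_def surj_pair)
    show "p \<sqsubseteq>\<^bsub>Hom chucon X Y\<^esub> r" if "p \<sqsubseteq>\<^bsub>Hom chucon X Y\<^esub> q" "q \<sqsubseteq>\<^bsub>Hom chucon X Y\<^esub> r"
      using that dist_trans[of A A' u u' u''] dist_trans[of B B' v v' v''] by (simp add: XY le_chucon)
  qed auto
qed

lemma chucon_locally_ordered:
  "locally_ordered_category (chucon :: (('u, 'o, 'm) qcat \<times> _, _) locat)"
proof (rule locally_ordered_category.intro)
  fix X Y :: "('u, 'o, 'm) qcat \<times> ('u, 'o, 'm) qcat \<times> ('u \<times> 'u \<Rightarrow> 'm)"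
  assume X: "X \<in> Ob chucon"
  obtain A B \<phi> where [simp]: "X = (A, B, \<phi>)" by (metis prod_cases3)
  note [simp] = X[simplified, unfolded Ob_chucon]
  note X' = X[simplified]
  show "Idt chucon X \<in> carrier (Hom chucon X X)"
    by (simp add: Idt_chucon Hom_chucon[OF X' X'] chu_connection_id)
  assume Y: "Y \<in> Ob chucon"
  obtain A' B' \<psi> where [simp]: "Y = (A', B', \<psi>)" by (metis prod_cases3)
  note [simp] = Y[simplified, unfolded Ob_chucon]
  note Y' = Y[simplified]
  show "partial_order (Hom chucon X Y)" using X Y by (rule chucon_order)
  fix p p' assume p: "p \<in> carrier (Hom chucon X Y)"
  obtain u v where [simp]: "p = (u, v)" by (metis surj_pair)
  have uv: "chu_connection A B \<phi> A' B' \<psi> u v" using p Hom_chucon[OF X' Y'] by simp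
  then have [simp]: "u \<in> dist A A'" "v \<in> dist B B'" by (auto simp: chu_connection_def)
  show "Cmp chucon X Y Y (Idt chucon Y) p = p" "Cmp chucon X X Y p (Idt chucon X) = p"
    by (simp_all add: Idt_chucon Cmp_chucon dist_comp_id_left dist_comp_id_right)
  fix Z :: "('u, 'o, 'm) qcat \<times> ('u, 'o, 'm) qcat \<times> ('u \<times> 'u \<Rightarrow> 'm)" and q q'
  assume Z: "Z \<in> Ob chucon"
  obtain A'' B'' \<chi> where [simp]: "Z = (A'', B'', \<chi>)" by (metis prod_cases3)
  note [simp] = Z[simplified, unfolded Ob_chucon]
  note Z' = Z[simplified]
  assume q: "q \<in> carrier (Hom chucon Y Z)"
  obtain u' v' where [simp]: "q = (u', v')" by (metis surj_pair)
  have uv': "chu_connection A' B' \<psi> A'' B'' \<chi> u' v'" using q Hom_chucon[OF Y' Z'] by simp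
  then have [simp]: "u' \<in> dist A' A''" "v' \<in> dist B' B''" by (auto simp: chu_connection_def)
  show "Cmp chucon X Y Z q p \<in> carrier (Hom chucon X Z)"
    using chu_connection_comp[OF _ _ _ _ _ _ _ _ _ uv uv'] by (simp add: Cmp_chucon Hom_chucon[OF X' Z'])
  {
    assume p': "p' \<in> carrier (Hom chucon X Y)" and q': "q' \<in> carrier (Hom chucon Y Z)"
      and le: "p \<sqsubseteq>\<^bsub>Hom chucon X Y\<^esub> p'" "q \<sqsubseteq>\<^bsub>Hom chucon Y Z\<^esub> q'"
    obtain a b c d where [simp]: "p' = (a, b)" "q' = (c, d)" by (metis surj_pair)
    have [simp]: "a \<in> dist A A'" "b \<in> dist B B'" "c \<in> dist A' A''" "d \<in> dist B' B''"
      using p' q' Hom_chucon[OF X' Y'] Hom_chucon[OF Y' Z'] by (auto simp: chu_connection_def)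
    show "Cmp chucon X Y Z q p \<sqsubseteq>\<^bsub>Hom chucon X Z\<^esub> Cmp chucon X Y Z q' p'"
      using le by (auto simp: Cmp_chucon le_chucon intro!: dist_comp_mono)
  }
  fix W :: "('u, 'o, 'm) qcat \<times> ('u, 'o, 'm) qcat \<times> ('u \<times> 'u \<Rightarrow> 'm)" and r
  assume W: "W \<in> Ob chucon"
  obtain A3 B3 \<omega> where [simp]: "W = (A3, B3, \<omega>)" by (metis prod_cases3)
  note [simp] = W[simplified, unfolded Ob_chucon]
  assume r: "r \<in> carrier (Hom chucon Z W)"
  obtain a b where [simp]: "r = (a, b)" by (metis surj_pair)
  have [simp]: "a \<in> dist A'' A3" "b \<in> dist B'' B3"
    using r Hom_chucon[OF Z' W[simplified]] by (auto simp: chu_connection_def)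
  show "Cmp chucon X Z W r (Cmp chucon X Y Z q p) = Cmp chucon X Y W (Cmp chucon Y Z W r q) p"
    by (simp add: Cmp_chucon dist_comp_assoc)
qed

end

lemma opposite_locally_ordered:
  assumes "locally_ordered_category C" shows "locally_ordered_category (opposite C)"
proof -
  interpret locally_ordered_category C by fact
  show ?thesis
    by (rule locally_ordered_category.intro)
      (auto simp: opposite_def hom_order idt_in_hom cmp_in_hom cmp_idt_left cmp_idt_right cmp_assoc cmp_mono)
qed

context quantaloid
begin

section \<open>Adjunctions and completeness\<close>

lemma objs_star [simp]: "objs (star Q X) = {()}"
  and qtyp_star: "qtyp (star Q X) i = X"
  and qhom_star: "qhom (star Q X) p = Idt Q X"
  by (simp_all add: star_def)

text \<open>The following two congruence rules transfer an entry of an implication between categories.  They let a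
Yoneda-type computation be reduced to the unit laws of implication: evaluating at an object \<open>x\<close> turns
a distributor out of \<open>A\<close> into one out of a one-object category, and conversely.\<close>

lemma dist_rimp_point_cong:
  assumes "qtyp A x = qtyp A' x'" "qtyp B y = qtyp B' y'"
    and "x \<in> objs A" "y \<in> objs B" "x' \<in> objs A'" "y' \<in> objs B'"
    and "\<And>z. z \<in> objs C \<Longrightarrow> g (y, z) = g' (y', z)" "\<And>z. z \<in> objs C \<Longrightarrow> h (x, z) = h' (x', z)"
  shows "dist_rimp A B C g h (x, y) = dist_rimp A' B' C g' h' (x', y')"
  using assms by (simp add: dist_rimp_def)

lemma dist_limp_point_cong:
  assumes "qtyp C z = qtyp C' z'" "qtyp B y = qtyp B' y'"
    and "z \<in> objs C" "y \<in> objs B" "z' \<in> objs C'" "y' \<in> objs B'"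
    and "\<And>x. x \<in> objs A \<Longrightarrow> f (x, y) = f' (x, y')" "\<And>x. x \<in> objs A \<Longrightarrow> h (x, z) = h' (x, z')"
  shows "dist_limp A B C h f (y, z) = dist_limp A B' C' h' f' (y', z')"
  using assms by (simp add: dist_limp_def)

text \<open>Implications compose like the hom-arrows of a category.  With one-object categories in place of
\<open>B\<close>, \<open>C\<close> and \<open>D\<close>, this is the composition law of the presheaf category; the dual statement gives that of
the category of closed copresheaves.\<close>

lemma dist_limp_comp_le:
  assumes [simp]: "is_qcat Q A" "is_qcat Q B" "is_qcat Q C" "is_qcat Q D"
    "f \<in> dist A B" "g \<in> dist A C" "h \<in> dist A D"
    and [simp]: "x \<in> objs B" "y \<in> objs C" "z \<in> objs D"
  shows "Cmp Q (qtyp B x) (qtyp C y) (qtyp D z) (dist_limp A C D h g (y, z)) (dist_limp A B C g f (x, y))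
    \<preceq>\<^bsub>qtyp B x\<rightarrow>qtyp D z\<^esub> dist_limp A B D h f (x, z)"
proof -
  have assoc: "dist_comp Q A B D (dist_comp Q B C D (dist_limp A C D h g) (dist_limp A B C g f)) f
      = dist_comp Q A C D (dist_limp A C D h g) (dist_comp Q A B C (dist_limp A B C g f) f)"
    by (simp add: dist_comp_assoc)
  have "dist_comp Q A C D (dist_limp A C D h g) (dist_comp Q A B C (dist_limp A B C g f) f)
      \<le>\<^bsub>A\<rightarrow>D\<^esub> dist_comp Q A C D (dist_limp A C D h g) g"
    by (intro dist_comp_mono) (auto simp: dist_comp_dist_limp_le dist_refl)
  then have "dist_comp Q A B D (dist_comp Q B C D (dist_limp A C D h g) (dist_limp A B C g f)) f \<le>\<^bsub>A\<rightarrow>D\<^esub> h"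
    unfolding assoc by (rule dist_trans[rotated 5]) (simp_all add: dist_comp_dist_limp_le)
  then have "dist_comp Q B C D (dist_limp A C D h g) (dist_limp A B C g f) \<le>\<^bsub>B\<rightarrow>D\<^esub> dist_limp A B D h f"
    by (simp add: le_dist_limp_iff)
  then show ?thesis by (simp add: dist_comp_le_iff)
qed

lemma dist_rimp_comp_le:
  assumes [simp]: "is_qcat Q A" "is_qcat Q B" "is_qcat Q C" "is_qcat Q D"
    "f \<in> dist A D" "g \<in> dist B D" "h \<in> dist C D"
    and [simp]: "x \<in> objs A" "y \<in> objs B" "z \<in> objs C"
  shows "Cmp Q (qtyp A x) (qtyp B y) (qtyp C z) (dist_rimp B C D h g (y, z)) (dist_rimp A B D g f (x, y))
    \<preceq>\<^bsub>qtyp A x\<rightarrow>qtyp C z\<^esub> dist_rimp A C D h f (x, z)"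
proof -
  have assoc: "dist_comp Q A C D h (dist_comp Q A B C (dist_rimp B C D h g) (dist_rimp A B D g f))
      = dist_comp Q A B D (dist_comp Q B C D h (dist_rimp B C D h g)) (dist_rimp A B D g f)"
    by (simp add: dist_comp_assoc)
  have "dist_comp Q A B D (dist_comp Q B C D h (dist_rimp B C D h g)) (dist_rimp A B D g f)
      \<le>\<^bsub>A\<rightarrow>D\<^esub> dist_comp Q A B D g (dist_rimp A B D g f)"
    by (intro dist_comp_mono) (auto simp: dist_comp_dist_rimp_le dist_refl)
  then have "dist_comp Q A C D h (dist_comp Q A B C (dist_rimp B C D h g) (dist_rimp A B D g f)) \<le>\<^bsub>A\<rightarrow>D\<^esub> f"
    unfolding assoc by (rule dist_trans[rotated 5]) (simp_all add: dist_comp_dist_rimp_le)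
  then have "dist_comp Q A B C (dist_rimp B C D h g) (dist_rimp A B D g f) \<le>\<^bsub>A\<rightarrow>C\<^esub> dist_rimp A C D h f"
    by (simp add: le_dist_rimp_iff)
  then show ?thesis by (simp add: dist_comp_le_iff)
qed

lemma qhom_le_dist_limp:
  assumes [simp]: "is_qcat Q A" "is_qcat Q B" "f \<in> dist A B" and "x \<in> objs B" "y \<in> objs B"
  shows "qhom B (x, y) \<preceq>\<^bsub>qtyp B x\<rightarrow>qtyp B y\<^esub> dist_limp A B B f f (x, y)"
proof -
  have "qhom B \<le>\<^bsub>B\<rightarrow>B\<^esub> dist_limp A B B f f" by (simp add: le_dist_limp_iff dist_comp_id_left dist_refl)
  then show ?thesis using assms by (simp add: dist_le_iff)
qed

lemma qhom_le_dist_rimp: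
  assumes [simp]: "is_qcat Q A" "is_qcat Q B" "f \<in> dist A B" and "x \<in> objs A" "y \<in> objs A"
  shows "qhom A (x, y) \<preceq>\<^bsub>qtyp A x\<rightarrow>qtyp A y\<^esub> dist_rimp A A B f f (x, y)"
proof -
  have "qhom A \<le>\<^bsub>A\<rightarrow>A\<^esub> dist_rimp A A B f f" by (simp add: le_dist_rimp_iff dist_comp_id_right dist_refl)
  then show ?thesis using assms by (simp add: dist_le_iff)
qed

lemma underlying_refl: "is_qcat Q A \<Longrightarrow> x \<in> objs A \<Longrightarrow> underlying_le Q A x x"
  by (simp add: underlying_le_def qhom_refl)

lemma qhom_mono_right:
  assumes A: "is_qcat Q A" and le: "underlying_le Q A y y'"
    and [simp]: "x \<in> objs A" "y \<in> objs A" "y' \<in> objs A"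
  shows "qhom A (x, y) \<preceq>\<^bsub>qtyp A x\<rightarrow>qtyp A y\<^esub> qhom A (x, y')"
proof -
  note [simp] = A idt_in_hom cmp_in_hom
  have t [simp]: "qtyp A y' = qtyp A y" and i: "Idt Q (qtyp A y) \<preceq>\<^bsub>qtyp A y\<rightarrow>qtyp A y\<^esub> qhom A (y, y')"
    using le by (auto simp: underlying_le_def)
  have a [simp]: "qhom A (y, y') \<in> arr (qtyp A y) (qtyp A y)" "qhom A (x, y') \<in> arr (qtyp A x) (qtyp A y)"
    using qhom_arr[OF A, of y y'] qhom_arr[OF A, of x y'] by simp_all
  have "qhom A (x, y) = Cmp Q (qtyp A x) (qtyp A y) (qtyp A y) (Idt Q (qtyp A y)) (qhom A (x, y))"
    by (subst cmp_idt_left) auto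
  also have "\<dots> \<preceq>\<^bsub>qtyp A x\<rightarrow>qtyp A y\<^esub> Cmp Q (qtyp A x) (qtyp A y) (qtyp A y) (qhom A (y, y')) (qhom A (x, y))"
    using i by (intro cmp_mono_left) auto
  finally show ?thesis
    by (rule arr_trans) (use qhom_trans[OF A, of x y y'] in auto)
qed

lemma qhom_mono_left:
  assumes A: "is_qcat Q A" and le: "underlying_le Q A x x'"
    and [simp]: "x \<in> objs A" "x' \<in> objs A" "y \<in> objs A"
  shows "qhom A (x', y) \<preceq>\<^bsub>qtyp A x\<rightarrow>qtyp A y\<^esub> qhom A (x, y)"
proof -
  note [simp] = A idt_in_hom cmp_in_hom
  have t [simp]: "qtyp A x' = qtyp A x" and i: "Idt Q (qtyp A x) \<preceq>\<^bsub>qtyp A x\<rightarrow>qtyp A x\<^esub> qhom A (x, x')"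
    using le by (auto simp: underlying_le_def)
  have a [simp]: "qhom A (x, x') \<in> arr (qtyp A x) (qtyp A x)" "qhom A (x', y) \<in> arr (qtyp A x) (qtyp A y)"
    using qhom_arr[OF A, of x x'] qhom_arr[OF A, of x' y] by simp_all
  have "qhom A (x', y) = Cmp Q (qtyp A x) (qtyp A x) (qtyp A y) (qhom A (x', y)) (Idt Q (qtyp A x))"
    by (subst cmp_idt_right) auto
  also have "\<dots> \<preceq>\<^bsub>qtyp A x\<rightarrow>qtyp A y\<^esub> Cmp Q (qtyp A x) (qtyp A x) (qtyp A y) (qhom A (x', y)) (qhom A (x, x'))"
    using i by (intro cmp_mono_right) auto
  finally show ?thesis
    by (rule arr_trans) (use qhom_trans[OF A, of x x' y] in auto)
qed

lemma underlying_trans: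
  assumes A: "is_qcat Q A" and le: "underlying_le Q A x y" "underlying_le Q A y z"
    and [simp]: "x \<in> objs A" "y \<in> objs A" "z \<in> objs A"
  shows "underlying_le Q A x z"
proof -
  have t: "qtyp A y = qtyp A x" "qtyp A z = qtyp A x"
    using le by (auto simp: underlying_le_def)
  have "Idt Q (qtyp A x) \<preceq>\<^bsub>qtyp A x\<rightarrow>qtyp A x\<^esub> qhom A (x, y)"
    using le t by (simp add: underlying_le_def)
  moreover have "qhom A (x, y) \<preceq>\<^bsub>qtyp A x\<rightarrow>qtyp A x\<^esub> qhom A (x, z)"
    using qhom_mono_right[OF A le(2), of x] t by simp
  moreover have "qhom A (x, y) \<in> arr (qtyp A x) (qtyp A x)" "qhom A (x, z) \<in> arr (qtyp A x) (qtyp A x)"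
    using qhom_arr[OF A, of x y] qhom_arr[OF A, of x z] t by simp_all
  ultimately show ?thesis
    using A t by (auto simp: underlying_le_def idt_in_hom intro: arr_trans)
qed

lemma skeletal_eqI:
  assumes A: "is_qcat Q A" and sk: "skeletal Q A" and xy: "x \<in> objs A" "y \<in> objs A" "qtyp A x = qtyp A y"
    and eq: "\<And>z. z \<in> objs A \<Longrightarrow> qhom A (x, z) = qhom A (y, z)"
  shows "x = y"
proof -
  have "underlying_le Q A x y" "underlying_le Q A y x"
    using eq[of x] eq[of y] qhom_refl[OF A xy(1)] qhom_refl[OF A xy(2)] xy
    by (simp_all add: underlying_le_def)
  then show ?thesis using sk xy by (auto simp: skeletal_def)
qed

text \<open>Adjunctions are handled through the hom-equation \<open>B(F x, y) = A(x, G y)\<close>.  It yields functoriality of both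
maps as well: \<open>A(x, y) \<le> A(x, G (F y)) = B(F x, F y)\<close>.\<close>

lemma qadjunctionI:
  assumes A: "is_qcat Q A" and B: "is_qcat Q B"
    and F: "F \<in> objs A \<rightarrow>\<^sub>E objs B" and G: "G \<in> objs B \<rightarrow>\<^sub>E objs A"
    and tF: "\<And>x. x \<in> objs A \<Longrightarrow> qtyp B (F x) = qtyp A x"
    and tG: "\<And>y. y \<in> objs B \<Longrightarrow> qtyp A (G y) = qtyp B y"
    and hom: "\<And>x y. x \<in> objs A \<Longrightarrow> y \<in> objs B \<Longrightarrow> qhom B (F x, y) = qhom A (x, G y)"
  shows "qadjunction Q A B F G"
proof -
  have [simp]: "x \<in> objs A \<Longrightarrow> F x \<in> objs B" "y \<in> objs B \<Longrightarrow> G y \<in> objs A" for x y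
    using F G by auto
  have unit: "underlying_le Q A x (G (F x))" if "x \<in> objs A" for x
    using that tF tG hom[of x "F x"] qhom_refl[OF B, of "F x"] by (simp add: underlying_le_def)
  have counit: "underlying_le Q B (F (G y)) y" if "y \<in> objs B" for y
    using that tF tG hom[of "G y" y] qhom_refl[OF A, of "G y"] by (simp add: underlying_le_def)
  have "is_qfunctor Q A B F"
    unfolding is_qfunctor_def
  proof (intro conjI ballI F)
    fix x y assume [simp]: "x \<in> objs A" "y \<in> objs A"
    show "qhom A (x, y) \<preceq>\<^bsub>qtyp A x\<rightarrow>qtyp A y\<^esub> qhom B (F x, F y)"
      using qhom_mono_right[OF A unit, of y x] by (simp add: hom)
  qed (simp add: tF)
  moreover have "is_qfunctor Q B A G"
    unfolding is_qfunctor_def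
  proof (intro conjI ballI G)
    fix x y assume [simp]: "x \<in> objs B" "y \<in> objs B"
    show "qhom B (x, y) \<preceq>\<^bsub>qtyp B x\<rightarrow>qtyp B y\<^esub> qhom A (G x, G y)"
      using qhom_mono_left[OF B counit, of x y] by (simp add: hom tF tG)
  qed (simp add: tG)
  ultimately show ?thesis
    using unit counit by (simp add: qadjunction_def qfunctor_le_def compose_def)
qed

lemma qadjunction_hom:
  assumes A: "is_qcat Q A" and B: "is_qcat Q B" and adj: "qadjunction Q A B F G"
    and [simp]: "x \<in> objs A" "y \<in> objs B"
  shows "qhom B (F x, y) = qhom A (x, G y)"
proof (rule arr_antisym)
  have F: "is_qfunctor Q A B F" and G: "is_qfunctor Q B A G"
    using adj by (auto simp: qadjunction_def)
  have [simp]: "x \<in> objs A \<Longrightarrow> F x \<in> objs B" "y \<in> objs B \<Longrightarrow> G y \<in> objs A" for x y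
    using F G by (auto simp: is_qfunctor_def)
  have t [simp]: "x \<in> objs A \<Longrightarrow> qtyp B (F x) = qtyp A x" "y \<in> objs B \<Longrightarrow> qtyp A (G y) = qtyp B y" for x y
    using F G by (auto simp: is_qfunctor_def)
  have unit: "underlying_le Q A x (G (F x))" and counit: "underlying_le Q B (F (G y)) y"
    using adj by (auto simp: qadjunction_def qfunctor_le_def compose_def)
  note [simp] = A B
  show a [simp]: "qhom B (F x, y) \<in> arr (qtyp A x) (qtyp B y)" "qhom A (x, G y) \<in> arr (qtyp A x) (qtyp B y)"
    using qhom_arr[OF B, of "F x" y] qhom_arr[OF A, of x "G y"] by simp_all
  have [simp]: "qhom A (G (F x), G y) \<in> arr (qtyp A x) (qtyp B y)" "qhom B (F x, F (G y)) \<in> arr (qtyp A x) (qtyp B y)"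
    using qhom_arr[OF B, of "F x" "F (G y)"] qhom_arr[OF A, of "G (F x)" "G y"] by simp_all
  have "qhom B (F x, y) \<preceq>\<^bsub>qtyp A x\<rightarrow>qtyp B y\<^esub> qhom A (G (F x), G y)"
    using G unfolding is_qfunctor_def by (metis \<open>y \<in> objs B\<close> \<open>x \<in> objs A\<close> \<open>\<And>x. x \<in> objs A \<Longrightarrow> F x \<in> objs B\<close> t(1))
  moreover have "qhom A (G (F x), G y) \<preceq>\<^bsub>qtyp A x\<rightarrow>qtyp B y\<^esub> qhom A (x, G y)"
    using qhom_mono_left[OF A unit, of "G y"] by simp
  ultimately show "qhom B (F x, y) \<preceq>\<^bsub>qtyp A x\<rightarrow>qtyp B y\<^esub> qhom A (x, G y)"
    by (rule arr_trans) auto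
  have "qhom A (x, G y) \<preceq>\<^bsub>qtyp A x\<rightarrow>qtyp B y\<^esub> qhom B (F x, F (G y))"
    using F unfolding is_qfunctor_def by (metis \<open>y \<in> objs B\<close> \<open>x \<in> objs A\<close> \<open>\<And>y. y \<in> objs B \<Longrightarrow> G y \<in> objs A\<close> t(2))
  moreover have "qhom B (F x, F (G y)) \<preceq>\<^bsub>qtyp A x\<rightarrow>qtyp B y\<^esub> qhom B (F x, y)"
    using qhom_mono_right[OF B counit, of "F x"] by simp
  ultimately show "qhom A (x, G y) \<preceq>\<^bsub>qtyp A x\<rightarrow>qtyp B y\<^esub> qhom B (F x, y)"
    by (rule arr_trans) auto
qed (use A B in auto)

lemma left_adjoint_iff:
  assumes A: "is_qcat Q A" and B: "is_qcat Q B"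
  shows "left_adjoint Q A B F \<longleftrightarrow>
    F \<in> objs A \<rightarrow>\<^sub>E objs B \<and> (\<forall>x\<in>objs A. qtyp B (F x) = qtyp A x) \<and>
    (\<exists>G. (\<forall>y\<in>objs B. G y \<in> objs A \<and> qtyp A (G y) = qtyp B y) \<and>
      (\<forall>x\<in>objs A. \<forall>y\<in>objs B. qhom B (F x, y) = qhom A (x, G y)))" (is "_ = ?R")
proof
  assume "left_adjoint Q A B F"
  then obtain G where adj: "qadjunction Q A B F G" by (auto simp: left_adjoint_def)
  then show ?R
    using qadjunction_hom[OF A B adj]
    by (auto simp: qadjunction_def is_qfunctor_def intro!: exI[of _ G])
next
  assume ?R
  then obtain G where F: "F \<in> objs A \<rightarrow>\<^sub>E objs B" "\<forall>x\<in>objs A. qtyp B (F x) = qtyp A x"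
    and G: "\<forall>y\<in>objs B. G y \<in> objs A \<and> qtyp A (G y) = qtyp B y"
      "\<forall>x\<in>objs A. \<forall>y\<in>objs B. qhom B (F x, y) = qhom A (x, G y)" by blast
  then have "qadjunction Q A B F (restrict G (objs B))"
    by (intro qadjunctionI[OF A B]) auto
  then show "left_adjoint Q A B F" by (auto simp: left_adjoint_def)
qed

lemma objs_presheaves:
  "(X, \<mu>) \<in> objs (presheaves Q A) \<longleftrightarrow> X \<in> Ob Q \<and> \<mu> \<in> dist A (star Q X)"
  by (simp add: presheaves_def Let_def)

lemma qtyp_presheaves:
  "(X, \<mu>) \<in> objs (presheaves Q A) \<Longrightarrow> qtyp (presheaves Q A) (X, \<mu>) = X"
  by (simp add: presheaves_def Let_def)

lemma qhom_presheaves: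
  assumes "is_qcat Q A" "(X, \<mu>) \<in> objs (presheaves Q A)" "(Y, \<nu>) \<in> objs (presheaves Q A)"
  shows "qhom (presheaves Q A) ((X, \<mu>), (Y, \<nu>)) = dist_limp A (star Q X) (star Q Y) \<nu> \<mu> ((), ())"
proof -
  have "qhom (presheaves Q A) ((X, \<mu>), (Y, \<nu>)) =
     left_implication (dist_hom Q (star Q X) (star Q Y)) (dist_hom Q A (star Q Y))
       (dist_comp Q A (star Q X) (star Q Y)) \<nu> \<mu> ((), ())"
    using assms by (simp add: presheaves_def Let_def)
  then show ?thesis
    using assms by (simp add: objs_presheaves left_implication_eq_dist_limp)
qed

lemma is_qcat_presheaves:
  assumes A: "is_qcat Q A" shows "is_qcat Q (presheaves Q A)"
  unfolding is_qcat_def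
proof (intro conjI ballI)
  note [simp] = objs_presheaves qtyp_presheaves qhom_presheaves A
  show "qtyp (presheaves Q A) \<in> objs (presheaves Q A) \<rightarrow>\<^sub>E Ob Q"
    by (auto simp: presheaves_def Let_def)
  show "qhom (presheaves Q A) \<in> (\<Pi>\<^sub>E (x, y)\<in>objs (presheaves Q A) \<times> objs (presheaves Q A).
      arr (qtyp (presheaves Q A) x) (qtyp (presheaves Q A) y))"
  proof (rule PiE_I)
    fix p assume "p \<in> objs (presheaves Q A) \<times> objs (presheaves Q A)"
    then obtain X \<mu> Y \<nu> where "p = ((X, \<mu>), (Y, \<nu>))"
      "X \<in> Ob Q" "\<mu> \<in> dist A (star Q X)" "Y \<in> Ob Q" "\<nu> \<in> dist A (star Q Y)"
      by auto
    then show "qhom (presheaves Q A) p \<in> (case p of (x, y) \<Rightarrow> arr (qtyp (presheaves Q A) x) (qtyp (presheaves Q A) y))"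
      using dist_limp_arr[of A "star Q X" "star Q Y" "()" "()" \<nu> \<mu>] by (simp add: qtyp_star)
  qed (auto simp: presheaves_def Let_def)
  fix x assume "x \<in> objs (presheaves Q A)"
  then obtain X \<mu> where [simp]: "x = (X, \<mu>)" "X \<in> Ob Q" "\<mu> \<in> dist A (star Q X)" by (cases x) auto
  show "Idt Q (qtyp (presheaves Q A) x) \<preceq>\<^bsub>qtyp (presheaves Q A) x\<rightarrow>qtyp (presheaves Q A) x\<^esub>
      qhom (presheaves Q A) (x, x)"
    using qhom_le_dist_limp[of A "star Q X" \<mu> "()" "()"] by (simp add: qtyp_star qhom_star)
  fix y assume "y \<in> objs (presheaves Q A)"
  then obtain Y \<nu> where [simp]: "y = (Y, \<nu>)" "Y \<in> Ob Q" "\<nu> \<in> dist A (star Q Y)" by (cases y) auto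
  fix z assume "z \<in> objs (presheaves Q A)"
  then obtain Z \<xi> where [simp]: "z = (Z, \<xi>)" "Z \<in> Ob Q" "\<xi> \<in> dist A (star Q Z)" by (cases z) auto
  show "Cmp Q (qtyp (presheaves Q A) x) (qtyp (presheaves Q A) y) (qtyp (presheaves Q A) z)
      (qhom (presheaves Q A) (y, z)) (qhom (presheaves Q A) (x, y))
    \<preceq>\<^bsub>qtyp (presheaves Q A) x\<rightarrow>qtyp (presheaves Q A) z\<^esub> qhom (presheaves Q A) (x, z)"
    using dist_limp_comp_le[of A "star Q X" "star Q Y" "star Q Z" \<mu> \<nu> \<xi> "()" "()" "()"]
    by (simp add: qtyp_star)
qed

definition representable :: "('a, 'o, 'm) qcat \<Rightarrow> 'a \<Rightarrow> 'a \<times> unit \<Rightarrow> 'm" where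
  "representable A x = (\<lambda>(a, _)\<in>objs A \<times> {()}. qhom A (a, x))"

lemma representable_dist [simp]:
  assumes A: "is_qcat Q A" and [simp]: "x \<in> objs A"
  shows "representable A x \<in> dist A (star Q (qtyp A x))"
proof (rule distI)
  note [simp] = A
  fix a a' i i'
  show "representable A x \<in> extensional (objs A \<times> objs (star Q (qtyp A x)))"
    by (simp add: representable_def)
  assume [simp]: "a \<in> objs A"
  assume "i \<in> objs (star Q (qtyp A x))"
  then have [simp]: "i = ()" by simp
  show "representable A x (a, i) \<in> arr (qtyp A a) (qtyp (star Q (qtyp A x)) i)"
    by (simp add: representable_def qtyp_star)
  show "Cmp Q (qtyp A a) (qtyp (star Q (qtyp A x)) i) (qtyp (star Q (qtyp A x)) i')
      (qhom (star Q (qtyp A x)) (i, i')) (representable A x (a, i))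
    \<preceq>\<^bsub>qtyp A a\<rightarrow>qtyp (star Q (qtyp A x)) i'\<^esub> representable A x (a, i')"
    by (simp add: representable_def qtyp_star qhom_star cmp_idt_left)
  assume [simp]: "a' \<in> objs A"
  show "Cmp Q (qtyp A a') (qtyp A a) (qtyp (star Q (qtyp A x)) i) (representable A x (a, i)) (qhom A (a', a))
    \<preceq>\<^bsub>qtyp A a'\<rightarrow>qtyp (star Q (qtyp A x)) i\<^esub> representable A x (a', i)"
    by (simp add: representable_def qtyp_star qhom_trans)
qed (use assms in auto)

lemma yoneda_apply: "x \<in> objs A \<Longrightarrow> yoneda A x = (qtyp A x, representable A x)"
  by (simp add: yoneda_def representable_def)

text \<open>The Yoneda lemma in the form needed for suprema: hom-arrows of the presheaf category into representable
presheaves are entries of the single distributor \<open>A \<swarrow> \<theta>\<close>.\<close>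

lemma qhom_to_representable:
  assumes A: "is_qcat Q A" and \<theta>: "X \<in> Ob Q" "\<theta> \<in> dist A (star Q X)" and y: "y \<in> objs A"
  shows "qhom (presheaves Q A) ((X, \<theta>), yoneda A y) = dist_limp A (star Q X) A (qhom A) \<theta> ((), y)"
proof -
  have "qhom (presheaves Q A) ((X, \<theta>), yoneda A y) =
      dist_limp A (star Q X) (star Q (qtyp A y)) (representable A y) \<theta> ((), ())"
    using assms by (simp add: yoneda_apply qhom_presheaves objs_presheaves)
  also have "\<dots> = dist_limp A (star Q X) A (qhom A) \<theta> ((), y)"
    using assms by (intro dist_limp_point_cong) (simp_all add: qtyp_star representable_def)
  finally show ?thesis .
qed

text \<open>A left adjoint of the Yoneda embedding picks, for every presheaf \<open>\<theta>\<close>, an object \<open>s\<close> that satisfies the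
hom-equation of the adjunction, that is, a weighted supremum \<open>A(s, -) = A \<swarrow> \<theta>\<close>.\<close>

lemma complete_qcat_iff:
  assumes A: "is_qcat Q A"
  shows "complete_qcat Q A \<longleftrightarrow> (\<forall>X\<in>Ob Q. \<forall>\<theta>\<in>dist A (star Q X). \<exists>s\<in>objs A. qtyp A s = X \<and>
    (\<forall>y\<in>objs A. qhom A (s, y) = dist_limp A (star Q X) A (qhom A) \<theta> ((), y)))" (is "_ = ?R")
proof
  let ?P = "presheaves Q A"
  note P = is_qcat_presheaves[OF A]
  assume "complete_qcat Q A"
  then obtain S where adj: "qadjunction Q ?P A S (yoneda A)" by (auto simp: complete_qcat_def)
  show ?R
  proof (intro ballI)
    fix X \<theta> assume \<theta>: "X \<in> Ob Q" "\<theta> \<in> dist A (star Q X)"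
    then have "(X, \<theta>) \<in> objs ?P" by (simp add: objs_presheaves)
    then show "\<exists>s\<in>objs A. qtyp A s = X \<and>
        (\<forall>y\<in>objs A. qhom A (s, y) = dist_limp A (star Q X) A (qhom A) \<theta> ((), y))"
      using adj qadjunction_hom[OF P A adj] qhom_to_representable[OF A \<theta>]
      by (intro bexI[of _ "S (X, \<theta>)"]) (auto simp: qadjunction_def is_qfunctor_def qtyp_presheaves)
  qed
next
  let ?P = "presheaves Q A"
  note P = is_qcat_presheaves[OF A]
  assume ?R
  then have "\<forall>p\<in>objs ?P. \<exists>s. s \<in> objs A \<and> qtyp A s = fst p \<and>
      (\<forall>y\<in>objs A. qhom A (s, y) = dist_limp A (star Q (fst p)) A (qhom A) (snd p) ((), y))"
    by (force simp: objs_presheaves)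
  then obtain S where S: "\<forall>p\<in>objs ?P. S p \<in> objs A \<and> qtyp A (S p) = fst p \<and>
      (\<forall>y\<in>objs A. qhom A (S p, y) = dist_limp A (star Q (fst p)) A (qhom A) (snd p) ((), y))"
    by metis
  have "qadjunction Q ?P A (restrict S (objs ?P)) (yoneda A)"
  proof (rule qadjunctionI[OF P A])
    show "restrict S (objs ?P) \<in> objs ?P \<rightarrow>\<^sub>E objs A" using S by auto
    show "yoneda A \<in> objs A \<rightarrow>\<^sub>E objs ?P"
    proof (rule PiE_I)
      show "yoneda A x \<in> objs ?P" if "x \<in> objs A" for x
        using that A by (simp add: yoneda_apply objs_presheaves)
    qed (simp add: yoneda_def)
    show "qtyp A (restrict S (objs ?P) p) = qtyp ?P p" if "p \<in> objs ?P" for p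
      using that S by (cases p) (auto simp: qtyp_presheaves)
    show "qtyp ?P (yoneda A y) = qtyp A y" if "y \<in> objs A" for y
      using that A by (simp add: yoneda_apply qtyp_presheaves objs_presheaves)
    show "qhom A (restrict S (objs ?P) p, y) = qhom ?P (p, yoneda A y)" if "p \<in> objs ?P" "y \<in> objs A" for p y
      using that S qhom_to_representable[OF A, of "fst p" "snd p" y]
      by (cases p) (auto simp: objs_presheaves)
  qed
  then show "complete_qcat Q A" by (auto simp: complete_qcat_def)
qed

section \<open>The locally ordered category of complete categories\<close>

lemma Ob_CCat: "A \<in> Ob (CCat Q) \<longleftrightarrow>
    is_qcat Q A \<and> objs A \<prec> (UNIV :: 'u set) \<and> skeletal Q A \<and> complete_qcat Q A"
  for A :: "('u, 'o, 'm) qcat"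
  by (simp add: CCat_def)

lemma Hom_CCat: "F \<in> carrier (Hom (CCat Q) A B) \<longleftrightarrow> left_adjoint Q A B F"
  by (simp add: CCat_def)

lemma le_CCat: "F \<sqsubseteq>\<^bsub>Hom (CCat Q) A B\<^esub> G \<longleftrightarrow> qfunctor_le Q A B F G"
  by (simp add: CCat_def)

lemma Idt_CCat: "Idt (CCat Q) A = (\<lambda>x\<in>objs A. x)"
  by (simp add: CCat_def)

lemma Cmp_CCat: "Cmp (CCat Q) A B C G F = compose (objs A) G F"
  by (simp add: CCat_def)

lemma left_adjoint_PiE: "left_adjoint Q A B F \<Longrightarrow> F \<in> objs A \<rightarrow>\<^sub>E objs B"
  by (auto simp: left_adjoint_def qadjunction_def is_qfunctor_def)

lemma left_adjoint_mono:
  assumes A: "is_qcat Q A" and B: "is_qcat Q B" and F: "left_adjoint Q A B F"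
    and le: "underlying_le Q A x y" and [simp]: "x \<in> objs A" "y \<in> objs A"
  shows "underlying_le Q B (F x) (F y)"
proof -
  have t: "qtyp B (F x) = qtyp A x" "qtyp B (F y) = qtyp A y" and o: "F x \<in> objs B" "F y \<in> objs B"
    and a: "qhom A (x, y) \<preceq>\<^bsub>qtyp A x\<rightarrow>qtyp A y\<^esub> qhom B (F x, F y)"
    using F by (auto simp: left_adjoint_def qadjunction_def is_qfunctor_def)
  have xy: "qtyp A y = qtyp A x" "Idt Q (qtyp A x) \<preceq>\<^bsub>qtyp A x\<rightarrow>qtyp A x\<^esub> qhom A (x, y)"
    using le by (auto simp: underlying_le_def)
  show ?thesis
    using arr_trans[OF xy(2) a[unfolded xy]] A qhom_arr[OF B o] qhom_arr[OF A, of x y] t xy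
    by (simp add: underlying_le_def idt_in_hom)
qed

lemma left_adjoint_id:
  assumes "is_qcat Q A" shows "left_adjoint Q A A (\<lambda>x\<in>objs A. x)"
  using assms by (auto simp: left_adjoint_iff intro!: exI[of _ "\<lambda>x. x"])

lemma left_adjoint_compose:
  assumes A: "is_qcat Q A" and B: "is_qcat Q B" and C: "is_qcat Q C"
    and F: "left_adjoint Q A B F" and H: "left_adjoint Q B C H"
  shows "left_adjoint Q A C (compose (objs A) H F)"
proof -
  obtain G where F': "F \<in> objs A \<rightarrow>\<^sub>E objs B" "\<And>x. x \<in> objs A \<Longrightarrow> qtyp B (F x) = qtyp A x"
    and G: "\<And>y. y \<in> objs B \<Longrightarrow> G y \<in> objs A \<and> qtyp A (G y) = qtyp B y"
      "\<And>x y. x \<in> objs A \<Longrightarrow> y \<in> objs B \<Longrightarrow> qhom B (F x, y) = qhom A (x, G y)"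
    using F unfolding left_adjoint_iff[OF A B] by blast
  obtain K where H': "H \<in> objs B \<rightarrow>\<^sub>E objs C" "\<And>x. x \<in> objs B \<Longrightarrow> qtyp C (H x) = qtyp B x"
    and K: "\<And>y. y \<in> objs C \<Longrightarrow> K y \<in> objs B \<and> qtyp B (K y) = qtyp C y"
      "\<And>x y. x \<in> objs B \<Longrightarrow> y \<in> objs C \<Longrightarrow> qhom C (H x, y) = qhom B (x, K y)"
    using H unfolding left_adjoint_iff[OF B C] by blast
  have [simp]: "x \<in> objs A \<Longrightarrow> F x \<in> objs B" "y \<in> objs B \<Longrightarrow> H y \<in> objs C" for x y
    using F' H' by auto
  show ?thesis
    unfolding left_adjoint_iff[OF A C]
    by (intro conjI exI[of _ "\<lambda>z. G (K z)"]) (auto simp: compose_def F' H' G K)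
qed

lemma CCat_order:
  assumes A: "A \<in> Ob (CCat Q)" and B: "B \<in> Ob (CCat Q)"
  shows "partial_order (Hom (CCat Q) A B)"
proof -
  have e: "eq (Hom (CCat Q) A B) = (=)" by (simp add: CCat_def)
  have A: "is_qcat Q A" and B: "is_qcat Q B" and sk: "skeletal Q B"
    using A B by (auto simp: Ob_CCat)
  show ?thesis
  proof (unfold_locales, unfold e)
    fix F G H
    assume "F \<in> carrier (Hom (CCat Q) A B)"
    then have F: "F \<in> objs A \<rightarrow>\<^sub>E objs B" using left_adjoint_PiE by (auto simp: Hom_CCat)
    show "F \<sqsubseteq>\<^bsub>Hom (CCat Q) A B\<^esub> F"
      using F B by (auto simp: le_CCat qfunctor_le_def intro!: underlying_refl)
    assume "G \<in> carrier (Hom (CCat Q) A B)"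
    then have G: "G \<in> objs A \<rightarrow>\<^sub>E objs B" using left_adjoint_PiE by (auto simp: Hom_CCat)
    show "F = G" if "F \<sqsubseteq>\<^bsub>Hom (CCat Q) A B\<^esub> G" "G \<sqsubseteq>\<^bsub>Hom (CCat Q) A B\<^esub> F"
    proof (rule PiE_ext[OF F G])
      fix x assume "x \<in> objs A"
      then show "F x = G x"
        using that PiE_mem[OF F] PiE_mem[OF G] sk
        by (simp add: le_CCat qfunctor_le_def skeletal_def)
    qed
    assume "H \<in> carrier (Hom (CCat Q) A B)"
    then have H: "H \<in> objs A \<rightarrow>\<^sub>E objs B" using left_adjoint_PiE by (auto simp: Hom_CCat)
    show "F \<sqsubseteq>\<^bsub>Hom (CCat Q) A B\<^esub> H" if "F \<sqsubseteq>\<^bsub>Hom (CCat Q) A B\<^esub> G" "G \<sqsubseteq>\<^bsub>Hom (CCat Q) A B\<^esub> H"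
      unfolding le_CCat qfunctor_le_def
    proof
      fix x assume x: "x \<in> objs A"
      show "underlying_le Q B (F x) (H x)"
        by (rule underlying_trans[OF B, of _ "G x"])
          (use that x F G H in \<open>auto simp: le_CCat qfunctor_le_def\<close>)
    qed
  qed auto
qed

lemma CCat_locally_ordered:
  "locally_ordered_category (CCat Q :: (('u, 'o, 'm) qcat, 'u \<Rightarrow> 'u) locat)"
proof (rule locally_ordered_category.intro)
  fix A B C :: "('u, 'o, 'm) qcat" and F F' G G'
  assume AO: "A \<in> Ob (CCat Q)"
  then have A: "is_qcat Q A" by (simp add: Ob_CCat)
  show "Idt (CCat Q) A \<in> carrier (Hom (CCat Q) A A)"
    using A by (simp add: Idt_CCat Hom_CCat left_adjoint_id)
  assume BO: "B \<in> Ob (CCat Q)"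
  then have B: "is_qcat Q B" by (simp add: Ob_CCat)
  show "partial_order (Hom (CCat Q) A B)" using AO BO by (rule CCat_order)
  assume F: "F \<in> carrier (Hom (CCat Q) A B)"
  then have FP: "F \<in> objs A \<rightarrow>\<^sub>E objs B" by (simp add: Hom_CCat left_adjoint_PiE)
  show "Cmp (CCat Q) A B B (Idt (CCat Q) B) F = F" "Cmp (CCat Q) A A B F (Idt (CCat Q) A) = F"
    using FP by (auto simp: Cmp_CCat Idt_CCat compose_Id Id_compose PiE_def)
  assume CO: "C \<in> Ob (CCat Q)"
  then have C: "is_qcat Q C" by (simp add: Ob_CCat)
  assume G: "G \<in> carrier (Hom (CCat Q) B C)"
  then have GP: "G \<in> objs B \<rightarrow>\<^sub>E objs C" by (simp add: Hom_CCat left_adjoint_PiE)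
  show "Cmp (CCat Q) A B C G F \<in> carrier (Hom (CCat Q) A C)"
    using A B C F G by (simp add: Cmp_CCat Hom_CCat left_adjoint_compose)
  {
    assume F': "F' \<in> carrier (Hom (CCat Q) A B)" and G': "G' \<in> carrier (Hom (CCat Q) B C)"
      and le: "F \<sqsubseteq>\<^bsub>Hom (CCat Q) A B\<^esub> F'" "G \<sqsubseteq>\<^bsub>Hom (CCat Q) B C\<^esub> G'"
    have F'P: "F' \<in> objs A \<rightarrow>\<^sub>E objs B" using F' by (simp add: Hom_CCat left_adjoint_PiE)
    have G'P: "G' \<in> objs B \<rightarrow>\<^sub>E objs C" using G' by (simp add: Hom_CCat left_adjoint_PiE)
    show "Cmp (CCat Q) A B C G F \<sqsubseteq>\<^bsub>Hom (CCat Q) A C\<^esub> Cmp (CCat Q) A B C G' F'"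
      unfolding le_CCat qfunctor_le_def Cmp_CCat
    proof
      fix x assume x: "x \<in> objs A"
      have o [simp]: "F x \<in> objs B" "F' x \<in> objs B" using x FP F'P by auto
      have "underlying_le Q C (G (F x)) (G (F' x))"
        using le x G by (intro left_adjoint_mono[OF B C]) (auto simp: Hom_CCat le_CCat qfunctor_le_def)
      moreover have "underlying_le Q C (G (F' x)) (G' (F' x))"
        using le o by (auto simp: le_CCat qfunctor_le_def)
      ultimately have "underlying_le Q C (G (F x)) (G' (F' x))"
        using PiE_mem[OF GP] PiE_mem[OF G'P] by (rule_tac underlying_trans[OF C]) auto
      then show "underlying_le Q C (compose (objs A) G F x) (compose (objs A) G' F' x)"
        using x by (simp add: compose_eq)
    qed
  }
  fix D :: "('u, 'o, 'm) qcat" and H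
  show "Cmp (CCat Q) A C D H (Cmp (CCat Q) A B C G F) = Cmp (CCat Q) A B D (Cmp (CCat Q) B C D H G) F"
    using FP by (auto simp: Cmp_CCat compose_def fun_eq_iff)
qed

end

section \<open>Smallness\<close>

lemma universe_infinite:
  assumes "set_universe TYPE('u)" shows "infinite (UNIV :: 'u set)"
proof
  assume fin: "finite (UNIV :: 'u set)"
  obtain x :: 'u where True by blast
  have c: "card (UNIV - {x} :: 'u set) < card (UNIV :: 'u set)"
    using fin by (intro psubset_card_mono) auto
  \<comment> \<open>A universe with \<open>n\<close> elements has a smaller subset with \<open>n - 1\<close> elements, which has at least \<open>n\<close> subsets.\<close>
  have "(UNIV - {x} :: 'u set) \<prec> (UNIV :: 'u set)"
    using fin c by (simp add: lesspoll_def lepoll_iff_finite_card subset_imp_lepoll eqpoll_iff_card)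
  then have "Pow (UNIV - {x}) \<prec> (UNIV :: 'u set)"
    using assms unfolding set_universe_def by blast
  then have "\<not> (UNIV :: 'u set) \<lesssim> Pow (UNIV - {x} :: 'u set)"
    by (meson lepoll_antisym lesspoll_def)
  moreover have "(UNIV :: 'u set) \<lesssim> Pow (UNIV - {x} :: 'u set)"
  proof -
    \<comment> \<open>Besides the \<open>n - 1\<close> complements of points, the full subset occurs as the value at \<open>y = x\<close>.\<close>
    have "inj_on (\<lambda>y. UNIV - {x} - {y} :: 'u set) UNIV"
      by (auto simp: inj_on_def)
    then show ?thesis
      unfolding lepoll_def by (intro exI[of _ "\<lambda>y. UNIV - {x} - {y}"]) auto
  qed
  ultimately show False by blast
qed

context includes cardinal_syntax
begin

lemma Times_lesspoll_infinite:
  fixes S :: "'a set" and T :: "'b set" and V :: "'c set"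
  assumes V: "infinite V" and S: "S \<prec> V" and T: "T \<prec> V"
  shows "S \<times> T \<prec> V"
proof (cases "finite S \<and> finite T")
  case True
  then show ?thesis using V by (intro finite_lesspoll_infinite) auto
next
  case False
  show ?thesis
  proof (cases "S = {} \<or> T = {}")
    case True
    then have "S \<times> T = {}" by auto
    then show ?thesis using V by (auto intro: finite_lesspoll_infinite)
  next
    case ne: False
    consider "|S| \<le>o |T|" | "|T| \<le>o |S|"
      using ordLeq_total[OF card_of_Well_order card_of_Well_order] by blast
    then show ?thesis
    proof cases
      case 1
      then have "infinite T" using False card_of_ordLeq_infinite by blast
      then have "|S \<times> T| \<le>o |T|"
        using card_of_Times_infinite[of T S] 1 ne ordIso_iff_ordLeq by blast
      then have "S \<times> T \<lesssim> T" by (simp add: lepoll_def card_of_ordLeq[symmetric])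
      then show ?thesis using T by (rule lesspoll_trans1)
    next
      case 2
      then have "infinite S" using False card_of_ordLeq_infinite by blast
      then have "|S \<times> T| \<le>o |S|"
        using card_of_Times_infinite[of S T] 2 ne ordIso_iff_ordLeq by blast
      then have "S \<times> T \<lesssim> S" by (simp add: lepoll_def card_of_ordLeq[symmetric])
      then show ?thesis using S by (rule lesspoll_trans1)
    qed
  qed
qed

end

section \<open>The complete category of closed copresheaves of a distributor\<close>

locale universe_quantaloid = quantaloid Q for Q :: "('o, 'm) locat" +
  fixes U :: "'u itself"
  assumes universe: "set_universe TYPE('u)" and small: "small_quantaloid TYPE('u) Q"
begin

definition closed_copresheaves :: "('u, 'o, 'm) qcat \<Rightarrow> ('u, 'o, 'm) qcat \<Rightarrow> ('u \<times> 'u \<Rightarrow> 'm)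
    \<Rightarrow> ('o \<times> (unit \<times> 'u \<Rightarrow> 'm)) set" where
  "closed_copresheaves A B \<phi> = {(X, dist_limp A (star Q X) B \<phi> \<mu>) | X \<mu>. X \<in> Ob Q \<and> \<mu> \<in> dist A (star Q X)}"

text \<open>Objects of the categories of \<open>CCat Q\<close> are elements of the universe, whereas closed copresheaves are
functions paired with a type; the choice is immaterial, any injection into the universe serves.\<close>

definition code :: "('u, 'o, 'm) qcat \<Rightarrow> ('u, 'o, 'm) qcat \<Rightarrow> ('u \<times> 'u \<Rightarrow> 'm)
    \<Rightarrow> 'o \<times> (unit \<times> 'u \<Rightarrow> 'm) \<Rightarrow> 'u" where
  "code A B \<phi> = (SOME e. inj_on e (closed_copresheaves A B \<phi>))"

definition decode :: "('u, 'o, 'm) qcat \<Rightarrow> ('u, 'o, 'm) qcat \<Rightarrow> ('u \<times> 'u \<Rightarrow> 'm)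
    \<Rightarrow> 'u \<Rightarrow> 'o \<times> (unit \<times> 'u \<Rightarrow> 'm)" where
  "decode A B \<phi> = inv_into (closed_copresheaves A B \<phi>) (code A B \<phi>)"

definition fixpoint_cat :: "('u, 'o, 'm) qcat \<Rightarrow> ('u, 'o, 'm) qcat \<Rightarrow> ('u \<times> 'u \<Rightarrow> 'm) \<Rightarrow> ('u, 'o, 'm) qcat" where
  "fixpoint_cat A B \<phi> = \<lparr>objs = code A B \<phi> ` closed_copresheaves A B \<phi>,
     qtyp = (\<lambda>i\<in>code A B \<phi> ` closed_copresheaves A B \<phi>. fst (decode A B \<phi> i)),
     qhom = (\<lambda>(i, j)\<in>code A B \<phi> ` closed_copresheaves A B \<phi> \<times> code A B \<phi> ` closed_copresheaves A B \<phi>.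
       dist_rimp (star Q (fst (decode A B \<phi> i))) (star Q (fst (decode A B \<phi> j))) B
         (snd (decode A B \<phi> j)) (snd (decode A B \<phi> i)) ((), ()))\<rparr>"

text \<open>The last argument is the second component of a Chu connection from \<open>\<phi>\<close> to \<open>\<psi>\<close>; the codes hide the map
\<open>\<nu> \<mapsto> v \<searrow> \<nu>\<close>.\<close>

definition fixpoint_map :: "('u, 'o, 'm) qcat \<Rightarrow> ('u, 'o, 'm) qcat \<Rightarrow> ('u \<times> 'u \<Rightarrow> 'm)
    \<Rightarrow> ('u, 'o, 'm) qcat \<Rightarrow> ('u, 'o, 'm) qcat \<Rightarrow> ('u \<times> 'u \<Rightarrow> 'm) \<Rightarrow> ('u \<times> 'u \<Rightarrow> 'm) \<Rightarrow> 'u \<Rightarrow> 'u" where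
  "fixpoint_map A' B' \<psi> A B \<phi> v = (\<lambda>i\<in>objs (fixpoint_cat A' B' \<psi>). code A B \<phi>
     (fst (decode A' B' \<psi> i), dist_rimp (star Q (fst (decode A' B' \<psi> i))) B B' v (snd (decode A' B' \<psi> i))))"

context
  fixes A B :: "('u, 'o, 'm) qcat" and \<phi> :: "'u \<times> 'u \<Rightarrow> 'm"
  assumes obj: "(A, B, \<phi>) \<in> Ob chucon"
begin

lemma source_qcat: "is_qcat Q A" and target_qcat: "is_qcat Q B" and arrow_dist: "\<phi> \<in> dist A B"
  and target_small: "objs B \<prec> (UNIV :: 'u set)"
  using obj by (auto simp: Ob_chucon)

lemma closed_copresheavesD:
  assumes "(X, \<nu>) \<in> closed_copresheaves A B \<phi>"
  shows "X \<in> Ob Q" "\<nu> \<in> dist (star Q X) B"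
  using assms source_qcat target_qcat arrow_dist by (auto simp: closed_copresheaves_def)

lemma closed_copresheaves_fixed:
  assumes "(X, \<nu>) \<in> closed_copresheaves A B \<phi>"
  shows "dist_limp A (star Q X) B \<phi> (dist_rimp A (star Q X) B \<nu> \<phi>) = \<nu>"
  using assms source_qcat target_qcat arrow_dist by (auto simp: closed_copresheaves_def dist_limp_dist_rimp_dist_limp)

text \<open>A copresheaf on \<open>B\<close> is determined by its type and its graph, a subset of the small set
\<open>objs B \<times> arrows Q\<close>.\<close>

lemma closed_copresheaves_small: "closed_copresheaves A B \<phi> \<prec> (UNIV :: 'u set)"
proof -
  define gr where "gr = (\<lambda>(X :: 'o, \<nu> :: unit \<times> 'u \<Rightarrow> 'm). (X, {(b, \<nu> ((), b)) | b. b \<in> objs B}))"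
  have "inj_on gr (closed_copresheaves A B \<phi>)"
  proof (rule inj_onI)
    fix p q assume pq: "p \<in> closed_copresheaves A B \<phi>" "q \<in> closed_copresheaves A B \<phi>" "gr p = gr q"
    obtain X \<nu> Y \<xi> where [simp]: "p = (X, \<nu>)" "q = (Y, \<xi>)" by (metis surj_pair)
    have [simp]: "Y = X" and *: "{(b, \<nu> ((), b)) | b. b \<in> objs B} = {(b, \<xi> ((), b)) | b. b \<in> objs B}"
      using pq(3) by (auto simp: gr_def)
    have "\<nu> = \<xi>"
    proof (rule dist_eqI[of _ "star Q X" B])
      show "\<nu> (x, b) = \<xi> (x, b)" if "x \<in> objs (star Q X)" "b \<in> objs B" for x b
      proof -
        have "(b, \<nu> ((), b)) \<in> {(b, \<xi> ((), b)) | b. b \<in> objs B}" using that * by blast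
        then show ?thesis by auto
      qed
    qed (use pq closed_copresheavesD target_qcat in auto)
    then show "p = q" by simp
  qed
  moreover have "gr ` closed_copresheaves A B \<phi> \<subseteq> Ob Q \<times> Pow (objs B \<times> arrows Q)"
  proof
    fix q assume "q \<in> gr ` closed_copresheaves A B \<phi>"
    then obtain X \<nu> where p: "(X, \<nu>) \<in> closed_copresheaves A B \<phi>" "q = gr (X, \<nu>)" by auto
    have "\<nu> ((), b) \<in> arrows Q" if "b \<in> objs B" for b
      using dist_arr[OF closed_copresheavesD(2)[OF p(1)], of "()" b] closed_copresheavesD(1)[OF p(1)] qtyp_Ob[OF target_qcat that] that
      by (auto simp: arrows_def qtyp_star)
    then show "q \<in> Ob Q \<times> Pow (objs B \<times> arrows Q)"
      using closed_copresheavesD(1)[OF p(1)] by (auto simp: p gr_def)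
  qed
  ultimately have le: "closed_copresheaves A B \<phi> \<lesssim> Ob Q \<times> Pow (objs B \<times> arrows Q)"
    by (auto simp: lepoll_def)
  have inf: "infinite (UNIV :: 'u set)" using universe by (rule universe_infinite)
  have "objs B \<times> arrows Q \<prec> (UNIV :: 'u set)"
    using small target_small inf by (intro Times_lesspoll_infinite) (auto simp: small_quantaloid_def)
  moreover from this obtain f :: "'u \<times> 'm \<Rightarrow> 'u" where f: "inj_on f (objs B \<times> arrows Q)"
    using lesspoll_imp_lepoll unfolding lepoll_def by blast
  ultimately have "f ` (objs B \<times> arrows Q) \<prec> (UNIV :: 'u set)"
    using image_lepoll lesspoll_trans1 by blast
  then have "Pow (f ` (objs B \<times> arrows Q)) \<prec> (UNIV :: 'u set)"
    using universe by (auto simp: set_universe_def)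
  moreover have "Pow (objs B \<times> arrows Q) \<lesssim> Pow (f ` (objs B \<times> arrows Q))"
    using inj_on_image_Pow[OF f] unfolding lepoll_def by (intro exI[of _ "image f"]) auto
  ultimately have "Pow (objs B \<times> arrows Q) \<prec> (UNIV :: 'u set)"
    using lesspoll_trans1 by blast
  then have "Ob Q \<times> Pow (objs B \<times> arrows Q) \<prec> (UNIV :: 'u set)"
    using small inf by (intro Times_lesspoll_infinite) (auto simp: small_quantaloid_def)
  with le show ?thesis by (rule lesspoll_trans1)
qed

lemma inj_code: "inj_on (code A B \<phi>) (closed_copresheaves A B \<phi>)"
proof -
  have "\<exists>e :: _ \<Rightarrow> 'u. inj_on e (closed_copresheaves A B \<phi>)"
    using closed_copresheaves_small by (auto simp: lesspoll_def lepoll_def)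
  then show ?thesis unfolding code_def by (rule someI_ex)
qed

lemma decode_code: "p \<in> closed_copresheaves A B \<phi> \<Longrightarrow> decode A B \<phi> (code A B \<phi> p) = p"
  by (simp add: decode_def inj_code)

lemma objs_fixpoint_cat: "objs (fixpoint_cat A B \<phi>) = code A B \<phi> ` closed_copresheaves A B \<phi>"
  by (simp add: fixpoint_cat_def)

lemma code_in: "p \<in> closed_copresheaves A B \<phi> \<Longrightarrow> code A B \<phi> p \<in> objs (fixpoint_cat A B \<phi>)"
  by (simp add: fixpoint_cat_def)

lemma fixpoint_catE:
  assumes "i \<in> objs (fixpoint_cat A B \<phi>)"
  obtains X \<nu> where "(X, \<nu>) \<in> closed_copresheaves A B \<phi>" "i = code A B \<phi> (X, \<nu>)"
  using assms by (auto simp: objs_fixpoint_cat)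

lemma fixpoint_cat_small: "objs (fixpoint_cat A B \<phi>) \<prec> (UNIV :: 'u set)"
  unfolding objs_fixpoint_cat using closed_copresheaves_small image_lepoll lesspoll_trans1 by blast

lemma qtyp_fixpoint_cat: "(X, \<nu>) \<in> closed_copresheaves A B \<phi> \<Longrightarrow> qtyp (fixpoint_cat A B \<phi>) (code A B \<phi> (X, \<nu>)) = X"
  by (simp add: fixpoint_cat_def decode_code)

lemma qhom_fixpoint_cat:
  "(X, \<nu>) \<in> closed_copresheaves A B \<phi> \<Longrightarrow> (Y, \<xi>) \<in> closed_copresheaves A B \<phi> \<Longrightarrow>
    qhom (fixpoint_cat A B \<phi>) (code A B \<phi> (X, \<nu>), code A B \<phi> (Y, \<xi>))
      = dist_rimp (star Q X) (star Q Y) B \<xi> \<nu> ((), ())"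
  by (simp add: fixpoint_cat_def decode_code)

lemma is_qcat_fixpoint_cat: "is_qcat Q (fixpoint_cat A B \<phi>)"
  unfolding is_qcat_def
proof (intro conjI ballI)
  note [simp] = source_qcat target_qcat arrow_dist qtyp_fixpoint_cat qhom_fixpoint_cat
  show "qtyp (fixpoint_cat A B \<phi>) \<in> objs (fixpoint_cat A B \<phi>) \<rightarrow>\<^sub>E Ob Q"
    by (auto simp: fixpoint_cat_def decode_code closed_copresheavesD)
  show "qhom (fixpoint_cat A B \<phi>) \<in> (\<Pi>\<^sub>E (x, y)\<in>objs (fixpoint_cat A B \<phi>) \<times> objs (fixpoint_cat A B \<phi>).
      arr (qtyp (fixpoint_cat A B \<phi>) x) (qtyp (fixpoint_cat A B \<phi>) y))"
  proof (rule PiE_I)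
    fix p assume "p \<in> objs (fixpoint_cat A B \<phi>) \<times> objs (fixpoint_cat A B \<phi>)"
    then obtain X \<nu> Y \<xi> where p: "p = (code A B \<phi> (X, \<nu>), code A B \<phi> (Y, \<xi>))"
      "(X, \<nu>) \<in> closed_copresheaves A B \<phi>" "(Y, \<xi>) \<in> closed_copresheaves A B \<phi>"
      by (auto elim!: fixpoint_catE)
    then show "qhom (fixpoint_cat A B \<phi>) p \<in> (case p of (x, y) \<Rightarrow> arr (qtyp (fixpoint_cat A B \<phi>) x) (qtyp (fixpoint_cat A B \<phi>) y))"
      using dist_rimp_arr[of "star Q X" "star Q Y" B "()" "()" \<xi> \<nu>] by (simp add: qtyp_star closed_copresheavesD)
  qed (auto simp: fixpoint_cat_def)
  fix x assume "x \<in> objs (fixpoint_cat A B \<phi>)"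
  then obtain X \<nu> where x [simp]: "(X, \<nu>) \<in> closed_copresheaves A B \<phi>" "x = code A B \<phi> (X, \<nu>)" by (rule fixpoint_catE)
  note [simp] = closed_copresheavesD[OF x(1)]
  show "Idt Q (qtyp (fixpoint_cat A B \<phi>) x) \<preceq>\<^bsub>qtyp (fixpoint_cat A B \<phi>) x\<rightarrow>qtyp (fixpoint_cat A B \<phi>) x\<^esub> qhom (fixpoint_cat A B \<phi>) (x, x)"
    using qhom_le_dist_rimp[of "star Q X" B \<nu> "()" "()"] by (simp add: qtyp_star qhom_star)
  fix y assume "y \<in> objs (fixpoint_cat A B \<phi>)"
  then obtain Y \<xi> where y [simp]: "(Y, \<xi>) \<in> closed_copresheaves A B \<phi>" "y = code A B \<phi> (Y, \<xi>)" by (rule fixpoint_catE)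
  note [simp] = closed_copresheavesD[OF y(1)]
  fix z assume "z \<in> objs (fixpoint_cat A B \<phi>)"
  then obtain Z \<zeta> where z [simp]: "(Z, \<zeta>) \<in> closed_copresheaves A B \<phi>" "z = code A B \<phi> (Z, \<zeta>)" by (rule fixpoint_catE)
  note [simp] = closed_copresheavesD[OF z(1)]
  show "Cmp Q (qtyp (fixpoint_cat A B \<phi>) x) (qtyp (fixpoint_cat A B \<phi>) y) (qtyp (fixpoint_cat A B \<phi>) z)
      (qhom (fixpoint_cat A B \<phi>) (y, z)) (qhom (fixpoint_cat A B \<phi>) (x, y))
    \<preceq>\<^bsub>qtyp (fixpoint_cat A B \<phi>) x\<rightarrow>qtyp (fixpoint_cat A B \<phi>) z\<^esub> qhom (fixpoint_cat A B \<phi>) (x, z)"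
    using dist_rimp_comp_le[of "star Q X" "star Q Y" "star Q Z" B \<nu> \<xi> \<zeta> "()" "()" "()"]
    by (simp add: qtyp_star)
qed

text \<open>The order is reversed: \<open>1 \<le> \<xi> \<searrow> \<nu>\<close> means \<open>\<xi> \<circ> 1 \<le> \<nu>\<close>.\<close>

lemma underlying_le_fixpoint_cat:
  assumes x: "(X, \<nu>) \<in> closed_copresheaves A B \<phi>" and y: "(Y, \<xi>) \<in> closed_copresheaves A B \<phi>"
  shows "underlying_le Q (fixpoint_cat A B \<phi>) (code A B \<phi> (X, \<nu>)) (code A B \<phi> (Y, \<xi>)) \<longleftrightarrow>
    X = Y \<and> \<xi> \<le>\<^bsub>star Q X\<rightarrow>B\<^esub> \<nu>"
proof (cases "Y = X")
  case True
  have y': "(X, \<xi>) \<in> closed_copresheaves A B \<phi>" using y True by simp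
  note [simp] = source_qcat target_qcat arrow_dist closed_copresheavesD[OF x] closed_copresheavesD[OF y']
  have "Idt Q X \<preceq>\<^bsub>X\<rightarrow>X\<^esub> dist_rimp (star Q X) (star Q X) B \<xi> \<nu> ((), ()) \<longleftrightarrow>
      qhom (star Q X) \<le>\<^bsub>star Q X\<rightarrow>star Q X\<^esub> dist_rimp (star Q X) (star Q X) B \<xi> \<nu>"
    by (simp add: dist_le_iff[of "star Q X" "star Q X"] qtyp_star qhom_star)
  also have "\<dots> \<longleftrightarrow> dist_comp Q (star Q X) (star Q X) B \<xi> (qhom (star Q X)) \<le>\<^bsub>star Q X\<rightarrow>B\<^esub> \<nu>"
    by (rule le_dist_rimp_iff) simp_all
  finally show ?thesis
    using qtyp_fixpoint_cat[OF x] qtyp_fixpoint_cat[OF y'] qhom_fixpoint_cat[OF x y'] True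
    by (simp add: underlying_le_def dist_comp_id_right)
next
  case False
  then show ?thesis using qtyp_fixpoint_cat[OF x] qtyp_fixpoint_cat[OF y] by (auto simp: underlying_le_def)
qed

lemma skeletal_fixpoint_cat: "skeletal Q (fixpoint_cat A B \<phi>)"
  unfolding skeletal_def
proof (intro ballI impI)
  fix x y assume le: "underlying_le Q (fixpoint_cat A B \<phi>) x y \<and> underlying_le Q (fixpoint_cat A B \<phi>) y x"
  assume "x \<in> objs (fixpoint_cat A B \<phi>)"
  then obtain X \<nu> where x: "(X, \<nu>) \<in> closed_copresheaves A B \<phi>" "x = code A B \<phi> (X, \<nu>)" by (rule fixpoint_catE)
  assume "y \<in> objs (fixpoint_cat A B \<phi>)"
  then obtain Y \<xi> where y: "(Y, \<xi>) \<in> closed_copresheaves A B \<phi>" "y = code A B \<phi> (Y, \<xi>)" by (rule fixpoint_catE)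
  have XY: "X = Y" and le': "\<xi> \<le>\<^bsub>star Q X\<rightarrow>B\<^esub> \<nu>" "\<nu> \<le>\<^bsub>star Q Y\<rightarrow>B\<^esub> \<xi>"
    using le unfolding x(2) y(2) underlying_le_fixpoint_cat[OF x(1) y(1)] underlying_le_fixpoint_cat[OF y(1) x(1)]
    by blast+
  have "\<nu> = \<xi>"
    using closed_copresheavesD[OF x(1)] closed_copresheavesD[OF y(1)] le' unfolding XY
    by (intro dist_antisym[OF is_qcat_star target_qcat])
  then show "x = y" using x(2) y(2) XY by simp
qed

text \<open>All closed copresheaves at once, as the rows of one distributor from \<open>fixpoint_cat A B \<phi>\<close> to \<open>B\<close>.\<close>

definition tautological :: "'u \<times> 'u \<Rightarrow> 'm" where
  "tautological = (\<lambda>(i, b)\<in>objs (fixpoint_cat A B \<phi>) \<times> objs B. snd (decode A B \<phi> i) ((), b))"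

lemma tautological_code: "(X, \<nu>) \<in> closed_copresheaves A B \<phi> \<Longrightarrow> b \<in> objs B \<Longrightarrow> tautological (code A B \<phi> (X, \<nu>), b) = \<nu> ((), b)"
  by (simp add: tautological_def code_in decode_code)

lemma tautological_dist: "tautological \<in> dist (fixpoint_cat A B \<phi>) B"
proof (rule distI[OF is_qcat_fixpoint_cat target_qcat])
  show "tautological \<in> extensional (objs (fixpoint_cat A B \<phi>) \<times> objs B)" by (simp add: tautological_def)
  fix i b assume "i \<in> objs (fixpoint_cat A B \<phi>)"
  then obtain X \<nu> where i [simp]: "(X, \<nu>) \<in> closed_copresheaves A B \<phi>" "i = code A B \<phi> (X, \<nu>)" by (rule fixpoint_catE)
  note [simp] = source_qcat target_qcat arrow_dist closed_copresheavesD[OF i(1)] qtyp_fixpoint_cat tautological_code qhom_fixpoint_cat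
  assume b [simp]: "b \<in> objs B"
  show "tautological (i, b) \<in> arr (qtyp (fixpoint_cat A B \<phi>) i) (qtyp B b)"
    using dist_arr[of \<nu> "star Q X" B "()" b] by (simp add: qtyp_star)
  show "Cmp Q (qtyp (fixpoint_cat A B \<phi>) i) (qtyp B b) (qtyp B b') (qhom B (b, b')) (tautological (i, b))
      \<preceq>\<^bsub>qtyp (fixpoint_cat A B \<phi>) i\<rightarrow>qtyp B b'\<^esub> tautological (i, b')" if "b' \<in> objs B" for b'
    using that dist_action_left[of "star Q X" B \<nu> "()" b b'] by (simp add: qtyp_star)
  fix i' assume "i' \<in> objs (fixpoint_cat A B \<phi>)"
  then obtain Y \<xi> where i' [simp]: "(Y, \<xi>) \<in> closed_copresheaves A B \<phi>" "i' = code A B \<phi> (Y, \<xi>)" by (rule fixpoint_catE)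
  note [simp] = closed_copresheavesD[OF i'(1)]
  have "dist_comp Q (star Q Y) (star Q X) B \<nu> (dist_rimp (star Q Y) (star Q X) B \<nu> \<xi>) \<le>\<^bsub>star Q Y\<rightarrow>B\<^esub> \<xi>"
    by (simp add: dist_comp_dist_rimp_le)
  then show "Cmp Q (qtyp (fixpoint_cat A B \<phi>) i') (qtyp (fixpoint_cat A B \<phi>) i) (qtyp B b) (tautological (i, b)) (qhom (fixpoint_cat A B \<phi>) (i', i))
      \<preceq>\<^bsub>qtyp (fixpoint_cat A B \<phi>) i'\<rightarrow>qtyp B b\<^esub> tautological (i', b)"
    by (simp add: dist_comp_le_iff qtyp_star)
qed

text \<open>Closedness of all rows, in a form to which the laws for implications apply.\<close>

lemma tautological_eq_dist_limp: "tautological = dist_limp A (fixpoint_cat A B \<phi>) B \<phi> (dist_rimp A (fixpoint_cat A B \<phi>) B tautological \<phi>)"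
proof (rule dist_eqI[of _ "fixpoint_cat A B \<phi>" B])
  note [simp] = source_qcat target_qcat arrow_dist is_qcat_fixpoint_cat tautological_dist
  show "tautological \<in> dist (fixpoint_cat A B \<phi>) B"
    "dist_limp A (fixpoint_cat A B \<phi>) B \<phi> (dist_rimp A (fixpoint_cat A B \<phi>) B tautological \<phi>) \<in> dist (fixpoint_cat A B \<phi>) B" by simp_all
  fix i b assume "i \<in> objs (fixpoint_cat A B \<phi>)"
  then obtain X \<nu> where i: "(X, \<nu>) \<in> closed_copresheaves A B \<phi>" "i = code A B \<phi> (X, \<nu>)" by (rule fixpoint_catE)
  assume b: "b \<in> objs B"
  have "tautological (i, b) = dist_limp A (star Q X) B \<phi> (dist_rimp A (star Q X) B \<nu> \<phi>) ((), b)"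
    using i b by (simp add: tautological_code closed_copresheaves_fixed)
  also have "\<dots> = dist_limp A (fixpoint_cat A B \<phi>) B \<phi> (dist_rimp A (fixpoint_cat A B \<phi>) B tautological \<phi>) (i, b)"
    using i b
    by (intro dist_limp_point_cong dist_rimp_point_cong) (simp_all add: qtyp_star qtyp_fixpoint_cat tautological_code code_in)
  finally show "tautological (i, b) = dist_limp A (fixpoint_cat A B \<phi>) B \<phi> (dist_rimp A (fixpoint_cat A B \<phi>) B tautological \<phi>) (i, b)" .
qed

text \<open>The supremum of \<open>\<theta>\<close> is \<open>\<Lambda> \<swarrow> \<theta>\<close>, with \<open>\<Lambda>\<close> the tautological distributor.  It is closed since
\<open>\<Lambda> = \<phi> \<swarrow> U\<close> gives \<open>\<Lambda> \<swarrow> \<theta> = \<phi> \<swarrow> (\<theta> \<circ> U)\<close>, and it has the universal property since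
\<open>\<zeta> \<searrow> (\<Lambda> \<swarrow> \<theta>) = (\<zeta> \<searrow> \<Lambda>) \<swarrow> \<theta>\<close>, where \<open>\<zeta> \<searrow> \<Lambda>\<close> consists of the hom-arrows into \<open>\<zeta>\<close>.\<close>

lemma complete_fixpoint_cat: "complete_qcat Q (fixpoint_cat A B \<phi>)"
  unfolding complete_qcat_iff[OF is_qcat_fixpoint_cat]
proof (intro ballI)
  note [simp] = source_qcat target_qcat arrow_dist is_qcat_fixpoint_cat tautological_dist
  fix Y \<theta> assume [simp]: "Y \<in> Ob Q" "\<theta> \<in> dist (fixpoint_cat A B \<phi>) (star Q Y)"
  let ?M = "fixpoint_cat A B \<phi>"
  let ?s = "dist_limp ?M (star Q Y) B tautological \<theta>"
  let ?U = "dist_rimp A ?M B tautological \<phi>"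
  have "?s = dist_limp A (star Q Y) B \<phi> (dist_comp Q A ?M (star Q Y) \<theta> ?U)"
    by (subst tautological_eq_dist_limp) (simp add: dist_limp_dist_limp)
  then have s: "(Y, ?s) \<in> closed_copresheaves A B \<phi>"
    by (auto simp: closed_copresheaves_def intro!: exI[of _ "dist_comp Q A ?M (star Q Y) \<theta> ?U"])
  show "\<exists>s\<in>objs ?M. qtyp ?M s = Y \<and>
      (\<forall>y\<in>objs ?M. qhom ?M (s, y) = dist_limp ?M (star Q Y) ?M (qhom ?M) \<theta> ((), y))"
  proof (intro bexI[of _ "code A B \<phi> (Y, ?s)"] conjI ballI)
    fix y assume "y \<in> objs ?M"
    then obtain Z \<zeta> where y: "(Z, \<zeta>) \<in> closed_copresheaves A B \<phi>" "y = code A B \<phi> (Z, \<zeta>)" by (rule fixpoint_catE)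
    note [simp] = closed_copresheavesD[OF y(1)]
    have *: "dist_rimp ?M (star Q Z) B \<zeta> tautological (i, ()) = qhom ?M (i, y)" if i: "i \<in> objs ?M" for i
    proof -
      obtain X \<nu> where i: "(X, \<nu>) \<in> closed_copresheaves A B \<phi>" "i = code A B \<phi> (X, \<nu>)" using i by (rule fixpoint_catE)
      have "dist_rimp ?M (star Q Z) B \<zeta> tautological (i, ()) = dist_rimp (star Q X) (star Q Z) B \<zeta> \<nu> ((), ())"
        using i y by (intro dist_rimp_point_cong) (simp_all add: qtyp_star qtyp_fixpoint_cat tautological_code code_in)
      then show ?thesis using i y by (simp add: qhom_fixpoint_cat)
    qed
    have "qhom ?M (code A B \<phi> (Y, ?s), y) = dist_rimp (star Q Y) (star Q Z) B \<zeta> ?s ((), ())"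
      using s y by (simp add: qhom_fixpoint_cat)
    also have "\<dots> = dist_limp ?M (star Q Y) (star Q Z) (dist_rimp ?M (star Q Z) B \<zeta> tautological) \<theta> ((), ())"
      by (simp add: dist_rimp_dist_limp)
    also have "\<dots> = dist_limp ?M (star Q Y) ?M (qhom ?M) \<theta> ((), y)"
      using y by (intro dist_limp_point_cong) (simp_all add: qtyp_star qtyp_fixpoint_cat code_in *)
    finally show "qhom ?M (code A B \<phi> (Y, ?s), y) = dist_limp ?M (star Q Y) ?M (qhom ?M) \<theta> ((), y)" .
  qed (use s in \<open>auto simp: code_in qtyp_fixpoint_cat\<close>)
qed

lemma fixpoint_cat_Ob: "fixpoint_cat A B \<phi> \<in> Ob (CCat Q)"
  by (simp add: Ob_CCat is_qcat_fixpoint_cat skeletal_fixpoint_cat complete_fixpoint_cat fixpoint_cat_small)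

end

section \<open>Chu connections act by left adjoints\<close>

context
  fixes A B A' B' :: "('u, 'o, 'm) qcat" and \<phi> \<psi> :: "'u \<times> 'u \<Rightarrow> 'm"
  assumes obj: "(A, B, \<phi>) \<in> Ob chucon" and obj': "(A', B', \<psi>) \<in> Ob chucon"
begin

lemma fixpoint_map_code:
  assumes "(X, \<nu>) \<in> closed_copresheaves A' B' \<psi>"
  shows "fixpoint_map A' B' \<psi> A B \<phi> v (code A' B' \<psi> (X, \<nu>)) = code A B \<phi> (X, dist_rimp (star Q X) B B' v \<nu>)"
  using assms by (simp add: fixpoint_map_def code_in[OF obj'] decode_code[OF obj'])

text \<open>The Chu equation moves the implication by \<open>v\<close> past \<open>\<psi>\<close>:
\<open>v \<searrow> (\<psi> \<swarrow> \<mu>) = (v \<searrow> \<psi>) \<swarrow> \<mu> = (\<phi> \<swarrow> u) \<swarrow> \<mu> = \<phi> \<swarrow> (\<mu> \<circ> u)\<close>.\<close>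

lemma chu_connection_closed:
  assumes chu_connection: "chu_connection A B \<phi> A' B' \<psi> u v" and x: "(X, \<nu>) \<in> closed_copresheaves A' B' \<psi>"
  shows "(X, dist_rimp (star Q X) B B' v \<nu>) \<in> closed_copresheaves A B \<phi>"
proof -
  note [simp] = source_qcat[OF obj] target_qcat[OF obj] arrow_dist[OF obj] source_qcat[OF obj'] target_qcat[OF obj'] arrow_dist[OF obj']
  have [simp]: "u \<in> dist A A'" "v \<in> dist B B'" and eq: "dist_limp A A' B \<phi> u = dist_rimp A' B B' v \<psi>"
    using chu_connection by (auto simp: chu_connection_def)
  obtain \<mu> where [simp]: "X \<in> Ob Q" "\<mu> \<in> dist A' (star Q X)" and \<nu>: "\<nu> = dist_limp A' (star Q X) B' \<psi> \<mu>"
    using x by (auto simp: closed_copresheaves_def)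
  have "dist_rimp (star Q X) B B' v \<nu> = dist_limp A' (star Q X) B (dist_limp A A' B \<phi> u) \<mu>"
    by (simp add: \<nu> dist_rimp_dist_limp eq)
  also have "\<dots> = dist_limp A (star Q X) B \<phi> (dist_comp Q A A' (star Q X) \<mu> u)"
    by (simp add: dist_limp_dist_limp)
  finally show ?thesis
    by (auto simp: closed_copresheaves_def intro!: exI[of _ "dist_comp Q A A' (star Q X) \<mu> u"])
qed

text \<open>Without closedness, \<open>\<nu> \<mapsto> v \<searrow> \<nu>\<close> has the right adjoint \<open>\<xi> \<mapsto> v \<circ> \<xi>\<close>, by \<open>\<xi> \<searrow> (v \<searrow> \<nu>) = (v \<circ> \<xi>) \<searrow> \<nu>\<close>.  For closed
\<open>\<nu> = \<psi> \<swarrow> \<mu>\<close> the right-hand side is \<open>((v \<circ> \<xi>) \<searrow> \<psi>) \<swarrow> \<mu>\<close>, which is unchanged when \<open>v \<circ> \<xi>\<close> is replaced by its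
closure.\<close>

lemma left_adjoint_fixpoint_map:
  assumes chu_connection: "chu_connection A B \<phi> A' B' \<psi> u v"
  shows "left_adjoint Q (fixpoint_cat A' B' \<psi>) (fixpoint_cat A B \<phi>) (fixpoint_map A' B' \<psi> A B \<phi> v)"
  unfolding left_adjoint_iff[OF is_qcat_fixpoint_cat[OF obj'] is_qcat_fixpoint_cat[OF obj]]
proof (intro conjI)
  note [simp] = source_qcat[OF obj] target_qcat[OF obj] arrow_dist[OF obj] source_qcat[OF obj'] target_qcat[OF obj'] arrow_dist[OF obj']
  have [simp]: "u \<in> dist A A'" "v \<in> dist B B'" using chu_connection by (auto simp: chu_connection_def)
  let ?F = "fixpoint_map A' B' \<psi> A B \<phi> v"
  show "?F \<in> objs (fixpoint_cat A' B' \<psi>) \<rightarrow>\<^sub>E objs (fixpoint_cat A B \<phi>)"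
  proof (rule PiE_I)
    fix x assume "x \<in> objs (fixpoint_cat A' B' \<psi>)"
    then obtain X \<nu> where "(X, \<nu>) \<in> closed_copresheaves A' B' \<psi>" "x = code A' B' \<psi> (X, \<nu>)" by (rule fixpoint_catE[OF obj'])
    then show "?F x \<in> objs (fixpoint_cat A B \<phi>)"
      by (simp add: fixpoint_map_code code_in[OF obj] chu_connection_closed[OF chu_connection])
  qed (simp add: fixpoint_map_def)
  show "\<forall>x\<in>objs (fixpoint_cat A' B' \<psi>). qtyp (fixpoint_cat A B \<phi>) (?F x) = qtyp (fixpoint_cat A' B' \<psi>) x"
  proof
    fix x assume "x \<in> objs (fixpoint_cat A' B' \<psi>)"
    then obtain X \<nu> where "(X, \<nu>) \<in> closed_copresheaves A' B' \<psi>" "x = code A' B' \<psi> (X, \<nu>)" by (rule fixpoint_catE[OF obj'])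
    then show "qtyp (fixpoint_cat A B \<phi>) (?F x) = qtyp (fixpoint_cat A' B' \<psi>) x"
      by (simp add: fixpoint_map_code qtyp_fixpoint_cat[OF obj] qtyp_fixpoint_cat[OF obj'] chu_connection_closed[OF chu_connection])
  qed
  define cl where "cl = (\<lambda>X \<nu>. dist_limp A' (star Q X) B' \<psi>
     (dist_rimp A' (star Q X) B' (dist_comp Q (star Q X) B B' v \<nu>) \<psi>))"
  define G where "G = (\<lambda>j. code A' B' \<psi> (fst (decode A B \<phi> j), cl (fst (decode A B \<phi> j)) (snd (decode A B \<phi> j))))"
  have G_code: "G (code A B \<phi> (Y, \<xi>)) = code A' B' \<psi> (Y, cl Y \<xi>)" if "(Y, \<xi>) \<in> closed_copresheaves A B \<phi>" for Y \<xi>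
    using that by (simp add: G_def decode_code[OF obj])
  have cl_closed: "(Y, cl Y \<xi>) \<in> closed_copresheaves A' B' \<psi>" if y: "(Y, \<xi>) \<in> closed_copresheaves A B \<phi>" for Y \<xi>
    using closed_copresheavesD[OF obj y]
    by (auto simp: closed_copresheaves_def cl_def
      intro!: exI[of _ "dist_rimp A' (star Q Y) B' (dist_comp Q (star Q Y) B B' v \<xi>) \<psi>"])
  show "\<exists>G. (\<forall>y\<in>objs (fixpoint_cat A B \<phi>). G y \<in> objs (fixpoint_cat A' B' \<psi>) \<and> qtyp (fixpoint_cat A' B' \<psi>) (G y) = qtyp (fixpoint_cat A B \<phi>) y) \<and>
      (\<forall>x\<in>objs (fixpoint_cat A' B' \<psi>). \<forall>y\<in>objs (fixpoint_cat A B \<phi>).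
        qhom (fixpoint_cat A B \<phi>) (?F x, y) = qhom (fixpoint_cat A' B' \<psi>) (x, G y))"
  proof (intro exI[of _ G] conjI ballI)
    fix y assume "y \<in> objs (fixpoint_cat A B \<phi>)"
    then obtain Y \<xi> where y: "(Y, \<xi>) \<in> closed_copresheaves A B \<phi>" "y = code A B \<phi> (Y, \<xi>)" by (rule fixpoint_catE[OF obj])
    note [simp] = closed_copresheavesD[OF obj y(1)]
    show "G y \<in> objs (fixpoint_cat A' B' \<psi>)" "qtyp (fixpoint_cat A' B' \<psi>) (G y) = qtyp (fixpoint_cat A B \<phi>) y"
      using y cl_closed by (simp_all add: G_code code_in[OF obj'] qtyp_fixpoint_cat[OF obj] qtyp_fixpoint_cat[OF obj'])
    fix x assume "x \<in> objs (fixpoint_cat A' B' \<psi>)"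
    then obtain X \<nu> where x: "(X, \<nu>) \<in> closed_copresheaves A' B' \<psi>" "x = code A' B' \<psi> (X, \<nu>)" by (rule fixpoint_catE[OF obj'])
    note [simp] = closed_copresheavesD[OF obj' x(1)]
    let ?w = "dist_comp Q (star Q Y) B B' v \<xi>"
    obtain \<mu> where [simp]: "\<mu> \<in> dist A' (star Q X)" and \<nu>: "\<nu> = dist_limp A' (star Q X) B' \<psi> \<mu>"
      using x(1) by (auto simp: closed_copresheaves_def)
    have [simp]: "cl Y \<xi> \<in> dist (star Q Y) B'"
      using closed_copresheavesD(2)[OF obj' cl_closed[OF y(1)]] .
    have "dist_rimp (star Q X) (star Q Y) B \<xi> (dist_rimp (star Q X) B B' v \<nu>) = dist_rimp (star Q X) (star Q Y) B' ?w \<nu>"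
      by (rule dist_rimp_dist_rimp) simp_all
    also have "\<dots> = dist_limp A' (star Q X) (star Q Y) (dist_rimp A' (star Q Y) B' ?w \<psi>) \<mu>"
      unfolding \<nu> by (rule dist_rimp_dist_limp) simp_all
    also have "\<dots> = dist_limp A' (star Q X) (star Q Y) (dist_rimp A' (star Q Y) B' (cl Y \<xi>) \<psi>) \<mu>"
      by (simp add: cl_def dist_rimp_dist_limp_dist_rimp)
    also have "\<dots> = dist_rimp (star Q X) (star Q Y) B' (cl Y \<xi>) \<nu>"
      unfolding \<nu> by (rule dist_rimp_dist_limp[symmetric]) simp_all
    finally have main: "dist_rimp (star Q X) (star Q Y) B \<xi> (dist_rimp (star Q X) B B' v \<nu>)
        = dist_rimp (star Q X) (star Q Y) B' (cl Y \<xi>) \<nu>" .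
    show "qhom (fixpoint_cat A B \<phi>) (?F x, y) = qhom (fixpoint_cat A' B' \<psi>) (x, G y)"
      using qhom_fixpoint_cat[OF obj chu_connection_closed[OF chu_connection x(1)] y(1)] qhom_fixpoint_cat[OF obj' x(1) cl_closed[OF y(1)]]
      by (simp only: x(2) y(2) fixpoint_map_code[OF x(1)] G_code[OF y(1)] main)
  qed
qed

end

end

context quantaloid
begin

section \<open>Left adjoints as Chu connections of identity distributors\<close>

lemma dist_limp_qhom_self: "is_qcat Q A \<Longrightarrow> dist_limp A A A (qhom A) (qhom A) = qhom A"
  by (simp add: dist_limp_id)

lemma dist_rimp_qhom_self: "is_qcat Q A \<Longrightarrow> dist_rimp A A A (qhom A) (qhom A) = qhom A"
  by (simp add: dist_rimp_id)

lemma dist_comp_point_cong: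
  assumes "qtyp A x = qtyp A' x'" "qtyp C z = qtyp C' z'"
    and "x \<in> objs A" "z \<in> objs C" "x' \<in> objs A'" "z' \<in> objs C'"
    and "\<And>y. y \<in> objs B \<Longrightarrow> \<phi> (x, y) = \<phi>' (x', y)" "\<And>y. y \<in> objs B \<Longrightarrow> \<psi> (y, z) = \<psi>' (y, z')"
  shows "dist_comp Q A B C \<psi> \<phi> (x, z) = dist_comp Q A' B C' \<psi>' \<phi>' (x', z')"
  using assms by (simp add: dist_comp_apply cong: image_cong_simp)

definition graph :: "('a, 'o, 'm) qcat \<Rightarrow> ('b, 'o, 'm) qcat \<Rightarrow> ('a \<Rightarrow> 'b) \<Rightarrow> 'a \<times> 'b \<Rightarrow> 'm" where
  "graph A B F = (\<lambda>(x, y)\<in>objs A \<times> objs B. qhom B (F x, y))"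

definition cograph :: "('a, 'o, 'm) qcat \<Rightarrow> ('b, 'o, 'm) qcat \<Rightarrow> ('a \<Rightarrow> 'b) \<Rightarrow> 'b \<times> 'a \<Rightarrow> 'm" where
  "cograph A B F = (\<lambda>(y, x)\<in>objs B \<times> objs A. qhom B (y, F x))"

lemma graph_dist:
  assumes A: "is_qcat Q A" and B: "is_qcat Q B" and F: "is_qfunctor Q A B F"
  shows "graph A B F \<in> dist A B"
proof (rule distI[OF A B])
  have o [simp]: "x \<in> objs A \<Longrightarrow> F x \<in> objs B" and t: "x \<in> objs A \<Longrightarrow> qtyp A x = qtyp B (F x)"
    and m: "x \<in> objs A \<Longrightarrow> y \<in> objs A \<Longrightarrow> qhom A (x, y) \<preceq>\<^bsub>qtyp A x\<rightarrow>qtyp A y\<^esub> qhom B (F x, F y)" for x y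
    using F by (auto simp: is_qfunctor_def)
  have a: "x \<in> objs A \<Longrightarrow> y \<in> objs A \<Longrightarrow> qhom A (x, y) \<in> arr (qtyp B (F x)) (qtyp B (F y))" for x y
    using qhom_arr[OF A, of x y] by (simp add: t)
  note [simp] = A B
  show "graph A B F \<in> extensional (objs A \<times> objs B)" by (simp add: graph_def)
  fix x y assume [simp]: "x \<in> objs A" "y \<in> objs B"
  show "graph A B F (x, y) \<in> arr (qtyp A x) (qtyp B y)"
    by (simp add: graph_def t)
  show "Cmp Q (qtyp A x) (qtyp B y) (qtyp B y') (qhom B (y, y')) (graph A B F (x, y))
      \<preceq>\<^bsub>qtyp A x\<rightarrow>qtyp B y'\<^esub> graph A B F (x, y')" if "y' \<in> objs B" for y'
    using that by (simp add: graph_def t qhom_trans)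
  fix x' assume [simp]: "x' \<in> objs A"
  have "Cmp Q (qtyp B (F x')) (qtyp B (F x)) (qtyp B y) (qhom B (F x, y)) (qhom A (x', x))
      \<preceq>\<^bsub>qtyp B (F x')\<rightarrow>qtyp B y\<^esub>
      Cmp Q (qtyp B (F x')) (qtyp B (F x)) (qtyp B y) (qhom B (F x, y)) (qhom B (F x', F x))"
    using m[of x' x] by (intro cmp_mono_right) (auto simp: t a)
  then have "Cmp Q (qtyp B (F x')) (qtyp B (F x)) (qtyp B y) (qhom B (F x, y)) (qhom A (x', x))
      \<preceq>\<^bsub>qtyp B (F x')\<rightarrow>qtyp B y\<^esub> qhom B (F x', y)"
    by (rule arr_trans) (auto simp: a cmp_in_hom qhom_trans)
  then show "Cmp Q (qtyp A x') (qtyp A x) (qtyp B y) (graph A B F (x, y)) (qhom A (x', x))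
      \<preceq>\<^bsub>qtyp A x'\<rightarrow>qtyp B y\<^esub> graph A B F (x', y)"
    by (simp add: graph_def t)
qed

lemma cograph_dist:
  assumes A: "is_qcat Q A" and B: "is_qcat Q B" and F: "is_qfunctor Q A B F"
  shows "cograph A B F \<in> dist B A"
proof (rule distI[OF B A])
  have o [simp]: "x \<in> objs A \<Longrightarrow> F x \<in> objs B" and t: "x \<in> objs A \<Longrightarrow> qtyp A x = qtyp B (F x)"
    and m: "x \<in> objs A \<Longrightarrow> y \<in> objs A \<Longrightarrow> qhom A (x, y) \<preceq>\<^bsub>qtyp A x\<rightarrow>qtyp A y\<^esub> qhom B (F x, F y)" for x y
    using F by (auto simp: is_qfunctor_def)
  have a: "x \<in> objs A \<Longrightarrow> y \<in> objs A \<Longrightarrow> qhom A (x, y) \<in> arr (qtyp B (F x)) (qtyp B (F y))" for x y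
    using qhom_arr[OF A, of x y] by (simp add: t)
  note [simp] = A B
  show "cograph A B F \<in> extensional (objs B \<times> objs A)" by (simp add: cograph_def)
  fix y x assume [simp]: "x \<in> objs A" "y \<in> objs B"
  show "cograph A B F (y, x) \<in> arr (qtyp B y) (qtyp A x)"
    by (simp add: cograph_def t)
  show "Cmp Q (qtyp B y') (qtyp B y) (qtyp A x) (cograph A B F (y, x)) (qhom B (y', y))
      \<preceq>\<^bsub>qtyp B y'\<rightarrow>qtyp A x\<^esub> cograph A B F (y', x)" if "y' \<in> objs B" for y'
    using that by (simp add: cograph_def t qhom_trans)
  fix x' assume [simp]: "x' \<in> objs A"
  have "Cmp Q (qtyp B y) (qtyp B (F x)) (qtyp B (F x')) (qhom A (x, x')) (qhom B (y, F x))
      \<preceq>\<^bsub>qtyp B y\<rightarrow>qtyp B (F x')\<^esub>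
      Cmp Q (qtyp B y) (qtyp B (F x)) (qtyp B (F x')) (qhom B (F x, F x')) (qhom B (y, F x))"
    using m[of x x'] by (intro cmp_mono_left) (auto simp: t a)
  then have "Cmp Q (qtyp B y) (qtyp B (F x)) (qtyp B (F x')) (qhom A (x, x')) (qhom B (y, F x))
      \<preceq>\<^bsub>qtyp B y\<rightarrow>qtyp B (F x')\<^esub> qhom B (y, F x')"
    by (rule arr_trans) (auto simp: a cmp_in_hom qhom_trans)
  then show "Cmp Q (qtyp B y) (qtyp A x) (qtyp A x') (qhom A (x, x')) (cograph A B F (y, x))
      \<preceq>\<^bsub>qtyp B y\<rightarrow>qtyp A x'\<^esub> cograph A B F (y, x')"
    by (simp add: cograph_def t)
qed

text \<open>This is the distributor \<open>A(G y, x)\<close> for a right adjoint \<open>G\<close> of \<open>F\<close>, see \<open>left_adjointE\<close>.  The implication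
\<open>A \<swarrow> B(F -, -)\<close> expresses it by \<open>F\<close> alone, which avoids a choice of \<open>G\<close>.\<close>

definition right_adjoint_cograph :: "('a, 'o, 'm) qcat \<Rightarrow> ('b, 'o, 'm) qcat \<Rightarrow> ('a \<Rightarrow> 'b) \<Rightarrow> 'b \<times> 'a \<Rightarrow> 'm" where
  "right_adjoint_cograph A B F = dist_limp A B A (qhom A) (graph A B F)"

text \<open>The last property holds since \<open>B(F -, y) = A(-, G y)\<close> and \<open>A \<swarrow> A(-, G y) = A(G y, -)\<close>.\<close>

lemma left_adjointE:
  assumes A: "is_qcat Q A" and B: "is_qcat Q B" and F: "left_adjoint Q A B F"
  obtains G where "is_qfunctor Q A B F" "F \<in> objs A \<rightarrow>\<^sub>E objs B"
    "\<And>x. x \<in> objs A \<Longrightarrow> F x \<in> objs B"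
    "\<And>x. x \<in> objs A \<Longrightarrow> qtyp B (F x) = qtyp A x"
    "\<And>y. y \<in> objs B \<Longrightarrow> G y \<in> objs A" "\<And>y. y \<in> objs B \<Longrightarrow> qtyp A (G y) = qtyp B y"
    "\<And>x y. x \<in> objs A \<Longrightarrow> y \<in> objs B \<Longrightarrow> qhom A (x, G y) = qhom B (F x, y)"
    "\<And>x y. x \<in> objs A \<Longrightarrow> y \<in> objs B \<Longrightarrow> right_adjoint_cograph A B F (y, x) = qhom A (G y, x)"
proof -
  obtain G where adj: "qadjunction Q A B F G" using F by (auto simp: left_adjoint_def)
  then have F': "is_qfunctor Q A B F" and G: "is_qfunctor Q B A G" by (auto simp: qadjunction_def)
  note hom = qadjunction_hom[OF A B adj]
  have r: "right_adjoint_cograph A B F (y, x) = qhom A (G y, x)" if "x \<in> objs A" "y \<in> objs B" for x y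
  proof -
    have "right_adjoint_cograph A B F (y, x) = dist_limp A A A (qhom A) (qhom A) (G y, x)"
      unfolding right_adjoint_cograph_def using that G hom
      by (intro dist_limp_point_cong) (auto simp: is_qfunctor_def graph_def)
    then show ?thesis using A by (simp add: dist_limp_qhom_self)
  qed
  show ?thesis
    using F' G hom r by (intro that[of G]) (auto simp: is_qfunctor_def)
qed

lemma right_adjoint_cograph_dist:
  assumes "is_qcat Q A" "is_qcat Q B" "left_adjoint Q A B F"
  shows "right_adjoint_cograph A B F \<in> dist B A"
  using assms by (auto simp: right_adjoint_cograph_def left_adjoint_def qadjunction_def intro!: dist_limp_dist graph_dist)

text \<open>By the Yoneda lemma the two sides of the Chu equation are \<open>B(F x, y)\<close> and \<open>A(x, G y)\<close>.\<close>

lemma chu_connection_left_adjoint: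
  assumes A: "is_qcat Q A" and B: "is_qcat Q B" and F: "left_adjoint Q A B F"
  shows "chu_connection B B (qhom B) A A (qhom A) (cograph A B F) (right_adjoint_cograph A B F)"
  using A B F
proof (cases rule: left_adjointE)
  case (1 G)
  note [simp] = A B cograph_dist[OF A B 1(1)] right_adjoint_cograph_dist[OF A B F]
  have "dist_limp B A B (qhom B) (cograph A B F) = dist_rimp A B A (right_adjoint_cograph A B F) (qhom A)"
  proof (rule dist_eqI[of _ A B])
    fix x y assume xy: "x \<in> objs A" "y \<in> objs B"
    have "dist_limp B A B (qhom B) (cograph A B F) (x, y) = dist_limp B B B (qhom B) (qhom B) (F x, y)"
      using xy 1 by (intro dist_limp_point_cong) (auto simp: cograph_def)
    also have "\<dots> = qhom A (x, G y)" using xy 1 by (simp add: dist_limp_qhom_self)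
    also have "\<dots> = dist_rimp A A A (qhom A) (qhom A) (x, G y)" by (simp add: dist_rimp_qhom_self)
    also have "\<dots> = dist_rimp A B A (right_adjoint_cograph A B F) (qhom A) (x, y)"
      using xy 1 by (intro dist_rimp_point_cong) auto
    finally show "dist_limp B A B (qhom B) (cograph A B F) (x, y) = dist_rimp A B A (right_adjoint_cograph A B F) (qhom A) (x, y)" .
  qed simp_all
  then show ?thesis by (simp add: chu_connection_def)
qed

text \<open>The identity distributor of \<open>B\<close>, with \<open>F x\<close> substituted in the second argument, is the cograph of \<open>F\<close>, and
substitution commutes with composition.\<close>

lemma dist_comp_cograph:
  assumes A: "is_qcat Q A" and B: "is_qcat Q B" and C: "is_qcat Q C" and F: "left_adjoint Q A B F"
    and \<psi>: "\<psi> \<in> dist C B" and x: "x \<in> objs A" and z: "z \<in> objs C"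
  shows "dist_comp Q C B A (cograph A B F) \<psi> (z, x) = \<psi> (z, F x)"
  using A B F
proof (cases rule: left_adjointE)
  case (1 G)
  have "dist_comp Q C B A (cograph A B F) \<psi> (z, x) = dist_comp Q C B B (qhom B) \<psi> (z, F x)"
    using x z 1 by (intro dist_comp_point_cong) (auto simp: cograph_def)
  then show ?thesis using B C \<psi> by (simp add: dist_comp_id_left)
qed

lemma cograph_compose:
  assumes A: "is_qcat Q A" and B: "is_qcat Q B" and C: "is_qcat Q C"
    and F: "left_adjoint Q A B F" and H: "left_adjoint Q B C H"
  shows "cograph A C (compose (objs A) H F) = dist_comp Q C B A (cograph A B F) (cograph B C H)"
proof (rule dist_eqI[of _ C A])
  have qf: "is_qfunctor Q A B F" "is_qfunctor Q B C H" "is_qfunctor Q A C (compose (objs A) H F)"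
    using F H left_adjoint_compose[OF A B C F H] by (auto simp: left_adjoint_def qadjunction_def)
  show "cograph A C (compose (objs A) H F) \<in> dist C A"
    "dist_comp Q C B A (cograph A B F) (cograph B C H) \<in> dist C A"
    using qf A B C by (auto intro!: cograph_dist dist_comp_dist)
  fix z x assume zx: "z \<in> objs C" "x \<in> objs A"
  have "F x \<in> objs B" using zx qf by (auto simp: is_qfunctor_def)
  then show "cograph A C (compose (objs A) H F) (z, x) = dist_comp Q C B A (cograph A B F) (cograph B C H) (z, x)"
    using zx dist_comp_cograph[OF A B C F cograph_dist[OF B C qf(2)] zx(2,1)]
    by (simp add: cograph_def compose_eq)
qed

lemma right_adjoint_cograph_compose:
  assumes A: "is_qcat Q A" and B: "is_qcat Q B" and C: "is_qcat Q C"
    and F: "left_adjoint Q A B F" and H: "left_adjoint Q B C H"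
  shows "right_adjoint_cograph A C (compose (objs A) H F) = dist_comp Q C B A (right_adjoint_cograph A B F) (right_adjoint_cograph B C H)"
proof -
  note HF = left_adjoint_compose[OF A B C F H]
  obtain G where G: "\<And>y. y \<in> objs B \<Longrightarrow> G y \<in> objs A" "\<And>y. y \<in> objs B \<Longrightarrow> qtyp A (G y) = qtyp B y"
    "\<And>x y. x \<in> objs A \<Longrightarrow> y \<in> objs B \<Longrightarrow> qhom A (x, G y) = qhom B (F x, y)"
    "\<And>x y. x \<in> objs A \<Longrightarrow> y \<in> objs B \<Longrightarrow> right_adjoint_cograph A B F (y, x) = qhom A (G y, x)"
    "\<And>x. x \<in> objs A \<Longrightarrow> F x \<in> objs B"
    by (rule left_adjointE[OF A B F]) blast
  obtain K where K: "\<And>y. y \<in> objs C \<Longrightarrow> K y \<in> objs B" "\<And>y. y \<in> objs C \<Longrightarrow> qtyp B (K y) = qtyp C y"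
    "\<And>x y. x \<in> objs B \<Longrightarrow> y \<in> objs C \<Longrightarrow> qhom B (x, K y) = qhom C (H x, y)"
    "\<And>x y. x \<in> objs B \<Longrightarrow> y \<in> objs C \<Longrightarrow> right_adjoint_cograph B C H (y, x) = qhom B (K y, x)"
    by (rule left_adjointE[OF B C H]) blast
  show ?thesis
  proof (rule dist_eqI[of _ C A])
    show "right_adjoint_cograph A C (compose (objs A) H F) \<in> dist C A"
      "dist_comp Q C B A (right_adjoint_cograph A B F) (right_adjoint_cograph B C H) \<in> dist C A"
      using A B C F H HF by (auto intro!: right_adjoint_cograph_dist dist_comp_dist)
    fix z x assume zx: "z \<in> objs C" "x \<in> objs A"
    have "dist_comp Q C B A (right_adjoint_cograph A B F) (right_adjoint_cograph B C H) (z, x)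
        = dist_comp Q B B A (right_adjoint_cograph A B F) (qhom B) (K z, x)"
      using zx K by (intro dist_comp_point_cong) auto
    also have "\<dots> = right_adjoint_cograph A B F (K z, x)"
      using right_adjoint_cograph_dist[OF A B F] A B by (simp add: dist_comp_id_right)
    also have "\<dots> = dist_limp A A A (qhom A) (qhom A) (G (K z), x)"
      using zx K G A by (simp add: dist_limp_qhom_self)
    also have "\<dots> = right_adjoint_cograph A C (compose (objs A) H F) (z, x)"
      unfolding right_adjoint_cograph_def using zx K G
      by (intro dist_limp_point_cong) (auto simp: graph_def compose_eq)
    finally show "right_adjoint_cograph A C (compose (objs A) H F) (z, x) =
        dist_comp Q C B A (right_adjoint_cograph A B F) (right_adjoint_cograph B C H) (z, x)" by simp
  qed
qed

lemma graph_id: "is_qcat Q A \<Longrightarrow> graph A A (\<lambda>x\<in>objs A. x) = qhom A"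
  and cograph_id: "is_qcat Q A \<Longrightarrow> cograph A A (\<lambda>x\<in>objs A. x) = qhom A"
  using dist_extensional[OF qhom_dist[of A]]
  by (auto simp: graph_def cograph_def fun_eq_iff extensional_def)

lemma cograph_mono:
  assumes A: "is_qcat Q A" and B: "is_qcat Q B" and F: "left_adjoint Q A B F" and F': "left_adjoint Q A B F'"
    and le: "qfunctor_le Q A B F F'"
  shows "cograph A B F \<le>\<^bsub>B\<rightarrow>A\<^esub> cograph A B F'"
  unfolding dist_le_iff
proof (intro ballI)
  fix y x assume yx: "y \<in> objs B" "x \<in> objs A"
  have "F x \<in> objs B" "F' x \<in> objs B" "qtyp B (F x) = qtyp A x"
    using F F' yx by (auto simp: left_adjoint_def qadjunction_def is_qfunctor_def)
  then show "cograph A B F (y, x) \<preceq>\<^bsub>qtyp B y\<rightarrow>qtyp A x\<^esub> cograph A B F' (y, x)"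
    using yx le qhom_mono_right[OF B, of "F x" "F' x" y] by (simp add: cograph_def qfunctor_le_def)
qed

lemma right_adjoint_cograph_mono:
  assumes A: "is_qcat Q A" and B: "is_qcat Q B" and F: "left_adjoint Q A B F" and F': "left_adjoint Q A B F'"
    and le: "qfunctor_le Q A B F F'"
  shows "right_adjoint_cograph A B F \<le>\<^bsub>B\<rightarrow>A\<^esub> right_adjoint_cograph A B F'"
  unfolding right_adjoint_cograph_def
proof (rule dist_limp_antimono[OF A B A])
  show "graph A B F' \<in> dist A B" "graph A B F \<in> dist A B" "qhom A \<in> dist A A"
    using A B F F' by (auto simp: left_adjoint_def qadjunction_def intro!: graph_dist)
  show "graph A B F' \<le>\<^bsub>A\<rightarrow>B\<^esub> graph A B F"
    unfolding dist_le_iff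
  proof (intro ballI)
    fix x y assume yx: "x \<in> objs A" "y \<in> objs B"
    have "F x \<in> objs B" "F' x \<in> objs B" "qtyp B (F x) = qtyp A x"
      using F F' yx by (auto simp: left_adjoint_def qadjunction_def is_qfunctor_def)
    then show "graph A B F' (x, y) \<preceq>\<^bsub>qtyp A x\<rightarrow>qtyp B y\<^esub> graph A B F (x, y)"
      using yx le qhom_mono_left[OF B, of "F x" "F' x" y] by (simp add: graph_def qfunctor_le_def)
  qed
qed

definition hom_functor :: "(('u, 'o, 'm) qcat, 'u \<Rightarrow> 'u, ('u, 'o, 'm) qcat \<times> ('u, 'o, 'm) qcat \<times> ('u \<times> 'u \<Rightarrow> 'm),
    ('u \<times> 'u \<Rightarrow> 'm) \<times> ('u \<times> 'u \<Rightarrow> 'm)) functor_data" where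
  "hom_functor = \<lparr>on_ob = (\<lambda>A. (A, A, qhom A)), on_hom = (\<lambda>A B F. (cograph A B F, right_adjoint_cograph A B F))\<rparr>"

lemma opposite_simps [simp]:
  "Ob (opposite C) = Ob C" "Hom (opposite C) X Y = Hom C Y X" "Idt (opposite C) = Idt C"
  "Cmp (opposite C) X Y Z g f = Cmp C Z Y X f g"
  by (simp_all add: opposite_def)

lemma hom_arrow_Ob: "A \<in> Ob (CCat Q) \<Longrightarrow> (A, A, qhom A) \<in> Ob chucon"
  by (simp add: Ob_CCat Ob_chucon)

lemma two_functor_hom:
  "two_functor (CCat Q :: (('u, 'o, 'm) qcat, 'u \<Rightarrow> 'u) locat) (opposite chucon) hom_functor"
proof (rule two_functor.intro)
  show "locally_ordered_category (CCat Q :: (('u, 'o, 'm) qcat, 'u \<Rightarrow> 'u) locat)"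
    by (rule CCat_locally_ordered)
  show "locally_ordered_category (opposite chucon)"
    by (intro opposite_locally_ordered chucon_locally_ordered)
  show "two_functor_axioms (CCat Q :: (('u, 'o, 'm) qcat, 'u \<Rightarrow> 'u) locat) (opposite chucon) hom_functor"
  proof (rule two_functor_axioms.intro)
    fix A B C :: "('u, 'o, 'm) qcat" and F F' H
    assume A': "A \<in> Ob (CCat Q)"
    then have A: "is_qcat Q A" by (simp add: Ob_CCat)
    show "on_ob hom_functor A \<in> Ob (opposite chucon)" using A' by (simp add: hom_functor_def hom_arrow_Ob)
    show "on_hom hom_functor A A (Idt (CCat Q) A) = Idt (opposite chucon) (on_ob hom_functor A)"
      using A by (simp add: hom_functor_def Idt_CCat Idt_chucon right_adjoint_cograph_def graph_id cograph_id dist_limp_qhom_self)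
    assume B': "B \<in> Ob (CCat Q)"
    then have B: "is_qcat Q B" by (simp add: Ob_CCat)
    assume "F \<in> carrier (Hom (CCat Q) A B)"
    then have F: "left_adjoint Q A B F" by (simp add: Hom_CCat)
    show "on_hom hom_functor A B F \<in> carrier (Hom (opposite chucon) (on_ob hom_functor A) (on_ob hom_functor B))"
      using Hom_chucon[OF hom_arrow_Ob[OF B'] hom_arrow_Ob[OF A']] chu_connection_left_adjoint[OF A B F] by (simp add: hom_functor_def)
    {
      assume "F' \<in> carrier (Hom (CCat Q) A B)" and le: "F \<sqsubseteq>\<^bsub>Hom (CCat Q) A B\<^esub> F'"
      then have F': "left_adjoint Q A B F'" by (simp add: Hom_CCat)
      show "on_hom hom_functor A B F \<sqsubseteq>\<^bsub>Hom (opposite chucon) (on_ob hom_functor A) (on_ob hom_functor B)\<^esub> on_hom hom_functor A B F'"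
        using le cograph_mono[OF A B F F'] right_adjoint_cograph_mono[OF A B F F']
        by (simp add: hom_functor_def le_CCat le_chucon)
    }
    assume "C \<in> Ob (CCat Q)"
    then have C: "is_qcat Q C" by (simp add: Ob_CCat)
    assume "H \<in> carrier (Hom (CCat Q) B C)"
    then have H: "left_adjoint Q B C H" by (simp add: Hom_CCat)
    show "on_hom hom_functor A C (Cmp (CCat Q) A B C H F) =
        Cmp (opposite chucon) (on_ob hom_functor A) (on_ob hom_functor B) (on_ob hom_functor C) (on_hom hom_functor B C H) (on_hom hom_functor A B F)"
      by (simp add: hom_functor_def Cmp_CCat Cmp_chucon cograph_compose[OF A B C F H] right_adjoint_cograph_compose[OF A B C F H])
  qed
qed

section \<open>The retraction\<close>

text \<open>The inverse bijection of a fully faithful type-preserving bijection is at once a left and a right adjoint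
of it.\<close>

lemma isomorphism_CCatI:
  fixes A B :: "('u, 'o, 'm) qcat"
  assumes A: "is_qcat Q A" and B: "is_qcat Q B" and \<beta>: "bij_betw \<beta> (objs A) (objs B)"
    and t: "\<And>x. x \<in> objs A \<Longrightarrow> qtyp B (\<beta> x) = qtyp A x"
    and hom: "\<And>x y. x \<in> objs A \<Longrightarrow> y \<in> objs A \<Longrightarrow> qhom B (\<beta> x, \<beta> y) = qhom A (x, y)"
  shows "isomorphism (CCat Q) B A (\<lambda>i\<in>objs B. inv_into (objs A) \<beta> i)"
proof -
  let ?g = "\<lambda>i\<in>objs B. inv_into (objs A) \<beta> i" and ?b = "\<lambda>x\<in>objs A. \<beta> x"
  have b: "\<beta> x \<in> objs B" if "x \<in> objs A" for x using \<beta> that by (auto simp: bij_betw_def)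
  have g: "inv_into (objs A) \<beta> i \<in> objs A" "\<beta> (inv_into (objs A) \<beta> i) = i" if "i \<in> objs B" for i
    using \<beta> that by (auto simp: bij_betw_def inv_into_into f_inv_into_f)
  have gb: "inv_into (objs A) \<beta> (\<beta> x) = x" if "x \<in> objs A" for x
    using \<beta> that by (auto simp: bij_betw_def)
  have tg: "qtyp A (inv_into (objs A) \<beta> i) = qtyp B i" if "i \<in> objs B" for i
    using t[OF g(1)[OF that]] g(2)[OF that] by simp
  have "left_adjoint Q B A ?g"
    unfolding left_adjoint_iff[OF B A]
  proof (intro conjI exI[of _ \<beta>] ballI)
    fix i y assume i: "i \<in> objs B" and y: "y \<in> objs A"
    show "qhom A (?g i, y) = qhom B (i, \<beta> y)"
      using hom[OF g(1)[OF i] y] g(2)[OF i] i by simp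
  qed (auto simp: g tg b t)
  moreover have "left_adjoint Q A B ?b"
    unfolding left_adjoint_iff[OF A B]
  proof (intro conjI exI[of _ "inv_into (objs A) \<beta>"] ballI)
    fix i y assume i: "i \<in> objs B" and y: "y \<in> objs A"
    show "qhom B (?b y, i) = qhom A (y, inv_into (objs A) \<beta> i)"
      using hom[OF y g(1)[OF i]] g(2)[OF i] y by simp
  qed (auto simp: g tg b t)
  moreover have "compose (objs B) ?b ?g = (\<lambda>x\<in>objs B. x)" "compose (objs A) ?g ?b = (\<lambda>x\<in>objs A. x)"
    using g b gb by (auto simp: compose_def fun_eq_iff)
  ultimately show ?thesis
    unfolding isomorphism_def by (auto simp: Hom_CCat Cmp_CCat Idt_CCat)
qed

definition corepresentable :: "('a, 'o, 'm) qcat \<Rightarrow> 'a \<Rightarrow> unit \<times> 'a \<Rightarrow> 'm" where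
  "corepresentable A s = (\<lambda>(_, b)\<in>{()} \<times> objs A. qhom A (s, b))"

text \<open>\<open>A(s, -)\<close> is a closed copresheaf of the identity distributor: it is \<open>A \<swarrow> A(-, s)\<close>.\<close>

lemma corepresentable_eq_dist_limp:
  assumes A: "is_qcat Q A" and s: "s \<in> objs A"
  shows "corepresentable A s = dist_limp A (star Q (qtyp A s)) A (qhom A) (representable A s)"
proof (rule extensionalityI[of _ "{()} \<times> objs A"])
  show "corepresentable A s \<in> extensional ({()} \<times> objs A)" by (simp add: corepresentable_def)
  show "dist_limp A (star Q (qtyp A s)) A (qhom A) (representable A s) \<in> extensional ({()} \<times> objs A)"
    by (simp add: dist_limp_def)
  fix p assume "p \<in> {()} \<times> objs A"
  then obtain b where p: "p = ((), b)" "b \<in> objs A" by auto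
  have "corepresentable A s p = dist_limp A A A (qhom A) (qhom A) (s, b)"
    using p A by (simp add: corepresentable_def dist_limp_qhom_self)
  also have "\<dots> = dist_limp A (star Q (qtyp A s)) A (qhom A) (representable A s) ((), b)"
    using p s by (intro dist_limp_point_cong) (auto simp: qtyp_star representable_def)
  finally show "corepresentable A s p = dist_limp A (star Q (qtyp A s)) A (qhom A) (representable A s) p"
    by (simp add: p)
qed

end

context universe_quantaloid
begin

definition fixpoint_functor :: "(('u, 'o, 'm) qcat \<times> ('u, 'o, 'm) qcat \<times> ('u \<times> 'u \<Rightarrow> 'm),
    ('u \<times> 'u \<Rightarrow> 'm) \<times> ('u \<times> 'u \<Rightarrow> 'm), ('u, 'o, 'm) qcat, 'u \<Rightarrow> 'u) functor_data" where
  "fixpoint_functor = \<lparr>on_ob = (\<lambda>(A, B, \<phi>). fixpoint_cat A B \<phi>),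
    on_hom = (\<lambda>(A', B', \<psi>) (A, B, \<phi>) (u, v). fixpoint_map A' B' \<psi> A B \<phi> v)\<rparr>"

lemma fixpoint_map_id:
  assumes obj: "(A, B, \<phi>) \<in> Ob chucon"
  shows "fixpoint_map A B \<phi> A B \<phi> (qhom B) = (\<lambda>x\<in>objs (fixpoint_cat A B \<phi>). x)"
proof (rule extensionalityI[of _ "objs (fixpoint_cat A B \<phi>)"])
  fix x assume x: "x \<in> objs (fixpoint_cat A B \<phi>)"
  then obtain X \<nu> where x': "(X, \<nu>) \<in> closed_copresheaves A B \<phi>" "x = code A B \<phi> (X, \<nu>)" by (rule fixpoint_catE[OF obj])
  have "dist_rimp (star Q X) B B (qhom B) \<nu> = \<nu>"
    using closed_copresheavesD[OF obj x'(1)] target_qcat[OF obj] by (simp add: dist_rimp_id)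
  then show "fixpoint_map A B \<phi> A B \<phi> (qhom B) x = (\<lambda>x\<in>objs (fixpoint_cat A B \<phi>). x) x"
    using x x' by (simp add: fixpoint_map_code[OF obj obj])
qed (auto simp: fixpoint_map_def)

lemma fixpoint_map_comp:
  assumes X: "(A, B, \<phi>) \<in> Ob chucon" and Y: "(A', B', \<psi>) \<in> Ob chucon" and Z: "(A'', B'', \<chi>) \<in> Ob chucon"
    and f: "chu_connection A' B' \<psi> A B \<phi> u v" and g: "chu_connection A'' B'' \<chi> A' B' \<psi> u' v'"
  shows "fixpoint_map A B \<phi> A'' B'' \<chi> (dist_comp Q B'' B' B v v') =
    compose (objs (fixpoint_cat A B \<phi>)) (fixpoint_map A' B' \<psi> A'' B'' \<chi> v') (fixpoint_map A B \<phi> A' B' \<psi> v)"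
proof (rule extensionalityI[of _ "objs (fixpoint_cat A B \<phi>)"])
  fix x assume x: "x \<in> objs (fixpoint_cat A B \<phi>)"
  then obtain X \<nu> where x': "(X, \<nu>) \<in> closed_copresheaves A B \<phi>" "x = code A B \<phi> (X, \<nu>)" by (rule fixpoint_catE[OF X])
  have "dist_rimp (star Q X) B'' B' v' (dist_rimp (star Q X) B' B v \<nu>) = dist_rimp (star Q X) B'' B (dist_comp Q B'' B' B v v') \<nu>"
    using closed_copresheavesD[OF X x'(1)] target_qcat[OF X] target_qcat[OF Y] target_qcat[OF Z] f g
    by (intro dist_rimp_dist_rimp) (auto simp: chu_connection_def)
  then show "fixpoint_map A B \<phi> A'' B'' \<chi> (dist_comp Q B'' B' B v v') x =
    compose (objs (fixpoint_cat A B \<phi>)) (fixpoint_map A' B' \<psi> A'' B'' \<chi> v') (fixpoint_map A B \<phi> A' B' \<psi> v) x"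
    using x fixpoint_map_code[OF Z X x'(1)] fixpoint_map_code[OF Y X x'(1)] fixpoint_map_code[OF Z Y chu_connection_closed[OF Y X f x'(1)]]
    by (simp add: compose_eq x'(2))
qed (auto simp: fixpoint_map_def compose_def)

lemma fixpoint_map_mono:
  assumes X: "(A, B, \<phi>) \<in> Ob chucon" and Y: "(A', B', \<psi>) \<in> Ob chucon"
    and f: "chu_connection A' B' \<psi> A B \<phi> u v" and g: "chu_connection A' B' \<psi> A B \<phi> u' v'" and le: "v \<le>\<^bsub>B'\<rightarrow>B\<^esub> v'"
  shows "qfunctor_le Q (fixpoint_cat A B \<phi>) (fixpoint_cat A' B' \<psi>) (fixpoint_map A B \<phi> A' B' \<psi> v) (fixpoint_map A B \<phi> A' B' \<psi> v')"
  unfolding qfunctor_le_def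
proof
  fix x assume "x \<in> objs (fixpoint_cat A B \<phi>)"
  then obtain X \<nu> where x: "(X, \<nu>) \<in> closed_copresheaves A B \<phi>" "x = code A B \<phi> (X, \<nu>)" by (rule fixpoint_catE[OF X])
  have "dist_rimp (star Q X) B' B v' \<nu> \<le>\<^bsub>star Q X\<rightarrow>B'\<^esub> dist_rimp (star Q X) B' B v \<nu>"
    using closed_copresheavesD[OF X x(1)] target_qcat[OF X] target_qcat[OF Y] f g le
    by (intro dist_rimp_antimono) (auto simp: chu_connection_def)
  then show "underlying_le Q (fixpoint_cat A' B' \<psi>) (fixpoint_map A B \<phi> A' B' \<psi> v x) (fixpoint_map A B \<phi> A' B' \<psi> v' x)"
    unfolding x(2) fixpoint_map_code[OF Y X x(1)]
      underlying_le_fixpoint_cat[OF Y chu_connection_closed[OF Y X f x(1)] chu_connection_closed[OF Y X g x(1)]] by simp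
qed

lemma two_functor_fixpoint:
  "two_functor (opposite chucon) (CCat Q :: (('u, 'o, 'm) qcat, 'u \<Rightarrow> 'u) locat) fixpoint_functor"
proof (rule two_functor.intro)
  show "locally_ordered_category (CCat Q :: (('u, 'o, 'm) qcat, 'u \<Rightarrow> 'u) locat)"
    by (rule CCat_locally_ordered)
  show "locally_ordered_category (opposite chucon)"
    by (intro opposite_locally_ordered chucon_locally_ordered)
  show "two_functor_axioms (opposite chucon) (CCat Q :: (('u, 'o, 'm) qcat, 'u \<Rightarrow> 'u) locat) fixpoint_functor"
  proof (rule two_functor_axioms.intro, unfold opposite_simps)
    fix X Y Z :: "('u, 'o, 'm) qcat \<times> ('u, 'o, 'm) qcat \<times> ('u \<times> 'u \<Rightarrow> 'm)" and f f' g
    assume X': "X \<in> Ob chucon"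
    obtain A B \<phi> where [simp]: "X = (A, B, \<phi>)" by (metis prod_cases3)
    note X = X'[simplified]
    show "on_ob fixpoint_functor X \<in> Ob (CCat Q)" by (simp add: fixpoint_functor_def fixpoint_cat_Ob[OF X])
    show "on_hom fixpoint_functor X X (Idt chucon X) = Idt (CCat Q) (on_ob fixpoint_functor X)"
      by (simp add: fixpoint_functor_def Idt_chucon Idt_CCat fixpoint_map_id[OF X])
    assume Y': "Y \<in> Ob chucon"
    obtain A' B' \<psi> where [simp]: "Y = (A', B', \<psi>)" by (metis prod_cases3)
    note Y = Y'[simplified]
    assume f: "f \<in> carrier (Hom chucon Y X)"
    obtain u v where [simp]: "f = (u, v)" by (metis surj_pair)
    have uv: "chu_connection A' B' \<psi> A B \<phi> u v" using f Hom_chucon[OF Y X] by simp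
    show "on_hom fixpoint_functor X Y f \<in> carrier (Hom (CCat Q) (on_ob fixpoint_functor X) (on_ob fixpoint_functor Y))"
      by (simp add: fixpoint_functor_def Hom_CCat left_adjoint_fixpoint_map[OF Y X uv])
    {
      assume f': "f' \<in> carrier (Hom chucon Y X)" and le: "f \<sqsubseteq>\<^bsub>Hom chucon Y X\<^esub> f'"
      obtain u' v' where [simp]: "f' = (u', v')" by (metis surj_pair)
      have uv': "chu_connection A' B' \<psi> A B \<phi> u' v'" using f' Hom_chucon[OF Y X] by simp
      show "on_hom fixpoint_functor X Y f \<sqsubseteq>\<^bsub>Hom (CCat Q) (on_ob fixpoint_functor X) (on_ob fixpoint_functor Y)\<^esub> on_hom fixpoint_functor X Y f'"
        using le fixpoint_map_mono[OF X Y uv uv'] by (simp add: fixpoint_functor_def le_CCat le_chucon)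
    }
    assume Z': "Z \<in> Ob chucon"
    obtain A'' B'' \<chi> where [simp]: "Z = (A'', B'', \<chi>)" by (metis prod_cases3)
    note Z = Z'[simplified]
    assume g: "g \<in> carrier (Hom chucon Z Y)"
    obtain u' v' where [simp]: "g = (u', v')" by (metis surj_pair)
    have uv': "chu_connection A'' B'' \<chi> A' B' \<psi> u' v'" using g Hom_chucon[OF Z Y] by simp
    show "on_hom fixpoint_functor X Z (Cmp chucon Z Y X f g) =
        Cmp (CCat Q) (on_ob fixpoint_functor X) (on_ob fixpoint_functor Y) (on_ob fixpoint_functor Z) (on_hom fixpoint_functor Y Z g) (on_hom fixpoint_functor X Y f)"
      by (simp add: fixpoint_functor_def Cmp_chucon Cmp_CCat fixpoint_map_comp[OF X Y Z uv uv'])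
  qed
qed

text \<open>The component at \<open>A\<close> of the isomorphism, in the direction from \<open>A\<close> to \<open>M (J A)\<close>: the object \<open>s\<close> goes to \<open>A(s, -)\<close>.\<close>

definition embed :: "('u, 'o, 'm) qcat \<Rightarrow> 'u \<Rightarrow> 'u" where
  "embed A s = code A A (qhom A) (qtyp A s, corepresentable A s)"

context
  fixes A :: "('u, 'o, 'm) qcat"
  assumes A: "A \<in> Ob (CCat Q)"
begin

lemma CCat_is_qcat: "is_qcat Q A" using A by (simp add: Ob_CCat)

lemma corepresentable_closed:
  "s \<in> objs A \<Longrightarrow> (qtyp A s, corepresentable A s) \<in> closed_copresheaves A A (qhom A)"
  using CCat_is_qcat by (auto simp: closed_copresheaves_def corepresentable_eq_dist_limp intro!: exI[of _ "representable A s"])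

text \<open>Completeness of \<open>A\<close> is used here: the closed copresheaf \<open>A \<swarrow> \<mu>\<close> is corepresented by the supremum of \<open>\<mu>\<close>.\<close>

lemma closed_corepresentable:
  assumes "p \<in> closed_copresheaves A A (qhom A)"
  obtains s where "s \<in> objs A" "p = (qtyp A s, corepresentable A s)"
proof -
  obtain X \<mu> where p: "X \<in> Ob Q" "\<mu> \<in> dist A (star Q X)" "p = (X, dist_limp A (star Q X) A (qhom A) \<mu>)"
    using assms by (auto simp: closed_copresheaves_def)
  obtain s where s: "s \<in> objs A" "qtyp A s = X"
    "\<And>y. y \<in> objs A \<Longrightarrow> qhom A (s, y) = dist_limp A (star Q X) A (qhom A) \<mu> ((), y)"
    using A p complete_qcat_iff[OF CCat_is_qcat] unfolding Ob_CCat by blast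
  have "corepresentable A s = dist_limp A (star Q X) A (qhom A) \<mu>"
  proof (rule extensionalityI[of _ "{()} \<times> objs A"])
    show "corepresentable A s p = dist_limp A (star Q X) A (qhom A) \<mu> p" if "p \<in> {()} \<times> objs A" for p
      using that s by (auto simp: corepresentable_def)
  qed (auto simp: corepresentable_def dist_limp_def)
  then show ?thesis using that s p by auto
qed

lemma qtyp_embed: "s \<in> objs A \<Longrightarrow> qtyp (fixpoint_cat A A (qhom A)) (embed A s) = qtyp A s"
  unfolding embed_def by (rule qtyp_fixpoint_cat[OF hom_arrow_Ob[OF A] corepresentable_closed])

lemma qhom_embed:
  assumes s: "s \<in> objs A" and t: "t \<in> objs A"
  shows "qhom (fixpoint_cat A A (qhom A)) (embed A s, embed A t) = qhom A (s, t)"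
proof -
  have "qhom (fixpoint_cat A A (qhom A)) (embed A s, embed A t) =
      dist_rimp (star Q (qtyp A s)) (star Q (qtyp A t)) A (corepresentable A t) (corepresentable A s) ((), ())"
    unfolding embed_def by (rule qhom_fixpoint_cat[OF hom_arrow_Ob[OF A] corepresentable_closed[OF s] corepresentable_closed[OF t]])
  also have "\<dots> = dist_rimp A A A (qhom A) (qhom A) (s, t)"
    using s t by (intro dist_rimp_point_cong) (auto simp: qtyp_star corepresentable_def)
  finally show ?thesis using CCat_is_qcat by (simp add: dist_rimp_qhom_self)
qed

lemma bij_embed: "bij_betw (embed A) (objs A) (objs (fixpoint_cat A A (qhom A)))"
  unfolding bij_betw_def
proof
  show "inj_on (embed A) (objs A)"
  proof (rule inj_onI)
    fix s t assume st: "s \<in> objs A" "t \<in> objs A" "embed A s = embed A t"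
    have "qtyp A s = qtyp A t" using qtyp_embed[OF st(1)] qtyp_embed[OF st(2)] st(3) by simp
    moreover have "qhom A (s, z) = qhom A (t, z)" if "z \<in> objs A" for z
      using qhom_embed[OF st(1) that] qhom_embed[OF st(2) that] st(3) by simp
    moreover have "skeletal Q A" using A by (simp add: Ob_CCat)
    ultimately show "s = t" using skeletal_eqI[OF CCat_is_qcat] st by blast
  qed
  show "embed A ` objs A = objs (fixpoint_cat A A (qhom A))"
    unfolding objs_fixpoint_cat[OF hom_arrow_Ob[OF A]] embed_def
    by (auto intro: corepresentable_closed elim: closed_corepresentable)
qed

lemma inv_embed: "s \<in> objs A \<Longrightarrow> inv_into (objs A) (embed A) (embed A s) = s"
  using bij_embed by (auto simp: bij_betw_def)

lemma embed_in: "s \<in> objs A \<Longrightarrow> embed A s \<in> objs (fixpoint_cat A A (qhom A))"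
  using bij_embed by (auto simp: bij_betw_def)

end

text \<open>The action of \<open>F\<close> on \<open>A(s, -)\<close> is \<open>A(G y, -) \<searrow> A(s, -) = A(s, G y) = B(F s, y)\<close>.\<close>

lemma embed_natural:
  assumes A: "A \<in> Ob (CCat Q)" and B: "B \<in> Ob (CCat Q)" and F: "left_adjoint Q A B F" and s: "s \<in> objs A"
  shows "fixpoint_map A A (qhom A) B B (qhom B) (right_adjoint_cograph A B F) (embed A s) = embed B (F s)"
  using CCat_is_qcat[OF A] CCat_is_qcat[OF B] F
proof (cases rule: left_adjointE)
  case (1 G)
  note [simp] = CCat_is_qcat[OF A] CCat_is_qcat[OF B]
  have "dist_rimp (star Q (qtyp A s)) B A (right_adjoint_cograph A B F) (corepresentable A s) = corepresentable B (F s)"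
  proof (rule extensionalityI[of _ "{()} \<times> objs B"])
    fix p assume "p \<in> {()} \<times> objs B"
    then obtain y where p: "p = ((), y)" "y \<in> objs B" by auto
    have "dist_rimp (star Q (qtyp A s)) B A (right_adjoint_cograph A B F) (corepresentable A s) ((), y)
        = dist_rimp A A A (qhom A) (qhom A) (s, G y)"
      using 1 s p by (intro dist_rimp_point_cong) (auto simp: qtyp_star corepresentable_def)
    then show "dist_rimp (star Q (qtyp A s)) B A (right_adjoint_cograph A B F) (corepresentable A s) p = corepresentable B (F s) p"
      using 1 s p by (simp add: dist_rimp_qhom_self corepresentable_def)
  qed (auto simp: dist_rimp_def corepresentable_def)
  then show ?thesis
    using 1 s fixpoint_map_code[OF hom_arrow_Ob[OF B] hom_arrow_Ob[OF A] corepresentable_closed[OF A s]]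
    by (simp add: embed_def)
qed

text \<open>The natural isomorphism from \<open>M J\<close> to the identity is the inverse of \<open>embed\<close>, so its naturality follows
from that of \<open>embed\<close>.\<close>

lemma fixpoint_hom_iso_id:
  "naturally_isomorphic (CCat Q) (CCat Q) (comp_functor fixpoint_functor hom_functor) id_functor"
  unfolding naturally_isomorphic_def
proof (intro exI[of _ "\<lambda>A. \<lambda>i\<in>objs (fixpoint_cat A A (qhom A)). inv_into (objs A) (embed A) i"] conjI ballI)
  fix A :: "('u, 'o, 'm) qcat" assume A: "A \<in> Ob (CCat Q)"
  have "isomorphism (CCat Q) (fixpoint_cat A A (qhom A)) A (\<lambda>i\<in>objs (fixpoint_cat A A (qhom A)). inv_into (objs A) (embed A) i)"
    by (rule isomorphism_CCatI)
      (use CCat_is_qcat[OF A] is_qcat_fixpoint_cat[OF hom_arrow_Ob[OF A]] bij_embed[OF A] qtyp_embed[OF A] qhom_embed[OF A] in auto)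
  then show "isomorphism (CCat Q) (on_ob (comp_functor fixpoint_functor hom_functor) A) (on_ob id_functor A)
      (\<lambda>i\<in>objs (fixpoint_cat A A (qhom A)). inv_into (objs A) (embed A) i)"
    by (simp add: comp_functor_def id_functor_def fixpoint_functor_def hom_functor_def)
next
  fix A B :: "('u, 'o, 'm) qcat" and F
  assume A: "A \<in> Ob (CCat Q)" and B: "B \<in> Ob (CCat Q)" and F': "F \<in> carrier (Hom (CCat Q) A B)"
  then have F: "left_adjoint Q A B F" by (simp add: Hom_CCat)
  let ?M = "\<lambda>A. fixpoint_cat A A (qhom A)"
  let ?\<alpha> = "\<lambda>A. \<lambda>i\<in>objs (?M A). inv_into (objs A) (embed A) i"
  let ?F = "fixpoint_map A A (qhom A) B B (qhom B) (right_adjoint_cograph A B F)"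
  have "compose (objs (?M A)) (?\<alpha> B) ?F = compose (objs (?M A)) F (?\<alpha> A)"
  proof (rule extensionalityI[of _ "objs (?M A)"])
    fix i assume "i \<in> objs (?M A)"
    then obtain s where s: "s \<in> objs A" "i = embed A s"
      using bij_embed[OF A] by (auto simp: bij_betw_def)
    have "F s \<in> objs B" using left_adjoint_PiE[OF F] s by auto
    then show "compose (objs (?M A)) (?\<alpha> B) ?F i = compose (objs (?M A)) F (?\<alpha> A) i"
      using s by (simp add: compose_eq embed_in[OF A] embed_in[OF B] embed_natural[OF A B F] inv_embed[OF A] inv_embed[OF B])
  qed (auto simp: compose_def)
  then show "Cmp (CCat Q) (on_ob (comp_functor fixpoint_functor hom_functor) A) (on_ob (comp_functor fixpoint_functor hom_functor) B) (on_ob id_functor B)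
      (?\<alpha> B) (on_hom (comp_functor fixpoint_functor hom_functor) A B F)
    = Cmp (CCat Q) (on_ob (comp_functor fixpoint_functor hom_functor) A) (on_ob id_functor A) (on_ob id_functor B)
      (on_hom id_functor A B F) (?\<alpha> A)"
    by (simp add: comp_functor_def id_functor_def fixpoint_functor_def hom_functor_def Cmp_CCat)
qed

end

theorem theorem3p3p3:
  fixes Q :: "('o, 'm) locat"
  assumes "set_universe TYPE('u)" and "small_quantaloid TYPE('u) Q"
  shows "\<exists>J M.
    two_functor (CCat Q :: (('u, 'o, 'm) qcat, 'u \<Rightarrow> 'u) locat)
      (opposite (ChuCon (Dist Q :: (('u, 'o, 'm) qcat, 'u \<times> 'u \<Rightarrow> 'm) locat))) J \<and>
    two_functor (opposite (ChuCon (Dist Q :: (('u, 'o, 'm) qcat, 'u \<times> 'u \<Rightarrow> 'm) locat)))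
      (CCat Q :: (('u, 'o, 'm) qcat, 'u \<Rightarrow> 'u) locat) M \<and>
    naturally_isomorphic (CCat Q :: (('u, 'o, 'm) qcat, 'u \<Rightarrow> 'u) locat)
      (CCat Q :: (('u, 'o, 'm) qcat, 'u \<Rightarrow> 'u) locat) (comp_functor M J) id_functor"
proof -
  interpret quantaloid Q using assms(2) by (simp add: small_quantaloid_def)
  interpret universe_quantaloid Q "TYPE('u)"
    using assms by unfold_locales
  show ?thesis
    using two_functor_hom two_functor_fixpoint fixpoint_hom_iso_id by blast
qed

end
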